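(* Let $P\in\mathbb B(V)$ be an umbral operator and let $(P_n(\omega))_{n=0}^\infty$ be the corresponding binomial sequence, with generating function $\sum_{n=0}^\infty\frac1{n!}\langle P_n(\omega),v^{\otimes n}\rangle=\exp[\langle\omega,B(v)\rangle]$, where $B(v)\in\mathcal F_1(V)$. Let $Q$ be the corresponding lowering differential and let $L(v)=B^{\langle-1\rangle}(v)$. Let $S=[S_{kn}]_{k,n\in\mathbb N_0}\in\mathbb P(V)$ and let $(S_n(\omega))_{n=0}^\infty$ be the corresponding polynomial sequence. The following conditions are equivalent: (S1) There exists $A(v)\in\mathcal F_0(V)$ such that $\sum_{n=0}^\infty\frac1{n!}\langle S_n(\omega),v^{\otimes n}\rangle=\exp[\langle\omega,B(v)\rangle]A(v)$ for all $\omega\in V^*$ (hence $(S_n(\omega))_{n=0}^\infty$ is a Sheffer sequence). (S2) The linear operator $T:=PS^{-1}\in\mathcal L(\mathcal P(V^* ))$, i.e., the operator satisfying $T\langle S_n(\cdot),f_n\rangle=\langle P_n(\cdot),f_n\rangle$ for all $n\in\mathbb N_0$, $f_n\in V^{\odot n}$, is shift-invariant. (S3) $Q$ is the lowering differential for the polynomial sequence $(S_n(\omega))_{n=0}^\infty$. (S4) For all $\omega,\theta\in V^*$ and $n\in\mathbb N$, $S_n(\omega+\theta)=\sum_{k=0}^n\binom nkS_k(\omega)\odot P_{n-k}(\theta)$. (S5) There exists $\rho(v)=\sum_{k=0}^\infty\langle\rho_k,v^{\otimes k}\rangle\in\mathcal F_0(V)$ such that, for all $\omega\in V^*$ and $n\in\mathbb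 N_0$, $S_n(\omega)=\sum_{k=0}^n\binom nk\rho_k\odot P_{n-k}(\omega)$. (S6) There exists $A(v)\in\mathcal F_0(V)$ such that, for each $k\in\mathbb N_0$, $\sum_{n=k}^\infty\frac{k!}{n!}S_{kn}v^{\otimes n}=B(v)^{\otimes k}A(v)$ (equality of formal tensor power series in $\mathcal F(V,V^{\odot k})$). Furthermore, the formal tensor power series $A(v)=\sum_{k=0}^\infty\langle A_k,v^{\otimes k}\rangle\in\mathcal F_0(V)$ in (S1) and (S6) are the same, the series $\rho(v)$ in (S5) has the form $\rho(v)=\sum_{k=0}^\infty\langle k!\,A_k,v^{\otimes k}\rangle$ (i.e., $\rho_k=k!\,A_k$), and the operator $T$ in (S2) is given by $T=\tau(D)$, where $\tau(v):=A^{-1}(B^{\langle-1\rangle}(v))=A^{-1}(L(v))\in\mathcal F_0(V)$.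
   Context: $\mathbb F=\mathbb R$ or $\mathbb C$; $V$ is a vector space over $\mathbb F$ (of any dimension); $V^*$ is its algebraic dual; $\langle\cdot,\cdot\rangle$ denotes the dual pairing (also between $(V^{\odot n})^*$ and $V^{\odot n}$). $\mathbb N=\{1,2,\dots\}$, $\mathbb N_0=\mathbb N\cup\{0\}$. $\mathcal L(U,W)$ is the space of linear operators from $U$ to $W$, $\mathcal L(U)=\mathcal L(U,U)$. $V^{\odot n}$ is the $n$th algebraic symmetric tensor power of $V$, the linear span of the vectors $v_1\odot\dots\odot v_n=\frac1{n!}\sum_{\pi\in S_n}v_{\pi(1)}\otimes\dots\otimes v_{\pi(n)}$ (equivalently, of the vectors $v^{\otimes n}$, $v\in V$); $V^{\odot 0}=\mathbb F$, $v^{\otimes 0}=1$. For $\omega\in V^*$, $\omega^{\otimes n}\in(V^{\odot n})^*$ is given by $\langle\omega^{\otimes n},v_1\odot\dots\odot v_n\rangle=\prod_i\langle\omega,v_i\rangle$, and $\omega^{\otimes 0}=1$. For linear operators (or functionals) $A_i$ on $V^{\odot l_i}$, $m=l_1+\dots+l_n$, the operator $A_1\odot\dots\odot A_n$ on $V^{\odot m}$ is determined by $(A_1\odot\dots\odot A_n)v^{\otimes m}=(A_1v^{\otimes l_1})\odot\dots\odot(A_nv^{\otimes l_n})$ (scalar-valued factors act by multiplication). Polynomials: $\mathcal P(V^* )$ is the vector space of functions $p:V^*\to\mathbb F$ of the form $p(\omega)=\sum_{k=0}^n\langle\omega^{\otimes k},f_k\rangle$ with $f_k\in V^{\odot k}$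 (uniquely determined by $p$). $\mathcal P(V^*,W)$ is the linear span of the functions $\omega\mapsto p(\omega)w$, $p\in\mathcal P(V^* )$, $w\in W$. $(E(\theta)p)(\omega)=p(\omega+\theta)$ and $(D(\theta)p)(\omega)=\frac{d}{dt}\big|_{t=0}p(\omega+t\theta)$, $\theta\in V^*$. $T\in\mathcal L(\mathcal P(V^* ))$ is shift-invariant if $TE(\theta)=E(\theta)T$ for all $\theta\in V^*$. Polynomial sequences: $\mathbb P(V)$ is the set of operators $P\in\mathcal L(\mathcal P(V^* ))$ of the form $(P\langle\cdot^{\otimes n},f_n\rangle)(\omega)=\sum_{k=0}^n\langle\omega^{\otimes k},P_{kn}f_n\rangle$ for $f_n\in V^{\odot n}$, $n\in\mathbb N_0$, with $P_{kn}\in\mathcal L(V^{\odot n},V^{\odot k})$ and each $P_{nn}$ bijective; one writes $P=[P_{kn}]_{k,n\in\mathbb N_0}$ with $P_{kn}=0$ for $k>n$. Such $P$ is a bijection. The corresponding polynomial sequence, $P_n(\omega)\in(V^{\odot n})^*$, is defined by $\langle P_n(\omega),f_n\rangle=(P\langle\cdot^{\otimes n},f_n\rangle)(\omega)$. The lowering differential for $P$ (or for its polynomial sequence) is the operator $Q\in\mathcal L(\mathcal P(V^* ),\mathcal P(V^*,V))$ determined by $\langle\theta,(Qp)(\omega)\rangle=(PD(\theta)P^{-1}p)(\omega)$ for all $\theta\in V^*$. $P$ is an umbral operator ($P\in\mathbb B(V)$) and $(P_n(\omega))$ is a binomial sequence if $P_0=1$ and $P_n(\omega+\theta)=\sum_{k=0}^n\binom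 nkP_k(\omega)\odot P_{n-k}(\theta)$ for all $\omega,\theta\in V^*$, $n\in\mathbb N$; every binomial sequence has generating function $\exp[\langle\omega,B(v)\rangle]$ for a unique $B(v)\in\mathcal F_1(V)$. A Sheffer sequence is a polynomial sequence with generating function $\exp[\langle\omega,B(v)\rangle]A(v)$ with $B(v)\in\mathcal F_1(V)$, $A(v)\in\mathcal F_0(V)$. $D^k\in\mathcal L(\mathcal P(V^* ),\mathcal P(V^*,V^{\odot k}))$ is determined by $(D^k\langle\cdot^{\otimes n},v^{\otimes n}\rangle)(\omega)=n(n-1)\dotsm(n-k+1)\langle\omega,v\rangle^{n-k}v^{\otimes k}$ (zero if $k>n$). For $\tau(v)=\tau_0+\sum_{k\ge1}\langle\tau_k,v^{\otimes k}\rangle\in\mathcal F(V,\mathbb F)$, $\tau(D)\in\mathcal L(\mathcal P(V^* ))$ is $(\tau(D)p)(\omega)=\tau_0p(\omega)+\sum_{k\ge1}\langle\tau_k,(D^kp)(\omega)\rangle$ (a finite sum for each $p$). Formal tensor power series: $\mathcal F(V,W)$ is the set of formal series $A(v)=A_0+\sum_{n\ge1}A_nv^{\otimes n}$ with $A_0\in W$, $A_n\in\mathcal L(V^{\odot n},W)$, identified with the coefficient sequence; $A(0)=A_0$; for $W=\mathbb F$ one writes $\langle A_n,v^{\otimes n}\rangle$. The product of $A^{(1)}(v)\in\mathcal F(V,\mathbb F)$ and $A^{(2)}(v)\in\mathcal F(V,W)$ has $n$th coefficient $\sum_{k=0}^nA_k^{(1)}\odot A_{n-k}^{(2)}$. $\langle\omega,B(v)\rangle=\sum_n\langle\omega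 B_n,v^{\otimes n}\rangle$, where $\omega B_n$ is the composition of $\omega$ and $B_n$; $\exp[C(v)]=\sum_{k\ge0}\frac1{k!}C(v)^k$ when $C(0)=0$. For $B(v)\in\mathcal F(V,V)$ with $B(0)=0$, $B(v)^{\otimes k}\in\mathcal F(V,V^{\odot k})$ has $n$th coefficient $\sum_{i_1,\dots,i_k\ge1,\,i_1+\dots+i_k=n}B_{i_1}\odot\dots\odot B_{i_k}$ for $k\ge1$, $B(v)^{\otimes0}=1$, and $A(B(v))=A_0+\sum_{k\ge1}A_kB(v)^{\otimes k}$. $\mathcal F_0(V)$ is the set of $A(v)\in\mathcal F(V,\mathbb F)$ with $A(0)\ne0$, a group under multiplication; $A^{-1}(v)$ is the multiplicative inverse. $\mathcal F_1(V)$ is the set of $B(v)\in\mathcal F(V,V)$ with $B(0)=0$ and $B_1\in\mathcal L(V)$ invertible, a group under composition; $B^{\langle-1\rangle}(v)$ is the compositional inverse. *)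

theory Defs
  imports
    "HOL-Analysis.Derivative"
    "HOL-Library.Function_Algebras"
    "HOL-Combinatorics.Permutations"
begin

(* The ground field is a type of class real_normed_field.  Up to isomorphism the only such fields
   are the reals and the complex numbers (Ostrowski / Gelfand-Mazur), and both are instances.
   The vector space V is a type 'v together with its scalar multiplication s. *)

section \<open>Linear operators\<close>

definition scale_fun :: "('f \<Rightarrow> 'w \<Rightarrow> 'w) \<Rightarrow> 'f \<Rightarrow> ('x \<Rightarrow> 'w) \<Rightarrow> 'x \<Rightarrow> 'w" where
  "scale_fun sW c g = (\<lambda>x. sW c (g x))"

(* L(U,W) for subspaces U, W of the ambient types.  Operators are extended by 0 outside U, so that
   equality of operators is equality of functions, sums of operators are pointwise sums, and
   composition of operators is composition of functions. *)
definition lin_ops ::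
  "('f \<Rightarrow> 'u \<Rightarrow> 'u) \<Rightarrow> ('f \<Rightarrow> 'w \<Rightarrow> 'w) \<Rightarrow> 'u::ab_group_add set \<Rightarrow> 'w::ab_group_add set \<Rightarrow> ('u \<Rightarrow> 'w) set"
where
  "lin_ops sU sW U W =
     {A. (\<forall>x\<in>U. A x \<in> W) \<and> (\<forall>x\<in>U. \<forall>y\<in>U. A (x + y) = A x + A y) \<and>
         (\<forall>c. \<forall>x\<in>U. A (sU c x) = sW c (A x)) \<and> (\<forall>x. x \<notin> U \<longrightarrow> A x = 0)}"

definition alg_dual :: "('f::field_char_0 \<Rightarrow> 'v::ab_group_add \<Rightarrow> 'v) \<Rightarrow> ('v \<Rightarrow> 'f) set" where
  "alg_dual s = {\<omega>. Vector_Spaces.linear s (*) \<omega>}"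


section \<open>Symmetric tensor powers\<close>

(* The tensor power of V of order n is realised inside the n-linear forms on V^*, as the span of
   the forms (w_1, ..., w_n) |-> <w_1, v_1> ... <w_n, v_n>.  Since V^* separates the points of V,
   this is the algebraic tensor power.  A form is a function of the list [w_1, ..., w_n], extended
   by 0 to all other lists.  V^{(.)0} is spanned by the empty tensor, which plays the role of the
   scalar 1, and V^{(.)1} consists of the forms [w] |-> <w, v> and plays the role of V. *)
type_synonym ('f, 'v) tensor = "('v \<Rightarrow> 'f) list \<Rightarrow> 'f"

abbreviation tscale :: "'f::field_char_0 \<Rightarrow> ('f, 'v) tensor \<Rightarrow> ('f, 'v) tensor" where
  "tscale \<equiv> scale_fun (*)"

definition elem_tensor ::
  "('f::field_char_0 \<Rightarrow> 'v::ab_group_add \<Rightarrow> 'v) \<Rightarrow> 'v list \<Rightarrow> ('f, 'v) tensor"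
where
  "elem_tensor s vs =
     (\<lambda>ws. if length ws = length vs \<and> set ws \<subseteq> alg_dual s
           then \<Prod>i<length vs. (ws ! i) (vs ! i) else 0)"

definition sym_prod ::
  "('f::field_char_0 \<Rightarrow> 'v::ab_group_add \<Rightarrow> 'v) \<Rightarrow> 'v list \<Rightarrow> ('f, 'v) tensor"
where
  "sym_prod s vs =
     tscale (1 / fact (length vs))
       (\<Sum>\<pi> | \<pi> permutes {..<length vs}. elem_tensor s (permute_list \<pi> vs))"

definition sym_power ::
  "('f::field_char_0 \<Rightarrow> 'v::ab_group_add \<Rightarrow> 'v) \<Rightarrow> nat \<Rightarrow> ('f, 'v) tensor set"
where
  "sym_power s n = module.span tscale {sym_prod s vs | vs. length vs = n}"

definition tensor_pow ::
  "('f::field_char_0 \<Rightarrow> 'v::ab_group_add \<Rightarrow> 'v) \<Rightarrow> nat \<Rightarrow> 'v \<Rightarrow> ('f, 'v) tensor"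
where
  "tensor_pow s n v = elem_tensor s (replicate n v)"

(* The pairing of the n-th tensor power of w in V^* with a symmetric tensor; its values on the
   spanning vectors are given by the lemma dual_pow_sym_prod below. *)
definition dual_pow :: "nat \<Rightarrow> ('v \<Rightarrow> 'f) \<Rightarrow> ('f, 'v) tensor \<Rightarrow> 'f" where
  "dual_pow n \<omega> f = f (replicate n \<omega>)"

lemma sum_fun_apply: "(\<Sum>i\<in>I. g i) x = (\<Sum>i\<in>I. g i x)"
  by (induction I rule: infinite_finite_induct) auto

lemma dual_pow_sym_prod:
  assumes "\<omega> \<in> alg_dual s"
  shows "dual_pow (length vs) \<omega> (sym_prod s vs) = (\<Prod>v\<leftarrow>vs. \<omega> v)"
proof -
  have "elem_tensor s (permute_list \<pi> vs) (replicate (length vs) \<omega>) = (\<Prod>v\<leftarrow>vs. \<omega> v)"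
    if "\<pi> permutes {..<length vs}" for \<pi>
  proof -
    have "elem_tensor s (permute_list \<pi> vs) (replicate (length vs) \<omega>) =
        (\<Prod>v\<leftarrow>permute_list \<pi> vs. \<omega> v)"
      using assms by (auto simp: elem_tensor_def prod.list_conv_set_nth atLeast0LessThan)
    also have "\<dots> = (\<Prod>v\<leftarrow>vs. \<omega> v)"
      using mset_permute_list[OF that] by (metis mset_map prod_mset_prod_list)
    finally show ?thesis .
  qed
  then show ?thesis
    by (simp add: dual_pow_def sym_prod_def scale_fun_def sum_fun_apply finite_permutations
        card_permutations)
qed

(* The linear operator C on V^{(.)n} determined by C v^{(x)n} = phi v for all v. *)
definition pow_ext ::
  "('f::field_char_0 \<Rightarrow> 'v::ab_group_add \<Rightarrow> 'v) \<Rightarrow> ('f \<Rightarrow> 'w \<Rightarrow> 'w) \<Rightarrow> 'w::ab_group_add set \<Rightarrow> nat \<Rightarrow>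
   ('v \<Rightarrow> 'w) \<Rightarrow> ('f, 'v) tensor \<Rightarrow> 'w"
where
  "pow_ext s sW W n \<phi> =
     (THE C. C \<in> lin_ops tscale sW (sym_power s n) W \<and> (\<forall>v. C (tensor_pow s n v) = \<phi> v))"

(* A1 (.) A2 for scalar-valued A1 on V^{(.)k} and W-valued A2 on V^{(.)l} *)
definition op_prod ::
  "('f::field_char_0 \<Rightarrow> 'v::ab_group_add \<Rightarrow> 'v) \<Rightarrow> ('f \<Rightarrow> 'w \<Rightarrow> 'w) \<Rightarrow> 'w::ab_group_add set \<Rightarrow> nat \<Rightarrow> nat \<Rightarrow>
   (('f, 'v) tensor \<Rightarrow> 'f) \<Rightarrow> (('f, 'v) tensor \<Rightarrow> 'w) \<Rightarrow> ('f, 'v) tensor \<Rightarrow> 'w"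
where
  "op_prod s sW W k l A1 A2 =
     pow_ext s sW W (k + l) (\<lambda>v. sW (A1 (tensor_pow s k v)) (A2 (tensor_pow s l v)))"


section \<open>Formal tensor power series\<close>

(* An element of F(V,W) is its sequence of coefficients.  The constant term A_0 in W is encoded as
   the operator c |-> c A_0 on V^{(.)0}, so that A(0) is the value at the empty tensor. *)
type_synonym ('f, 'v, 'w) tps = "nat \<Rightarrow> ('f, 'v) tensor \<Rightarrow> 'w"

definition tps_set ::
  "('f::field_char_0 \<Rightarrow> 'v::ab_group_add \<Rightarrow> 'v) \<Rightarrow> ('f \<Rightarrow> 'w \<Rightarrow> 'w) \<Rightarrow> 'w::ab_group_add set \<Rightarrow>
   ('f, 'v, 'w) tps set"
where
  "tps_set s sW W = {A. \<forall>n. A n \<in> lin_ops tscale sW (sym_power s n) W}"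

definition tps_at0 :: "('f::field_char_0 \<Rightarrow> 'v::ab_group_add \<Rightarrow> 'v) \<Rightarrow> ('f, 'v, 'w) tps \<Rightarrow> 'w" where
  "tps_at0 s A = A 0 (elem_tensor s [])"

definition tps_mult ::
  "('f::field_char_0 \<Rightarrow> 'v::ab_group_add \<Rightarrow> 'v) \<Rightarrow> ('f \<Rightarrow> 'w \<Rightarrow> 'w) \<Rightarrow> 'w::ab_group_add set \<Rightarrow>
   ('f, 'v, 'f) tps \<Rightarrow> ('f, 'v, 'w) tps \<Rightarrow> ('f, 'v, 'w) tps"
where
  "tps_mult s sW W A1 A2 = (\<lambda>n. \<Sum>k\<le>n. op_prod s sW W k (n - k) (A1 k) (A2 (n - k)))"

definition tps_one :: "('f::field_char_0 \<Rightarrow> 'v::ab_group_add \<Rightarrow> 'v) \<Rightarrow> ('f, 'v, 'f) tps" where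
  "tps_one s = (\<lambda>n. if n = 0 then pow_ext s (*) UNIV 0 (\<lambda>v. 1) else 0)"

primrec tps_power ::
  "('f::field_char_0 \<Rightarrow> 'v::ab_group_add \<Rightarrow> 'v) \<Rightarrow> ('f, 'v, 'f) tps \<Rightarrow> nat \<Rightarrow> ('f, 'v, 'f) tps"
where
  "tps_power s C 0 = tps_one s"
| "tps_power s C (Suc k) = tps_mult s (*) UNIV C (tps_power s C k)"

(* exp[C(v)], for C(0) = 0 only: then C(v)^k has no terms of degree below k, and the n-th
   coefficient of the exponential series is a sum over k <= n. *)
definition tps_exp ::
  "('f::field_char_0 \<Rightarrow> 'v::ab_group_add \<Rightarrow> 'v) \<Rightarrow> ('f, 'v, 'f) tps \<Rightarrow> ('f, 'v, 'f) tps"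
where
  "tps_exp s C = (\<lambda>n. \<Sum>k\<le>n. scale_fun (*) (1 / fact k) (tps_power s C k n))"

(* B(v)^{(x)k} in F(V, V^{(.)k}), for B(0) = 0.  For k = 0 the only index list is [], which
   contributes to n = 0 only, so that B(v)^{(x)0} = 1. *)
definition tps_tpow ::
  "('f::field_char_0 \<Rightarrow> 'v::ab_group_add \<Rightarrow> 'v) \<Rightarrow> ('f, 'v, 'v) tps \<Rightarrow> nat \<Rightarrow> ('f, 'v, ('f, 'v) tensor) tps"
where
  "tps_tpow s B k =
     (\<lambda>n. \<Sum>is | length is = k \<and> (\<forall>i\<in>set is. 1 \<le> i) \<and> sum_list is = n.
        pow_ext s tscale (sym_power s k) n
          (\<lambda>v. sym_prod s (map (\<lambda>i. B i (tensor_pow s i v)) is)))"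

(* A(B(v)), for B(0) = 0 only: then B(v)^{(x)k} has no terms of degree below k. *)
definition tps_comp ::
  "('f::field_char_0 \<Rightarrow> 'v::ab_group_add \<Rightarrow> 'v) \<Rightarrow> ('f, 'v, 'w::ab_group_add) tps \<Rightarrow> ('f, 'v, 'v) tps \<Rightarrow>
   ('f, 'v, 'w) tps"
where
  "tps_comp s A B = (\<lambda>n. \<Sum>k\<le>n. A k \<circ> tps_tpow s B k n)"

(* the series v in F(V,V) *)
definition tps_ident :: "('f::field_char_0 \<Rightarrow> 'v::ab_group_add \<Rightarrow> 'v) \<Rightarrow> ('f, 'v, 'v) tps" where
  "tps_ident s = (\<lambda>n. if n = 1 then pow_ext s s UNIV 1 (\<lambda>v. v) else 0)"

definition tps_F0 :: "('f::field_char_0 \<Rightarrow> 'v::ab_group_add \<Rightarrow> 'v) \<Rightarrow> ('f, 'v, 'f) tps set" where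
  "tps_F0 s = {A \<in> tps_set s (*) UNIV. tps_at0 s A \<noteq> 0}"

definition tps_F1 :: "('f::field_char_0 \<Rightarrow> 'v::ab_group_add \<Rightarrow> 'v) \<Rightarrow> ('f, 'v, 'v) tps set" where
  "tps_F1 s =
     {B \<in> tps_set s s UNIV. tps_at0 s B = 0 \<and> bij_betw (B 1) (sym_power s 1) UNIV}"

definition tps_inverse ::
  "('f::field_char_0 \<Rightarrow> 'v::ab_group_add \<Rightarrow> 'v) \<Rightarrow> ('f, 'v, 'f) tps \<Rightarrow> ('f, 'v, 'f) tps"
where
  "tps_inverse s A = (THE A'. A' \<in> tps_F0 s \<and> tps_mult s (*) UNIV A A' = tps_one s)"

definition tps_comp_inverse ::
  "('f::field_char_0 \<Rightarrow> 'v::ab_group_add \<Rightarrow> 'v) \<Rightarrow> ('f, 'v, 'v) tps \<Rightarrow> ('f, 'v, 'v) tps"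
where
  "tps_comp_inverse s B =
     (THE L. L \<in> tps_F1 s \<and> tps_comp s B L = tps_ident s \<and> tps_comp s L B = tps_ident s)"


section \<open>Polynomials on the dual space\<close>

(* Functions on V^* are extended by 0 to all functions 'v => 'f. *)

definition monomial ::
  "('f::field_char_0 \<Rightarrow> 'v::ab_group_add \<Rightarrow> 'v) \<Rightarrow> nat \<Rightarrow> ('f, 'v) tensor \<Rightarrow> ('v \<Rightarrow> 'f) \<Rightarrow> 'f"
where
  "monomial s n f = (\<lambda>\<omega>. if \<omega> \<in> alg_dual s then dual_pow n \<omega> f else 0)"

definition polys :: "('f::field_char_0 \<Rightarrow> 'v::ab_group_add \<Rightarrow> 'v) \<Rightarrow> (('v \<Rightarrow> 'f) \<Rightarrow> 'f) set" where
  "polys s = {\<Sum>k\<le>n. monomial s k (f k) | n f. \<forall>k\<le>n. f k \<in> sym_power s k}"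

definition polys_in ::
  "('f::field_char_0 \<Rightarrow> 'v::ab_group_add \<Rightarrow> 'v) \<Rightarrow> ('f \<Rightarrow> 'w \<Rightarrow> 'w) \<Rightarrow> 'w::ab_group_add set \<Rightarrow>
   (('v \<Rightarrow> 'f) \<Rightarrow> 'w) set"
where
  "polys_in s sW W =
     module.span (scale_fun sW) {\<lambda>\<omega>. sW (p \<omega>) w | p w. p \<in> polys s \<and> w \<in> W}"

type_synonym ('f, 'v) poly_op = "(('v \<Rightarrow> 'f) \<Rightarrow> 'f) \<Rightarrow> ('v \<Rightarrow> 'f) \<Rightarrow> 'f"

definition poly_lin_ops :: "('f::field_char_0 \<Rightarrow> 'v::ab_group_add \<Rightarrow> 'v) \<Rightarrow> ('f, 'v) poly_op set" where
  "poly_lin_ops s = lin_ops (scale_fun (*)) (scale_fun (*)) (polys s) (polys s)"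

definition shift_op ::
  "('f::field_char_0 \<Rightarrow> 'v::ab_group_add \<Rightarrow> 'v) \<Rightarrow> ('v \<Rightarrow> 'f) \<Rightarrow> ('f, 'v) poly_op"
where
  "shift_op s \<theta> p =
     (if p \<in> polys s then \<lambda>\<omega>. if \<omega> \<in> alg_dual s then p (\<omega> + \<theta>) else 0 else 0)"

definition deriv_op ::
  "('f::real_normed_field \<Rightarrow> 'v::ab_group_add \<Rightarrow> 'v) \<Rightarrow> ('v \<Rightarrow> 'f) \<Rightarrow> ('f, 'v) poly_op"
where
  "deriv_op s \<theta> p =
     (if p \<in> polys s
      then \<lambda>\<omega>. if \<omega> \<in> alg_dual s then deriv (\<lambda>t. p (\<omega> + scale_fun (*) t \<theta>)) 0 else 0
      else 0)"

definition shift_invariant ::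
  "('f::field_char_0 \<Rightarrow> 'v::ab_group_add \<Rightarrow> 'v) \<Rightarrow> ('f, 'v) poly_op \<Rightarrow> bool"
where
  "shift_invariant s T \<longleftrightarrow>
     T \<in> poly_lin_ops s \<and> (\<forall>\<theta>\<in>alg_dual s. T \<circ> shift_op s \<theta> = shift_op s \<theta> \<circ> T)"

definition op_inverse ::
  "('f::field_char_0 \<Rightarrow> 'v::ab_group_add \<Rightarrow> 'v) \<Rightarrow> ('f, 'v) poly_op \<Rightarrow> ('f, 'v) poly_op"
where
  "op_inverse s P p = (if p \<in> polys s then inv_into (polys s) P p else 0)"

(* D^k *)
definition diff_pow ::
  "('f::field_char_0 \<Rightarrow> 'v::ab_group_add \<Rightarrow> 'v) \<Rightarrow> nat \<Rightarrow>
   (('v \<Rightarrow> 'f) \<Rightarrow> 'f) \<Rightarrow> ('v \<Rightarrow> 'f) \<Rightarrow> ('f, 'v) tensor"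
where
  "diff_pow s k =
     (THE D. D \<in> lin_ops (scale_fun (*)) (scale_fun tscale)
                   (polys s) (polys_in s tscale (sym_power s k)) \<and>
        (\<forall>n v. \<forall>\<omega>\<in>alg_dual s. D (monomial s n (tensor_pow s n v)) \<omega> =
           tscale ((\<Prod>i<k. of_nat n - of_nat i) * \<omega> v ^ (n - k)) (tensor_pow s k v)))"

(* tau(D) *)
definition diff_subst ::
  "('f::field_char_0 \<Rightarrow> 'v::ab_group_add \<Rightarrow> 'v) \<Rightarrow> ('f, 'v, 'f) tps \<Rightarrow> ('f, 'v) poly_op"
where
  "diff_subst s \<tau> p =
     (if p \<in> polys s
      then \<lambda>\<omega>. tps_at0 s \<tau> * p \<omega> + (\<Sum>k | 1 \<le> k \<and> diff_pow s k p \<noteq> 0. \<tau> k (diff_pow s k p \<omega>))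
      else 0)"


section \<open>Polynomial sequences\<close>

definition op_matrix ::
  "('f::field_char_0 \<Rightarrow> 'v::ab_group_add \<Rightarrow> 'v) \<Rightarrow> ('f, 'v) poly_op \<Rightarrow>
   (nat \<Rightarrow> nat \<Rightarrow> ('f, 'v) tensor \<Rightarrow> ('f, 'v) tensor) \<Rightarrow> bool"
where
  "op_matrix s P M \<longleftrightarrow>
     (\<forall>k n. M k n \<in> lin_ops tscale tscale (sym_power s n) (sym_power s k)) \<and>
     (\<forall>k n. k > n \<longrightarrow> M k n = 0) \<and>
     (\<forall>n. bij_betw (M n n) (sym_power s n) (sym_power s n)) \<and>
     (\<forall>n. \<forall>f\<in>sym_power s n. P (monomial s n f) = (\<Sum>k\<le>n. monomial s k (M k n f)))"

definition poly_seq_ops :: "('f::field_char_0 \<Rightarrow> 'v::ab_group_add \<Rightarrow> 'v) \<Rightarrow> ('f, 'v) poly_op set" where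
  "poly_seq_ops s = {P \<in> poly_lin_ops s. \<exists>M. op_matrix s P M}"

(* P_n(w) in the dual of V^{(.)n} *)
definition poly_seq ::
  "('f::field_char_0 \<Rightarrow> 'v::ab_group_add \<Rightarrow> 'v) \<Rightarrow> ('f, 'v) poly_op \<Rightarrow> nat \<Rightarrow> ('v \<Rightarrow> 'f) \<Rightarrow>
   ('f, 'v) tensor \<Rightarrow> 'f"
where
  "poly_seq s P n \<omega> = (\<lambda>f. if f \<in> sym_power s n then P (monomial s n f) \<omega> else 0)"

definition gen_fun ::
  "('f::field_char_0 \<Rightarrow> 'v::ab_group_add \<Rightarrow> 'v) \<Rightarrow> ('f, 'v) poly_op \<Rightarrow> ('v \<Rightarrow> 'f) \<Rightarrow>
   ('f, 'v, 'f) tps"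
where
  "gen_fun s P \<omega> = (\<lambda>n. scale_fun (*) (1 / fact n) (poly_seq s P n \<omega>))"

definition lowering_differential ::
  "('f::real_normed_field \<Rightarrow> 'v::ab_group_add \<Rightarrow> 'v) \<Rightarrow> ('f, 'v) poly_op \<Rightarrow>
   (('v \<Rightarrow> 'f) \<Rightarrow> 'f) \<Rightarrow> ('v \<Rightarrow> 'f) \<Rightarrow> 'v"
where
  "lowering_differential s P =
     (THE Q. Q \<in> lin_ops (scale_fun (*)) (scale_fun s) (polys s) (polys_in s s UNIV) \<and>
        (\<forall>p\<in>polys s. \<forall>\<theta>\<in>alg_dual s. \<forall>\<omega>\<in>alg_dual s.
           \<theta> (Q p \<omega>) = P (deriv_op s \<theta> (op_inverse s P p)) \<omega>))"

definition umbral_ops :: "('f::field_char_0 \<Rightarrow> 'v::ab_group_add \<Rightarrow> 'v) \<Rightarrow> ('f, 'v) poly_op set" where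
  "umbral_ops s =
     {P \<in> poly_seq_ops s.
        (\<forall>\<omega>\<in>alg_dual s. poly_seq s P 0 \<omega> (elem_tensor s []) = 1) \<and>
        (\<forall>n\<ge>1. \<forall>\<omega>\<in>alg_dual s. \<forall>\<theta>\<in>alg_dual s.
           poly_seq s P n (\<omega> + \<theta>) =
             (\<Sum>k\<le>n. scale_fun (*) (of_nat (n choose k))
                (op_prod s (*) UNIV k (n - k) (poly_seq s P k \<omega>) (poly_seq s P (n - k) \<theta>))))}"

definition sheffer ::
  "('f::field_char_0 \<Rightarrow> 'v::ab_group_add \<Rightarrow> 'v) \<Rightarrow> ('f, 'v) poly_op \<Rightarrow> bool"
where
  "sheffer s S \<longleftrightarrow>
     S \<in> poly_seq_ops s \<and>
     (\<exists>B\<in>tps_F1 s. \<exists>A\<in>tps_F0 s. \<forall>\<omega>\<in>alg_dual s.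
        gen_fun s S \<omega> = tps_mult s (*) UNIV (tps_exp s (\<lambda>n. \<omega> \<circ> B n)) A)"

end

theory Submission
  imports Defs "HOL-Computational_Algebra.Formal_Power_Series"
begin

text \<open>
  Everything is tested on the powers v^n, which span the symmetric power of degree n, and on the
  points \<omega> of the dual, which determine a symmetric tensor through its diagonal values. Both facts
  are polarization (lemma polarization). A scalar tensor power series A then becomes the family
  of ordinary power series ser A v = \<Sum> A_n(v^n) t^n indexed by v, and the operations on tensor power series
  become multiplication, powers and exponentials in one variable. For a polynomial sequence P
  write gP(\<omega>, v) for the series ser of its generating function at \<omega>. Relative to the umbral operator
  P, the conditions on S become identities between power series:
  
    \<^item> the generating function condition and the condition on the matrix entries say
      gS(\<omega>, v) = gP(\<omega>, v) A(v); the second one is the first one read off in each degree of \<omega>;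
    \<^item> the expansion of S_n in the P_k with coefficients \<rho>_k says the same with A_k = \<rho>_k / k!, because
      binomial convolutions are products of exponential generating series;
    \<^item> the two-variable binomial identity says gS(\<omega> + \<theta>, v) = gS(\<omega>, v) gP(\<theta>, v).
  
  The first identity implies the last one since gP(\<omega> + \<theta>, v) = gP(\<omega>, v) gP(\<theta>, v), and \<omega> = 0 in the last
  one gives back the first one with A(v) = gS(0, v). The series A is unique because gP(0, v) = 1.
  
  The two conditions on operators reduce to these identities. Writing the shift of S_n and of P_n in
  the form of the binomial identity shows that T = P S^(-1) commutes with shifts exactly when S
  satisfies the binomial identity. The lowering differentials of S and P agree exactly when
  U = P^(-1) S commutes with all directional derivatives. A polynomial with vanishing
  derivatives is constant, so this happens exactly when U v^n = \<Sum> (n choose k) u_k v^(n-k), where u_k is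
  the value of U v^k at 0. Applying P gives the expansion of S_n in the P_k.
  
  Finally, \<tau>(D) multiplies the exponential of \<omega> by \<tau>. Substituting B into this statement, and using
  that composition of series is multiplicative and associative, gives
  \<tau>(D) P_n(\<omega>) = n! [t^n] (\<tau> o B)(v) gP(\<omega>, v) with \<tau> o B = A^(-1), hence \<tau>(D) S_n = P_n.
\<close>

section \<open>Polarization\<close>

lemma vector_space_field_mult: "vector_space ((*) :: 'f::field \<Rightarrow> 'f \<Rightarrow> 'f)"
  by unfold_locales (auto simp: algebra_simps)

lemma vector_space_scale_fun:
  assumes "vector_space sW"
  shows "vector_space (scale_fun sW)"
proof -
  interpret W: vector_space sW by fact
  show ?thesis
    by unfold_locales (auto simp: scale_fun_def fun_eq_iff W.scale_right_distrib W.scale_left_distrib)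
qed

lemma vector_space_tscale: "vector_space (tscale :: 'f::field_char_0 \<Rightarrow> ('f, 'v) tensor \<Rightarrow> _)"
  by (intro vector_space_scale_fun vector_space_field_mult)

text \<open>
  The leading term cancels in g(2t) - 2^n g(t), where g(t) is the given sum of degree n, and the other
  coefficients are multiplied by the non-zero numbers 2^k - 2^n. This induction on the degree takes
  the place of inverting a Vandermonde matrix, and it works modulo any subspace.
\<close>
lemma subspace_coefficients:
  fixes sW :: "'f::field_char_0 \<Rightarrow> 'w::ab_group_add \<Rightarrow> 'w"
  assumes "vector_space sW" and "module.subspace sW U"
    and "\<And>t. (\<Sum>k\<le>n. sW (t ^ k) (a k)) \<in> U" and "k \<le> n"
  shows "a k \<in> U"
proof -
  interpret W: vector_space sW by fact
  have scaled_back: "x \<in> U" if "sW c x \<in> U" "c \<noteq> 0" for c x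
    using W.subspace_scale[OF assms(2) that(1), of "inverse c"] that(2) by simp
  show ?thesis
    using assms(3,4)
  proof (induction n arbitrary: a k)
    case 0
    then show ?case using 0(1)[of 1] by simp
  next
    case (Suc n)
    let ?b = "\<lambda>k. sW (2 ^ k - 2 ^ Suc n) (a k)"
    have "(\<Sum>k\<le>n. sW (t ^ k) (?b k)) \<in> U" for t
    proof -
      have "(\<Sum>k\<le>n. sW (t ^ k) (?b k)) = (\<Sum>k\<le>Suc n. sW (t ^ k) (?b k))"
        by simp
      also have "\<dots> = (\<Sum>k\<le>Suc n. sW ((2 * t) ^ k) (a k)) -
          sW (2 ^ Suc n) (\<Sum>k\<le>Suc n. sW (t ^ k) (a k))"
        by (simp only: W.scale_sum_right sum_subtractf[symmetric])
          (auto intro!: sum.cong simp: W.scale_left_diff_distrib power_mult_distrib algebra_simps)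
      also have "\<dots> \<in> U"
        using Suc.prems(1) assms(2) by (intro W.subspace_diff W.subspace_scale) blast+
      finally show ?thesis .
    qed
    then have "?b k \<in> U" if "k \<le> n" for k
      using Suc.IH[of ?b k] that by blast
    moreover have "(2::'f) ^ k - 2 ^ Suc n \<noteq> 0" if "k \<le> n" for k
    proof -
      have "(2::nat) ^ k < 2 ^ Suc n" using that by (intro power_strict_increasing) auto
      then have "(2::nat) ^ k \<noteq> 2 ^ Suc n" by simp
      then have "of_nat (2 ^ k) \<noteq> (of_nat (2 ^ Suc n) :: 'f)" using of_nat_eq_iff by blast
      then show ?thesis by simp
    qed
    ultimately have low: "a k \<in> U" if "k \<le> n" for k
      using that scaled_back by blast
    have "a (Suc n) = (\<Sum>k\<le>Suc n. sW (1 ^ k) (a k)) - (\<Sum>k\<le>n. a k)"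
      by simp
    also have "\<dots> \<in> U"
      by (rule W.subspace_diff[OF assms(2) Suc.prems(1) W.subspace_sum[OF assms(2)]])
        (simp add: low)
    finally show ?case
      using low Suc.prems(2) le_Suc_eq by auto
  qed
qed

text \<open>
  A form is a function of a list, so that forms of all degrees are treated at once. Because of the
  symmetry, linearity in the head of the list is linearity in every argument.
\<close>
definition sym_multilinear ::
  "('f \<Rightarrow> 'x::ab_group_add \<Rightarrow> 'x) \<Rightarrow> ('f \<Rightarrow> 'w::ab_group_add \<Rightarrow> 'w) \<Rightarrow> 'x set \<Rightarrow> ('x list \<Rightarrow> 'w) \<Rightarrow> bool"
where
  "sym_multilinear sX sW X M \<longleftrightarrow>
     (\<forall>xs ys. mset xs = mset ys \<longrightarrow> M xs = M ys) \<and>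
     (\<forall>x\<in>X. \<forall>y\<in>X. \<forall>zs. set zs \<subseteq> X \<longrightarrow> M ((x + y) # zs) = M (x # zs) + M (y # zs)) \<and>
     (\<forall>c. \<forall>x\<in>X. \<forall>zs. set zs \<subseteq> X \<longrightarrow> M (sX c x # zs) = sW c (M (x # zs)))"

lemma sym_multilinearD:
  assumes "sym_multilinear sX sW X M"
  shows "mset xs = mset ys \<Longrightarrow> M xs = M ys"
    and "x \<in> X \<Longrightarrow> y \<in> X \<Longrightarrow> set zs \<subseteq> X \<Longrightarrow> M ((x + y) # zs) = M (x # zs) + M (y # zs)"
    and "x \<in> X \<Longrightarrow> set zs \<subseteq> X \<Longrightarrow> M (sX c x # zs) = sW c (M (x # zs))"
  using assms unfolding sym_multilinear_def by blast+

text \<open>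
  Only the coefficients of degree 0 and 1 of the expansion in t are needed: the coefficient of t is m
  times the form with exactly one argument replaced by y.
\<close>
lemma sym_multilinear_diagonal_expansion:
  fixes sW :: "'f::field_char_0 \<Rightarrow> 'w::ab_group_add \<Rightarrow> 'w"
  assumes W: "vector_space sW" and M: "sym_multilinear sX sW X M"
    and X: "\<And>c x. x \<in> X \<Longrightarrow> sX c x \<in> X" "\<And>x y. x \<in> X \<Longrightarrow> y \<in> X \<Longrightarrow> x + y \<in> X"
    and "x \<in> X" "y \<in> X" "set zs \<subseteq> X"
  shows "\<exists>a. (\<forall>t. M (replicate m (x + sX t y) @ zs) = (\<Sum>k\<le>m. sW (t ^ k) (a k))) \<and>
    a 0 = M (replicate m x @ zs) \<and>
    (m > 0 \<longrightarrow> a 1 = sW (of_nat m) (M (y # replicate (m - 1) x @ zs)))"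
  using \<open>set zs \<subseteq> X\<close>
proof (induction m arbitrary: zs)
  case 0
  interpret W: vector_space sW by fact
  show ?case by (rule exI[of _ "\<lambda>_. M zs"]) simp
next
  case (Suc m)
  interpret W: vector_space sW by fact
  let ?r = "\<lambda>t. replicate m (x + sX t y)"
  have sub: "set (x # zs) \<subseteq> X" "set (y # zs) \<subseteq> X"
    using assms Suc.prems by auto
  obtain a where a: "\<And>t. M (?r t @ x # zs) = (\<Sum>k\<le>m. sW (t ^ k) (a k))"
      "a 0 = M (replicate m x @ x # zs)"
      "m > 0 \<Longrightarrow> a 1 = sW (of_nat m) (M (y # replicate (m - 1) x @ x # zs))"
    using Suc.IH[OF sub(1)] by blast
  obtain b where b: "\<And>t. M (?r t @ y # zs) = (\<Sum>k\<le>m. sW (t ^ k) (b k))"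
      "b 0 = M (replicate m x @ y # zs)"
    using Suc.IH[OF sub(2)] by blast
  let ?c = "\<lambda>k. (if k \<le> m then a k else 0) + (if k = 0 then 0 else b (k - 1))"
  have "M (replicate (Suc m) (x + sX t y) @ zs) = (\<Sum>k\<le>Suc m. sW (t ^ k) (?c k))" for t
  proof -
    have r: "set (?r t @ zs) \<subseteq> X"
      using assms X Suc.prems by auto
    have "M (replicate (Suc m) (x + sX t y) @ zs) = M ((x + sX t y) # (?r t @ zs))"
      by simp
    also have "\<dots> = M (x # (?r t @ zs)) + sW t (M (y # (?r t @ zs)))"
      using sym_multilinearD(2,3)[OF M] r assms X by simp
    also have "M (x # (?r t @ zs)) = M (?r t @ x # zs)"
      by (rule sym_multilinearD(1)[OF M]) simp
    also have "M (y # (?r t @ zs)) = M (?r t @ y # zs)"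
      by (rule sym_multilinearD(1)[OF M]) simp
    also have "sW t (M (?r t @ y # zs)) = (\<Sum>k\<le>m. sW (t ^ Suc k) (b k))"
      by (simp add: b W.scale_sum_right)
    also have "\<dots> = (\<Sum>k\<le>Suc m. sW (t ^ k) (if k = 0 then 0 else b (k - 1)))"
      by (subst sum.atMost_Suc_shift) simp
    also have "M (?r t @ x # zs) = (\<Sum>k\<le>Suc m. sW (t ^ k) (if k \<le> m then a k else 0))"
      by (simp add: a)
    finally show ?thesis
      by (simp only: W.scale_right_distrib sum.distrib)
  qed
  moreover have "?c 0 = M (replicate (Suc m) x @ zs)"
    using a(2) by (simp add: replicate_append_same) (rule sym_multilinearD(1)[OF M], simp)
  moreover have "?c 1 = sW (of_nat (Suc m)) (M (y # replicate m x @ zs))"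
  proof -
    have y: "b 0 = M (y # replicate m x @ zs)"
      unfolding b(2) by (rule sym_multilinearD(1)[OF M]) simp
    show ?thesis
    proof (cases "m = 0")
      case False
      have "M (y # replicate (m - 1) x @ x # zs) = M (y # replicate m x @ zs)"
        using False by (intro sym_multilinearD(1)[OF M]) (cases m, auto)
      then show ?thesis
        using False a(3) y by (simp add: W.scale_left_distrib algebra_simps)
    qed (simp add: y)
  qed
  ultimately show ?case
    by (intro exI[of _ ?c]) simp
qed

text \<open>
  The coefficient of t in the diagonal value at x + ty replaces one entry x by y. Each such step turns
  one more of the equal entries into an arbitrary one. With a subspace U instead of zero the lemma
  yields both spanning statements and uniqueness statements.
\<close>
lemma polarization:
  fixes sW :: "'f::field_char_0 \<Rightarrow> 'w::ab_group_add \<Rightarrow> 'w"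
  assumes W: "vector_space sW" and U: "module.subspace sW U" and M: "sym_multilinear sX sW X M"
    and X: "\<And>c x. x \<in> X \<Longrightarrow> sX c x \<in> X" "\<And>x y. x \<in> X \<Longrightarrow> y \<in> X \<Longrightarrow> x + y \<in> X"
    and diag: "\<And>x. x \<in> X \<Longrightarrow> M (replicate n x) \<in> U"
    and xs: "set xs \<subseteq> X" "length xs = n" and "X \<noteq> {}"
  shows "M xs \<in> U"
proof -
  interpret W: vector_space sW by fact
  have "M (replicate m x @ zs) \<in> U" if "m + length zs = n" "set zs \<subseteq> X" "x \<in> X" for m zs x
    using that
  proof (induction zs arbitrary: m x)
    case Nil
    then show ?case using diag by simp
  next
    case (Cons y zs)
    then have zs: "set zs \<subseteq> X" and y: "y \<in> X" and x: "x \<in> X" by auto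
    obtain a where a: "\<And>t. M (replicate (Suc m) (x + sX t y) @ zs) = (\<Sum>k\<le>Suc m. sW (t ^ k) (a k))"
        "a 1 = sW (of_nat (Suc m)) (M (y # replicate m x @ zs))"
      using sym_multilinear_diagonal_expansion[OF W M X x y zs, where m = "Suc m"] by auto
    have "(\<Sum>k\<le>Suc m. sW (t ^ k) (a k)) \<in> U" for t
      unfolding a(1)[symmetric] using Cons.prems zs X x y by (intro Cons.IH) auto
    then have "a 1 \<in> U"
      by (rule subspace_coefficients[OF W U, where n = "Suc m"]) auto
    then have "sW (inverse (of_nat (Suc m))) (a 1) \<in> U"
      by (rule W.subspace_scale[OF U])
    then have "M (y # replicate m x @ zs) \<in> U"
      unfolding a(2) by (simp del: of_nat_Suc)
    also have "M (y # replicate m x @ zs) = M (replicate m x @ y # zs)"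
      by (rule sym_multilinearD(1)[OF M]) simp
    finally show ?case .
  qed
  from this[of "0" xs] show ?thesis
    using xs \<open>X \<noteq> {}\<close> by auto
qed

section \<open>Linear operators on subspaces\<close>

lemma lin_opsD:
  assumes "A \<in> lin_ops sU sW U W"
  shows "x \<in> U \<Longrightarrow> A x \<in> W" "x \<in> U \<Longrightarrow> y \<in> U \<Longrightarrow> A (x + y) = A x + A y"
    "x \<in> U \<Longrightarrow> A (sU c x) = sW c (A x)" "x \<notin> U \<Longrightarrow> A x = 0"
  using assms unfolding lin_ops_def by blast+

lemma lin_opsI:
  assumes "\<And>x. x \<in> U \<Longrightarrow> A x \<in> W" "\<And>x y. x \<in> U \<Longrightarrow> y \<in> U \<Longrightarrow> A (x + y) = A x + A y"
    "\<And>c x. x \<in> U \<Longrightarrow> A (sU c x) = sW c (A x)" "\<And>x. x \<notin> U \<Longrightarrow> A x = 0"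
  shows "A \<in> lin_ops sU sW U W"
  using assms unfolding lin_ops_def by blast

lemma lin_ops_zero_value: "A \<in> lin_ops sU sW U W \<Longrightarrow> A 0 = 0"
  by (cases "0 \<in> U") (use lin_opsD(2)[of A sU sW U W 0 0] lin_opsD(4)[of A] in auto)

lemma lin_ops_sum_value:
  assumes "A \<in> lin_ops sU sW U W" "module.subspace sU U" "vector_space sU"
    and "\<And>i. i \<in> I \<Longrightarrow> x i \<in> U"
  shows "A (\<Sum>i\<in>I. x i) = (\<Sum>i\<in>I. A (x i))"
proof -
  interpret vector_space sU by fact
  show ?thesis
    using assms(4)
  proof (induction I rule: infinite_finite_induct)
    case (insert i I)
    then show ?case
      using lin_opsD(2)[OF assms(1)] subspace_sum[OF assms(2), of I x] by simp
  qed (use lin_ops_zero_value[OF assms(1)] in auto)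
qed

lemma lin_ops_zero:
  assumes "vector_space sW" "module.subspace sW W"
  shows "0 \<in> lin_ops sU sW U W"
proof -
  interpret vector_space sW by fact
  show ?thesis using assms(2) by (intro lin_opsI) (auto simp: subspace_0)
qed

lemma lin_ops_add:
  assumes "vector_space sW" "module.subspace sW W" "A \<in> lin_ops sU sW U W" "B \<in> lin_ops sU sW U W"
  shows "A + B \<in> lin_ops sU sW U W"
proof -
  interpret vector_space sW by fact
  show ?thesis
    using lin_opsD[OF assms(3)] lin_opsD[OF assms(4)] subspace_add[OF assms(2)]
    by (intro lin_opsI) (simp_all add: scale_right_distrib)
qed

lemma lin_ops_scale:
  assumes "vector_space sW" "module.subspace sW W" "A \<in> lin_ops sU sW U W"
  shows "scale_fun sW c A \<in> lin_ops sU sW U W"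
proof -
  interpret vector_space sW by fact
  show ?thesis
    using lin_opsD[OF assms(3)] subspace_scale[OF assms(2)]
    by (intro lin_opsI) (simp_all add: scale_fun_def scale_right_distrib mult.commute)
qed

lemma lin_ops_sum:
  assumes "vector_space sW" "module.subspace sW W" "\<And>i. i \<in> I \<Longrightarrow> A i \<in> lin_ops sU sW U W"
  shows "(\<Sum>i\<in>I. A i) \<in> lin_ops sU sW U W"
  using assms(3)
  by (induction I rule: infinite_finite_induct)
    (simp_all add: lin_ops_zero[OF assms(1,2)] lin_ops_add[OF assms(1,2)])

lemma lin_ops_comp:
  assumes "A \<in> lin_ops sW sX W X" "B \<in> lin_ops sU sW U W"
  shows "A \<circ> B \<in> lin_ops sU sX U X"
  using lin_opsD[OF assms(2)] lin_opsD[OF assms(1)] lin_ops_zero_value[OF assms(1)]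
  by (intro lin_opsI) simp_all

lemma lin_ops_eqI_span:
  assumes "vector_space sU" "vector_space sW" "A \<in> lin_ops sU sW U W" "B \<in> lin_ops sU sW U W'"
    and "U = module.span sU G" "\<And>g. g \<in> G \<Longrightarrow> A g = B g"
  shows "A = B"
proof
  interpret U: vector_space sU by fact
  interpret W: vector_space sW by fact
  fix x
  show "A x = B x"
  proof (cases "x \<in> U")
    case True
    have "U.subspace {x. x \<in> U \<and> A x = B x}"
    proof -
      have U: "U.subspace U" using U.subspace_span[of G] assms(5) by simp
      show ?thesis
        by (rule U.subspaceI)
          (simp_all add: U.subspace_0[OF U] U.subspace_add[OF U] U.subspace_scale[OF U]
            lin_ops_zero_value[OF assms(3)] lin_ops_zero_value[OF assms(4)]
            lin_opsD(2,3)[OF assms(3)] lin_opsD(2,3)[OF assms(4)])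
    qed
    moreover have "g \<in> U \<and> A g = B g" if "g \<in> G" for g
      using that assms(6) U.span_base[of g G] by (simp add: assms(5)[symmetric])
    ultimately have "x \<in> U \<and> A x = B x"
      using U.span_induct[of x G "\<lambda>x. x \<in> U \<and> A x = B x"] True assms(5) by blast
    then show ?thesis ..
  qed (use lin_opsD(4) assms(3,4) in metis)
qed

section \<open>Symmetric tensors\<close>

lemma subspace_zero: "vector_space sW \<Longrightarrow> module.subspace sW {0}"
  and module_subspace_UNIV: "vector_space sW \<Longrightarrow> module.subspace sW UNIV"
  unfolding module_iff_vector_space[symmetric]
  by (rule module.subspace_single_0, assumption) (rule module.subspace_UNIV, assumption)

lemma scale_fun_apply: "scale_fun sW c g x = sW c (g x)"
  by (simp add: scale_fun_def)

lemma sum_scale_fun_apply: "(\<Sum>i\<in>I. scale_fun sW (c i) (g i)) x = (\<Sum>i\<in>I. sW (c i) (g i x))"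
  by (simp add: sum_fun_apply scale_fun_def)

locale sym_tensors = vector_space s
  for s :: "'f::field_char_0 \<Rightarrow> 'v::ab_group_add \<Rightarrow> 'v"
begin

abbreviation Dual :: "('v \<Rightarrow> 'f) set" where "Dual \<equiv> alg_dual s"
abbreviation Sym :: "nat \<Rightarrow> ('f, 'v) tensor set" where "Sym \<equiv> sym_power s"
abbreviation pw :: "nat \<Rightarrow> 'v \<Rightarrow> ('f, 'v) tensor" where "pw \<equiv> tensor_pow s"

lemma dual_iff: "\<omega> \<in> Dual \<longleftrightarrow> (\<forall>x y. \<omega> (x + y) = \<omega> x + \<omega> y) \<and> (\<forall>c x. \<omega> (s c x) = c * \<omega> x)"
  unfolding alg_dual_def Vector_Spaces.linear_iff
  by (auto simp: vector_space_axioms vector_space_field_mult)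

lemma dual_add: "\<omega> \<in> Dual \<Longrightarrow> \<omega> (x + y) = \<omega> x + \<omega> y"
  and dual_scale: "\<omega> \<in> Dual \<Longrightarrow> \<omega> (s c x) = c * \<omega> x"
  by (simp_all add: dual_iff)

lemma dual_zero: "\<omega> \<in> Dual \<Longrightarrow> \<omega> 0 = 0"
  using dual_scale[of \<omega> 0 0] by simp

lemma dual_sum: "\<omega> \<in> Dual \<Longrightarrow> \<omega> (\<Sum>i\<in>I. x i) = (\<Sum>i\<in>I. \<omega> (x i))"
  by (induction I rule: infinite_finite_induct) (simp_all add: dual_add dual_zero)

lemma zero_in_Dual: "0 \<in> Dual"
  and add_in_Dual: "\<omega> \<in> Dual \<Longrightarrow> \<theta> \<in> Dual \<Longrightarrow> \<omega> + \<theta> \<in> Dual"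
  and scale_in_Dual: "\<omega> \<in> Dual \<Longrightarrow> scale_fun (*) c \<omega> \<in> Dual"
  by (simp_all add: dual_iff scale_fun_def algebra_simps)

lemma dual_lin_ops: "\<omega> \<in> Dual \<longleftrightarrow> \<omega> \<in> lin_ops s (*) UNIV UNIV"
  by (auto simp: dual_iff lin_ops_def)

lemma dual_separates:
  assumes "\<And>\<omega>. \<omega> \<in> Dual \<Longrightarrow> \<omega> x = \<omega> y"
  shows "x = y"
proof (rule ccontr)
  assume "x \<noteq> y"
  interpret F: vector_space "(*) :: 'f \<Rightarrow> 'f \<Rightarrow> 'f" by (rule vector_space_field_mult)
  interpret p: vector_space_pair s "(*) :: 'f \<Rightarrow> 'f \<Rightarrow> 'f" ..
  have "independent {x - y}" using \<open>x \<noteq> y\<close> by simp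
  then obtain g where "Vector_Spaces.linear s (*) g" "g (x - y) = 1"
    using p.linear_independent_extend[of "{x - y}" "\<lambda>_. 1"] by auto
  moreover from this(1) have g: "g \<in> Dual" by (simp add: alg_dual_def)
  ultimately show False
    using assms[OF g] dual_add[OF g, of "x - y" y] by simp
qed

interpretation T: vector_space "tscale :: 'f \<Rightarrow> ('f, 'v) tensor \<Rightarrow> _"
  by (rule vector_space_tscale)

lemma subspace_Sym: "T.subspace (Sym n)"
  unfolding sym_power_def by (rule T.subspace_span)

lemma Sym_zero: "0 \<in> Sym n"
  and Sym_add: "f \<in> Sym n \<Longrightarrow> g \<in> Sym n \<Longrightarrow> f + g \<in> Sym n"
  and Sym_scale: "f \<in> Sym n \<Longrightarrow> tscale c f \<in> Sym n"
  using subspace_Sym by (simp_all add: T.subspace_0 T.subspace_add T.subspace_scale)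

lemma sym_prod_in_Sym: "length vs = n \<Longrightarrow> sym_prod s vs \<in> Sym n"
  unfolding sym_power_def by (rule T.span_base) auto

text \<open>
  The value of a symmetric product is a permanent divided by a factorial.
\<close>
lemma sym_prod_apply:
  "sym_prod s vs ws = (if length ws = length vs \<and> set ws \<subseteq> Dual
     then 1 / fact (length vs) *
       (\<Sum>\<pi> | \<pi> permutes {..<length vs}. \<Prod>i<length vs. (ws ! i) (vs ! \<pi> i)) else 0)"
proof -
  have "elem_tensor s (permute_list \<pi> vs) ws = (if length ws = length vs \<and> set ws \<subseteq> Dual
      then \<Prod>i<length vs. (ws ! i) (vs ! \<pi> i) else 0)" if "\<pi> permutes {..<length vs}" for \<pi>
    using permute_list_nth[OF that] by (auto simp: elem_tensor_def intro!: prod.cong)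
  then show ?thesis
    by (cases "length ws = length vs \<and> set ws \<subseteq> Dual")
      (auto simp: sym_prod_def scale_fun_def sum_fun_apply)
qed

text \<open>
  Expanding along columns instead of rows is what makes linearity in the vectors as visible as
  linearity in the functionals.
\<close>
lemma permanent_transpose:
  fixes g :: "nat \<Rightarrow> nat \<Rightarrow> 'f"
  shows "(\<Sum>\<pi> | \<pi> permutes {..<n}. \<Prod>i<n. g i (\<pi> i)) =
   (\<Sum>\<pi> | \<pi> permutes {..<n}. \<Prod>i<n. g (\<pi> i) i)"
proof -
  have "(\<Prod>i<n. g i (inv \<pi> i)) = (\<Prod>i<n. g (\<pi> i) i)" if "\<pi> permutes {..<n}" for \<pi>
    using prod.permute[OF that, of "\<lambda>i. g i (inv \<pi> i)"] that
    by (simp add: comp_def permutes_inverses)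
  then show ?thesis
    by (subst sum_permutations_inverse) (auto intro!: sum.cong)
qed

lemma sym_prod_apply':
  "sym_prod s vs ws = (if length ws = length vs \<and> set ws \<subseteq> Dual
     then 1 / fact (length vs) *
       (\<Sum>\<pi> | \<pi> permutes {..<length vs}. \<Prod>i<length vs. (ws ! \<pi> i) (vs ! i)) else 0)"
  using permanent_transpose[where n = "length vs" and g = "\<lambda>i j. (ws ! i) (vs ! j)"] by (simp add: sym_prod_apply)

lemma permanent_permute:
  fixes g :: "nat \<Rightarrow> nat \<Rightarrow> 'f"
  assumes "\<sigma> permutes {..<n}"
  shows "(\<Sum>\<pi> | \<pi> permutes {..<n}. \<Prod>i<n. g i (\<sigma> (\<pi> i))) =
   (\<Sum>\<pi> | \<pi> permutes {..<n}. \<Prod>i<n. g i (\<pi> i))"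
  using setum_permutations_compose_left[OF assms, of "\<lambda>\<pi>. \<Prod>i<n. g i (\<pi> i)"] by (simp add: comp_def)

lemma sym_prod_mset_cong:
  assumes "mset vs = mset vs'"
  shows "sym_prod s vs = sym_prod s vs'"
proof
  fix ws
  obtain \<sigma> where \<sigma>: "\<sigma> permutes {..<length vs'}" "permute_list \<sigma> vs' = vs"
    using mset_eq_permutation[OF assms] by auto
  then have "length vs = length vs'" by auto
  moreover have "vs ! \<pi> i = vs' ! \<sigma> (\<pi> i)" if "\<pi> permutes {..<length vs'}" "i < length vs'" for \<pi> i
    using that \<sigma> permute_list_nth[OF \<sigma>(1), of "\<pi> i"] permutes_in_image[OF that(1), of i] by auto
  ultimately show "sym_prod s vs ws = sym_prod s vs' ws"
    using permanent_permute[OF \<sigma>(1), where g = "\<lambda>i j. (ws ! i) (vs' ! j)"] by (simp add: sym_prod_apply)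
qed

lemma sym_prod_apply_mset_cong:
  assumes "mset ws = mset ws'"
  shows "sym_prod s vs ws = sym_prod s vs ws'"
proof (cases "length ws = length vs")
  case True
  obtain \<sigma> where \<sigma>: "\<sigma> permutes {..<length ws'}" "permute_list \<sigma> ws' = ws"
    using mset_eq_permutation[OF assms] by auto
  have l: "length ws' = length vs" and set: "set ws = set ws'"
    using True assms mset_eq_length mset_eq_setD by metis+
  have "ws ! \<pi> i = ws' ! \<sigma> (\<pi> i)" if "\<pi> permutes {..<length vs}" "i < length vs" for \<pi> i
    using that \<sigma> l permute_list_nth[OF \<sigma>(1), of "\<pi> i"] permutes_in_image[OF that(1), of i] by auto
  then show ?thesis
    using permanent_permute[where \<sigma> = \<sigma> and n = "length vs" and g = "\<lambda>i j. (ws' ! j) (vs ! i)"] \<sigma>(1) True l set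
    by (simp add: sym_prod_apply')
next
  case False
  then show ?thesis
    using mset_eq_length[OF assms] by (simp add: sym_prod_apply)
qed

lemma sym_prod_multilinear: "sym_multilinear s tscale UNIV (sym_prod s)"
  unfolding sym_multilinear_def
proof (intro conjI allI ballI impI)
  fix x y :: 'v and zs :: "'v list"
  show "sym_prod s ((x + y) # zs) = sym_prod s (x # zs) + sym_prod s (y # zs)"
  proof
    fix ws
    have "(ws ! \<pi> 0) (x + y) = (ws ! \<pi> 0) x + (ws ! \<pi> 0) y"
      if "length ws = Suc (length zs)" "set ws \<subseteq> Dual" "\<pi> permutes {..<Suc (length zs)}" for \<pi>
      using that permutes_in_image[OF that(3), of 0] by (intro dual_add) auto
    then show "sym_prod s ((x + y) # zs) ws = (sym_prod s (x # zs) + sym_prod s (y # zs)) ws"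
      unfolding sym_prod_apply' plus_fun_apply
      by (auto simp: prod.lessThan_Suc_shift algebra_simps sum.distrib
          simp del: prod.lessThan_Suc fact_Suc)
  qed
next
  fix c and x :: 'v and zs :: "'v list"
  show "sym_prod s (s c x # zs) = tscale c (sym_prod s (x # zs))"
  proof
    fix ws
    have "(ws ! \<pi> 0) (s c x) = c * (ws ! \<pi> 0) x"
      if "length ws = Suc (length zs)" "set ws \<subseteq> Dual" "\<pi> permutes {..<Suc (length zs)}" for \<pi>
      using that permutes_in_image[OF that(3), of 0] by (intro dual_scale) auto
    then show "sym_prod s (s c x # zs) ws = tscale c (sym_prod s (x # zs)) ws"
      unfolding sym_prod_apply' scale_fun_def
      by (auto simp: prod.lessThan_Suc_shift sum_distrib_left mult_ac intro!: sum.cong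
          simp del: prod.lessThan_Suc fact_Suc)
  qed
qed (rule sym_prod_mset_cong)

lemma sym_prod_apply_multilinear: "sym_multilinear (scale_fun (*)) (*) Dual (sym_prod s vs)"
  unfolding sym_multilinear_def
proof (intro conjI allI ballI impI)
  fix x y :: "'v \<Rightarrow> 'f" and zs assume "x \<in> Dual" "y \<in> Dual" "set zs \<subseteq> Dual"
  then show "sym_prod s vs ((x + y) # zs) = sym_prod s vs (x # zs) + sym_prod s vs (y # zs)"
    unfolding sym_prod_apply
    by (cases "length vs") (auto simp: prod.lessThan_Suc_shift algebra_simps sum.distrib
        add_in_Dual simp del: prod.lessThan_Suc fact_Suc)
next
  fix c and x :: "'v \<Rightarrow> 'f" and zs assume "x \<in> Dual" "set zs \<subseteq> Dual"
  then show "sym_prod s vs (scale_fun (*) c x # zs) = c * sym_prod s vs (x # zs)"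
    unfolding sym_prod_apply
    by (cases "length vs") (auto simp: prod.lessThan_Suc_shift sum_distrib_left mult_ac
        scale_in_Dual scale_fun_apply intro!: sum.cong simp del: prod.lessThan_Suc fact_Suc)
qed (rule sym_prod_apply_mset_cong)

lemma tensor_pow_apply:
  "pw n v ws = (if length ws = n \<and> set ws \<subseteq> Dual then (\<Prod>w\<leftarrow>ws. w v) else 0)"
  by (auto simp: tensor_pow_def elem_tensor_def prod.list_conv_set_nth atLeast0LessThan)

lemma sym_prod_replicate: "sym_prod s (replicate n v) = pw n v"
proof
  fix ws :: "('v \<Rightarrow> 'f) list"
  have "(\<Prod>i<n. (ws ! i) (replicate n v ! \<pi> i)) = (\<Prod>i<n. (ws ! i) v)" if "\<pi> permutes {..<n}" for \<pi>
    using permutes_in_image[OF that] by (intro prod.cong) auto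
  then show "sym_prod s (replicate n v) ws = pw n v ws"
    by (simp add: sym_prod_apply tensor_pow_apply prod.list_conv_set_nth atLeast0LessThan
        card_permutations)
qed

lemma tensor_pow_in_Sym: "pw n v \<in> Sym n"
  by (metis length_replicate sym_prod_in_Sym sym_prod_replicate)

text \<open>
  Polarization of the symmetric product modulo the span of the powers.
\<close>
lemma Sym_eq_span_powers: "Sym n = T.span (range (pw n))"
proof
  have "sym_prod s vs \<in> T.span (range (pw n))" if "length vs = n" for vs
    by (rule polarization[OF vector_space_tscale T.subspace_span sym_prod_multilinear])
      (auto simp: that sym_prod_replicate intro: T.span_base)
  then show "Sym n \<subseteq> T.span (range (pw n))"
    unfolding sym_power_def by (intro T.span_minimal) auto
  show "T.span (range (pw n)) \<subseteq> Sym n"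
    by (rule T.span_minimal) (auto simp: tensor_pow_in_Sym subspace_Sym)
qed

lemma Sym_induct [consumes 1, case_names power add scale]:
  assumes "f \<in> Sym n" "\<And>v. Q (pw n v)"
    "\<And>f g. f \<in> Sym n \<Longrightarrow> g \<in> Sym n \<Longrightarrow> Q f \<Longrightarrow> Q g \<Longrightarrow> Q (f + g)"
    "\<And>c f. f \<in> Sym n \<Longrightarrow> Q f \<Longrightarrow> Q (tscale c f)"
  shows "Q f"
proof -
  have "Q (tscale 0 (pw n 0))"
    using assms(2,4) tensor_pow_in_Sym by blast
  then have "Q 0" by simp
  then have "T.subspace {f. f \<in> Sym n \<and> Q f}"
    using assms(3,4) Sym_zero Sym_add Sym_scale by (intro T.subspaceI) auto
  then have "f \<in> Sym n \<and> Q f"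
    using T.span_induct[of f "range (pw n)" "\<lambda>f. f \<in> Sym n \<and> Q f"] assms(1,2) tensor_pow_in_Sym
    unfolding Sym_eq_span_powers[symmetric] by blast
  then show ?thesis ..
qed

lemma Sym_apply_outside:
  assumes "f \<in> Sym n" "\<not> (length ws = n \<and> set ws \<subseteq> Dual)"
  shows "f ws = 0"
  using assms by (induction rule: Sym_induct) (auto simp: tensor_pow_apply scale_fun_def)

lemma Sym_multilinear:
  assumes "f \<in> Sym n"
  shows "sym_multilinear (scale_fun (*)) (*) Dual f"
  using assms
proof (induction rule: Sym_induct)
  case (power v)
  then show ?case using sym_prod_apply_multilinear by (metis sym_prod_replicate)
next
  case (add f g)
  note f = sym_multilinearD[OF add(3)] and g = sym_multilinearD[OF add(4)]
  show ?case
    unfolding sym_multilinear_def plus_fun_apply[of f g]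
    by (intro conjI allI impI ballI) (metis f(1) g(1), simp_all add: f(2,3) g(2,3) algebra_simps)
next
  case (scale c f)
  note f = sym_multilinearD[OF scale(2)]
  show ?case
    unfolding sym_multilinear_def scale_fun_def[of "(*)" c f]
    by (intro conjI allI impI ballI) (metis f(1), simp_all add: f(2,3) algebra_simps)
qed

lemma sym_multilinear_diff:
  assumes "sym_multilinear sX (*) X M" "sym_multilinear sX (*) X N"
  shows "sym_multilinear sX ((*) :: 'f \<Rightarrow> 'f \<Rightarrow> 'f) X (\<lambda>xs. M xs - N xs)"
proof -
  note M = sym_multilinearD[OF assms(1)] and N = sym_multilinearD[OF assms(2)]
  show ?thesis
    unfolding sym_multilinear_def
    by (intro conjI allI impI ballI) (metis M(1) N(1), simp_all add: M(2,3) N(2,3) algebra_simps)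
qed

lemma polarization_eq:
  fixes M N :: "('v \<Rightarrow> 'f) list \<Rightarrow> 'f"
  assumes "sym_multilinear (scale_fun (*)) (*) Dual M" "sym_multilinear (scale_fun (*)) (*) Dual N"
    and "\<And>\<omega>. \<omega> \<in> Dual \<Longrightarrow> M (replicate n \<omega>) = N (replicate n \<omega>)"
    and "length ws = n" "set ws \<subseteq> Dual"
  shows "M ws = N ws"
proof -
  have "M ws - N ws \<in> {0}"
    by (rule polarization[OF vector_space_field_mult subspace_zero[OF vector_space_field_mult]
          sym_multilinear_diff[OF assms(1,2)], where n = n])
      (use assms(3-) zero_in_Dual in \<open>auto simp: scale_in_Dual add_in_Dual\<close>)
  then show ?thesis by simp
qed

text \<open>
  A symmetric tensor is a symmetric form on the dual, hence determined by its diagonal; this is why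
  the components of a polynomial on the dual are unique.
\<close>
lemma Sym_eqI_diagonal:
  assumes "f \<in> Sym n" "g \<in> Sym n" "\<And>\<omega>. \<omega> \<in> Dual \<Longrightarrow> f (replicate n \<omega>) = g (replicate n \<omega>)"
  shows "f = g"
proof
  fix ws
  show "f ws = g ws"
  proof (cases "length ws = n \<and> set ws \<subseteq> Dual")
    case True
    then show ?thesis
      by (intro polarization_eq[OF Sym_multilinear[OF assms(1)] Sym_multilinear[OF assms(2)] assms(3)]) auto
  next
    case False
    then show ?thesis using Sym_apply_outside[OF assms(1)] Sym_apply_outside[OF assms(2)] by simp
  qed
qed

lemma lin_ops_Sym_eqI:
  assumes "vector_space sW" "A \<in> lin_ops tscale sW (Sym n) W" "B \<in> lin_ops tscale sW (Sym n) W'"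
    and "\<And>v. A (pw n v) = B (pw n v)"
  shows "A = B"
  by (rule lin_ops_eqI_span[OF vector_space_tscale assms(1-3) Sym_eq_span_powers]) (auto simp: assms(4))

lemma pow_ext_eqI:
  assumes "vector_space sW" "C \<in> lin_ops tscale sW (Sym n) W" "\<And>v. C (pw n v) = \<phi> v"
  shows "pow_ext s sW W n \<phi> = C"
  unfolding pow_ext_def
  by (rule the_equality) (use assms lin_ops_Sym_eqI[OF assms(1)] in auto)

lemma contraction_in_Sym:
  assumes "f \<in> Sym (k + l)" "length ws = l" "set ws \<subseteq> Dual"
  shows "(\<lambda>us. f (us @ ws)) \<in> Sym k"
  using assms(1)
proof (induction rule: Sym_induct)
  case (power v)
  have "(\<lambda>us. pw (k + l) v (us @ ws)) = tscale (\<Prod>w\<leftarrow>ws. w v) (pw k v)"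
    using assms(2,3) by (auto simp: tensor_pow_apply scale_fun_def)
  then show ?case by (simp add: Sym_scale tensor_pow_in_Sym)
next
  case (add f g)
  then show ?case using Sym_add[of "\<lambda>us. f (us @ ws)" k "\<lambda>us. g (us @ ws)"] by (simp add: plus_fun_def)
next
  case (scale c f)
  then show ?case using Sym_scale[of "\<lambda>us. f (us @ ws)" k c] by (simp add: scale_fun_def)
qed

text \<open>
  Evaluates A on the first slots of a tensor and leaves a tensor in the last l slots.
\<close>
definition contract :: "nat \<Rightarrow> (('f, 'v) tensor \<Rightarrow> 'f) \<Rightarrow> ('f, 'v) tensor \<Rightarrow> ('f, 'v) tensor" where
  "contract l A f = (\<lambda>ws. if length ws = l \<and> set ws \<subseteq> Dual then A (\<lambda>us. f (us @ ws)) else 0)"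

lemma contract_power:
  assumes "A \<in> lin_ops tscale (*) (Sym k) UNIV"
  shows "contract l A (pw (k + l) v) = tscale (A (pw k v)) (pw l v)"
proof
  fix ws
  have "(\<lambda>us. pw (k + l) v (us @ ws)) = tscale (\<Prod>w\<leftarrow>ws. w v) (pw k v)"
    if "length ws = l" "set ws \<subseteq> Dual"
    using that by (auto simp: tensor_pow_apply scale_fun_def)
  then show "contract l A (pw (k + l) v) ws = tscale (A (pw k v)) (pw l v) ws"
    using lin_opsD(3)[OF assms tensor_pow_in_Sym]
    by (auto simp: contract_def tensor_pow_apply[of l] scale_fun_def[of _ "A (pw k v)"])
qed

lemma contract_add:
  assumes "A \<in> lin_ops tscale (*) (Sym k) UNIV" "f \<in> Sym (k + l)" "g \<in> Sym (k + l)"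
  shows "contract l A (f + g) = contract l A f + contract l A g"
  using lin_opsD(2)[OF assms(1) contraction_in_Sym contraction_in_Sym, OF assms(2) _ _ assms(3)]
  by (auto simp: contract_def fun_eq_iff plus_fun_def)

lemma contract_scale:
  assumes "A \<in> lin_ops tscale (*) (Sym k) UNIV" "f \<in> Sym (k + l)"
  shows "contract l A (tscale c f) = tscale c (contract l A f)"
  using lin_opsD(3)[OF assms(1) contraction_in_Sym, OF assms(2)]
  by (auto simp: contract_def fun_eq_iff scale_fun_def)

lemma contract_in_Sym:
  assumes "A \<in> lin_ops tscale (*) (Sym k) UNIV" "f \<in> Sym (k + l)"
  shows "contract l A f \<in> Sym l"
  using assms(2)
proof (induction rule: Sym_induct)
  case (power v)
  then show ?case by (simp add: contract_power[OF assms(1)] Sym_scale tensor_pow_in_Sym)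
next
  case (add f g)
  then show ?case by (simp only: contract_add[OF assms(1)] Sym_add)
next
  case (scale c f)
  then show ?case by (simp only: contract_scale[OF assms(1)] Sym_scale)
qed

lemma contract_compose_lin_ops:
  assumes "A1 \<in> lin_ops tscale (*) (Sym k) UNIV" "A2 \<in> lin_ops tscale sW (Sym l) W"
    and "vector_space sW" "module.subspace sW W"
  shows "(\<lambda>f. if f \<in> Sym (k + l) then A2 (contract l A1 f) else 0) \<in> lin_ops tscale sW (Sym (k + l)) W"
  using lin_opsD(1,2,3)[OF assms(2) contract_in_Sym[OF assms(1)]] contract_in_Sym[OF assms(1)]
  by (intro lin_opsI) (simp_all add: Sym_add Sym_scale contract_add[OF assms(1)] contract_scale[OF assms(1)])

text \<open>
  The contraction supplies the operator whose existence the definition of the product of operators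
  presupposes, without a basis of V. It also evaluates the product on tensors that are not powers,
  as composition of series requires.
\<close>
lemma op_prod_eq_contract:
  assumes "A1 \<in> lin_ops tscale (*) (Sym k) UNIV" "A2 \<in> lin_ops tscale sW (Sym l) W"
    and "vector_space sW" "module.subspace sW W"
  shows "op_prod s sW W k l A1 A2 = (\<lambda>f. if f \<in> Sym (k + l) then A2 (contract l A1 f) else 0)"
  unfolding op_prod_def
  by (rule pow_ext_eqI[OF assms(3) contract_compose_lin_ops[OF assms]])
    (simp add: tensor_pow_in_Sym contract_power[OF assms(1)] lin_opsD(3)[OF assms(2)])

lemma op_prod_lin_ops:
  assumes "A1 \<in> lin_ops tscale (*) (Sym k) UNIV" "A2 \<in> lin_ops tscale sW (Sym l) W"
    and "vector_space sW" "module.subspace sW W"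
  shows "op_prod s sW W k l A1 A2 \<in> lin_ops tscale sW (Sym (k + l)) W"
  by (simp add: op_prod_eq_contract[OF assms] contract_compose_lin_ops[OF assms])

lemma op_prod_power:
  assumes "A1 \<in> lin_ops tscale (*) (Sym k) UNIV" "A2 \<in> lin_ops tscale sW (Sym l) W"
    and "vector_space sW" "module.subspace sW W" and "k + l = n"
  shows "op_prod s sW W k l A1 A2 (pw n v) = sW (A1 (pw k v)) (A2 (pw l v))"
  unfolding op_prod_eq_contract[OF assms(1-4)] \<open>k + l = n\<close>[symmetric]
  by (simp add: tensor_pow_in_Sym contract_power[OF assms(1)] lin_opsD(3)[OF assms(2)])

section \<open>Operators given by their values on powers\<close>

abbreviation Functionals :: "nat \<Rightarrow> (('f, 'v) tensor \<Rightarrow> 'f) set" where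
  "Functionals n \<equiv> lin_ops tscale (*) (Sym n) UNIV"

lemmas field_space = vector_space_field_mult module_subspace_UNIV[OF vector_space_field_mult]

text \<open>
  The homogeneous functions on V that come from a functional on the symmetric power of degree n. They
  are closed under sums and products, so that operators given only by their values on powers can be
  shown to exist.
\<close>
definition representable :: "nat \<Rightarrow> ('v \<Rightarrow> 'f) \<Rightarrow> bool" where
  "representable n \<phi> \<longleftrightarrow> (\<exists>C\<in>Functionals n. \<forall>v. C (pw n v) = \<phi> v)"

lemma representableI: "A \<in> Functionals n \<Longrightarrow> representable n (\<lambda>v. A (pw n v))"
  unfolding representable_def by blast

lemma representable_const: "representable 0 (\<lambda>_. c)"
  unfolding representable_def
proof (intro bexI allI)
  let ?C = "\<lambda>f. if f \<in> Sym 0 then c * f [] else 0"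
  show "?C (pw 0 v) = c" for v
    by (simp add: tensor_pow_in_Sym) (simp add: tensor_pow_apply)
  show "?C \<in> Functionals 0"
    by (rule lin_opsI) (auto simp: Sym_add Sym_scale scale_fun_apply algebra_simps)
qed

lemma representable_sum:
  assumes "\<And>i. i \<in> I \<Longrightarrow> representable n (\<phi> i)"
  shows "representable n (\<lambda>v. \<Sum>i\<in>I. \<phi> i v)"
proof -
  obtain C where "\<And>i. i \<in> I \<Longrightarrow> C i \<in> Functionals n \<and> (\<forall>v. C i (pw n v) = \<phi> i v)"
    using assms unfolding representable_def by metis
  then show ?thesis
    unfolding representable_def
    by (intro bexI[of _ "\<Sum>i\<in>I. C i"] lin_ops_sum field_space) (auto simp: sum_fun_apply)
qed

lemma representable_mult:
  assumes "representable k \<phi>" "representable l \<psi>"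
  shows "representable (k + l) (\<lambda>v. \<phi> v * \<psi> v)"
proof -
  obtain A B where A: "A \<in> Functionals k" "\<And>v. A (pw k v) = \<phi> v"
    and B: "B \<in> Functionals l" "\<And>v. B (pw l v) = \<psi> v"
    using assms unfolding representable_def by blast
  show ?thesis
    unfolding representable_def
    using op_prod_lin_ops[OF A(1) B(1) field_space] op_prod_power[OF A(1) B(1) field_space refl] A B
    by auto
qed

lemma representable_scale: "representable n \<phi> \<Longrightarrow> representable n (\<lambda>v. c * \<phi> v)"
  using representable_mult[OF representable_const] by simp

lemma representable_zero: "representable n (\<lambda>_. 0)"
  using representable_sum[of "{}" n] by simp

lemma representable_prod:
  assumes "finite I" "\<And>i. i \<in> I \<Longrightarrow> representable (d i) (\<phi> i)"
  shows "representable (\<Sum>i\<in>I. d i) (\<lambda>v. \<Prod>i\<in>I. \<phi> i v)"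
  using assms by induction (simp_all add: representable_const representable_mult)

text \<open>
  A tensor is a function on lists of functionals, so it suffices to represent each of its values; that
  the resulting operator maps into the symmetric power needs to be known on powers only.
\<close>
lemma tensor_valued_operator_exists:
  assumes "\<And>v. \<phi> v \<in> Sym k" and "\<And>ws. representable n (\<lambda>v. \<phi> v ws)"
  shows "\<exists>C \<in> lin_ops tscale tscale (Sym n) (Sym k). \<forall>v. C (pw n v) = \<phi> v"
proof -
  obtain C where C: "\<And>ws. C ws \<in> Functionals n" "\<And>ws v. C ws (pw n v) = \<phi> v ws"
    using assms(2) unfolding representable_def by metis
  let ?D = "\<lambda>f ws. C ws f"
  have D: "?D (f + g) = ?D f + ?D g" "?D (tscale c f) = tscale c (?D f)"
    if "f \<in> Sym n" "g \<in> Sym n" for f g c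
    using that lin_opsD(2,3)[OF C(1)] by (auto simp: fun_eq_iff scale_fun_apply)
  have "?D f \<in> Sym k" if "f \<in> Sym n" for f
    using that
  proof (induction rule: Sym_induct)
    case (power v)
    then show ?case using assms(1)[of v] C(2) by simp
  next
    case (add f g)
    then show ?case unfolding D(1)[OF add(1,2)] by (intro Sym_add)
  next
    case (scale c f)
    then show ?case unfolding D(2)[OF scale(1,1)] by (intro Sym_scale)
  qed
  then have "?D \<in> lin_ops tscale tscale (Sym n) (Sym k)"
    using D lin_opsD(4)[OF C(1)] by (intro lin_opsI) auto
  then show ?thesis using C(2) by (intro bexI[of _ ?D]) auto
qed

section \<open>Scalar series as ordinary power series along a line\<close>

text \<open>
  The restriction of A to the line through v, as a power series in the parameter t of the line.
\<close>
definition ser :: "('f, 'v, 'f) tps \<Rightarrow> 'v \<Rightarrow> 'f fps" where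
  "ser A v = Abs_fps (\<lambda>n. A n (pw n v))"

lemma ser_nth [simp]: "fps_nth (ser A v) n = A n (pw n v)"
  by (simp add: ser_def)

abbreviation Series :: "('f, 'v, 'f) tps set" where
  "Series \<equiv> tps_set s (*) UNIV"

lemma tps_setD: "A \<in> tps_set s sW W \<Longrightarrow> A n \<in> lin_ops tscale sW (Sym n) W"
  by (simp add: tps_set_def)

lemma tps_setI: "(\<And>n. A n \<in> lin_ops tscale sW (Sym n) W) \<Longrightarrow> A \<in> tps_set s sW W"
  by (simp add: tps_set_def)

lemma tps_eqI:
  assumes "vector_space sW" "A \<in> tps_set s sW W" "B \<in> tps_set s sW W'"
    and "\<And>n v. A n (pw n v) = B n (pw n v)"
  shows "A = B"
  using lin_ops_Sym_eqI[OF assms(1) tps_setD[OF assms(2)] tps_setD[OF assms(3)]] assms(4) by blast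

lemma ser_inject: "A \<in> Series \<Longrightarrow> B \<in> Series \<Longrightarrow> (\<And>v. ser A v = ser B v) \<Longrightarrow> A = B"
  using tps_eqI[OF vector_space_field_mult] by (metis ser_nth)

lemma tps_mult_in:
  assumes "A1 \<in> Series" "A2 \<in> tps_set s sW W" "vector_space sW" "module.subspace sW W"
  shows "tps_mult s sW W A1 A2 \<in> tps_set s sW W"
  unfolding tps_mult_def
  using op_prod_lin_ops[OF tps_setD[OF assms(1)] tps_setD[OF assms(2)] assms(3,4)]
  by (intro tps_setI lin_ops_sum assms(3,4)) (metis atMost_iff le_add_diff_inverse)

lemma tps_mult_power:
  assumes "A1 \<in> Series" "A2 \<in> tps_set s sW W" "vector_space sW" "module.subspace sW W"
  shows "tps_mult s sW W A1 A2 n (pw n v) = (\<Sum>k\<le>n. sW (A1 k (pw k v)) (A2 (n - k) (pw (n - k) v)))"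
  unfolding tps_mult_def sum_fun_apply
  by (intro sum.cong refl op_prod_power[OF tps_setD[OF assms(1)] tps_setD[OF assms(2)] assms(3,4)]) auto

lemma ser_mult:
  assumes "A1 \<in> Series" "A2 \<in> Series"
  shows "tps_mult s (*) UNIV A1 A2 \<in> Series"
    and "ser (tps_mult s (*) UNIV A1 A2) v = ser A1 v * ser A2 v"
  using tps_mult_in[OF assms field_space] tps_mult_power[OF assms field_space]
  by (auto simp: fps_eq_iff fps_mult_nth atLeast0AtMost)

lemma ser_one: "tps_one s \<in> Series" "ser (tps_one s) v = 1"
proof -
  obtain C where C: "C \<in> Functionals 0" "\<And>v. C (pw 0 v) = 1"
    using representable_const[of 1] unfolding representable_def by auto
  have one: "pow_ext s (*) UNIV 0 (\<lambda>v. 1) = C"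
    by (rule pow_ext_eqI[OF vector_space_field_mult]) (use C in auto)
  have "tps_one s = (\<lambda>n. if n = 0 then C else 0)"
    unfolding tps_one_def one by (rule refl)
  then show "tps_one s \<in> Series" "ser (tps_one s) v = 1"
    using C by (auto simp: tps_set_def fps_eq_iff lin_ops_zero field_space)
qed

lemma ser_power:
  assumes "A \<in> Series"
  shows "tps_power s A k \<in> Series" and "ser (tps_power s A k) v = ser A v ^ k"
  by (induction k) (simp_all add: ser_one ser_mult assms)

lemma ser_exp:
  assumes "A \<in> Series"
  shows "tps_exp s A \<in> Series"
    and "ser (tps_exp s A) v = Abs_fps (\<lambda>n. \<Sum>k\<le>n. 1 / fact k * fps_nth (ser A v ^ k) n)"
proof -
  show "tps_exp s A \<in> Series"
    unfolding tps_exp_def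
    using tps_setD[OF ser_power(1)[OF assms]]
    by (intro tps_setI lin_ops_sum lin_ops_scale field_space)
  show "ser (tps_exp s A) v = Abs_fps (\<lambda>n. \<Sum>k\<le>n. 1 / fact k * fps_nth (ser A v ^ k) n)"
    unfolding ser_power(2)[OF assms, symmetric]
    by (simp add: fps_eq_iff tps_exp_def sum_scale_fun_apply)
qed

lemma tps_at0_eq: "tps_at0 s A = A 0 (pw 0 v)"
  by (simp add: tps_at0_def tensor_pow_def)

text \<open>
  The coefficients of the inverse of ser A v are given by the recursion for reciprocals of power series,
  and each step of this recursion preserves representability.
\<close>
lemma F0_inverse:
  assumes "A \<in> tps_F0 s"
  shows "tps_inverse s A \<in> tps_F0 s" "tps_mult s (*) UNIV A (tps_inverse s A) = tps_one s"
    "ser (tps_inverse s A) v = inverse (ser A v)"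
proof -
  have A: "A \<in> Series" "fps_nth (ser A v) 0 \<noteq> 0" for v
    using assms by (auto simp: tps_F0_def tps_at0_eq[of A v])
  have "representable n (\<lambda>v. fps_nth (inverse (ser A v)) n)" for n
  proof (induction n rule: less_induct)
    case (less n)
    show ?case
    proof (cases n)
      case 0
      have "fps_nth (inverse (ser A v)) n = inverse (tps_at0 s A)" for v
        using 0 by (simp add: tps_at0_eq[of A v])
      then show ?thesis
        using 0 representable_const by simp
    next
      case (Suc m)
      have eq: "fps_nth (inverse (ser A v)) n = (- inverse (tps_at0 s A)) *
          (\<Sum>i = 1..n. A i (pw i v) * fps_nth (inverse (ser A v)) (n - i))" for v
        unfolding Suc fps_inverse_def tps_at0_eq[of A v] by simp
      have "representable (i + (n - i)) (\<lambda>v. A i (pw i v) * fps_nth (inverse (ser A v)) (n - i))"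
        if "i \<in> {1..n}" for i
        using that less.IH[of "n - i"]
        by (intro representable_mult representableI[OF tps_setD[OF A(1)]]) auto
      then show ?thesis
        unfolding eq by (intro representable_scale representable_sum) auto
    qed
  qed
  then obtain C where C: "\<And>n. C n \<in> Functionals n"
      "\<And>n v. C n (pw n v) = fps_nth (inverse (ser A v)) n"
    unfolding representable_def by metis
  have C1: "C \<in> Series" using C(1) by (intro tps_setI)
  have C2: "ser C v = inverse (ser A v)" for v
    by (simp add: fps_eq_iff C(2))
  have "C \<in> tps_F0 s"
    using C1 A(2) by (simp add: tps_F0_def tps_at0_eq[of _ 0] C(2))
  moreover have "tps_mult s (*) UNIV A C = tps_one s"
    by (rule ser_inject) (use A C1 C2 in \<open>auto simp: ser_mult ser_one inverse_mult_eq_1'\<close>)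
  moreover have "D = C" if "D \<in> tps_F0 s" "tps_mult s (*) UNIV A D = tps_one s" for D
  proof (rule ser_inject)
    show D: "D \<in> Series" using that by (simp add: tps_F0_def)
    have "ser A v * ser D v = 1" for v
      using that(2) by (metis ser_mult(2)[OF A(1) D] ser_one(2))
    then show "ser D v = ser C v" for v
      unfolding C2 by (rule fps_inverse_unique[symmetric])
  qed (rule C1)
  ultimately have "tps_inverse s A = C"
    unfolding tps_inverse_def by (intro the_equality) blast+
  then show "tps_inverse s A \<in> tps_F0 s" "tps_mult s (*) UNIV A (tps_inverse s A) = tps_one s"
    "ser (tps_inverse s A) v = inverse (ser A v)"
    using \<open>C \<in> tps_F0 s\<close> \<open>tps_mult s (*) UNIV A C = tps_one s\<close> C2 by auto
qed

section \<open>Tensor powers of a vector-valued series\<close>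

text \<open>
  The series that may be substituted: without a constant term, each coefficient of a composition is a
  finite sum.
\<close>
definition Vseries :: "('f, 'v, 'v) tps set" where
  "Vseries = {B \<in> tps_set s s UNIV. tps_at0 s B = 0}"

lemma Vseries_tps_set: "B \<in> Vseries \<Longrightarrow> B \<in> tps_set s s UNIV"
  and Vseries_at0: "B \<in> Vseries \<Longrightarrow> B 0 (pw 0 v) = 0"
  and F1_Vseries: "B \<in> tps_F1 s \<Longrightarrow> B \<in> Vseries"
  by (simp_all add: Vseries_def tps_F1_def tps_at0_eq[of _ v])

lemma dual_comp_Series: "\<omega> \<in> Dual \<Longrightarrow> B \<in> Vseries \<Longrightarrow> (\<lambda>n. \<omega> \<circ> B n) \<in> Series"
  using lin_ops_comp[of \<omega> s "(*)" UNIV UNIV] by (auto simp: Vseries_def tps_set_def dual_lin_ops)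

abbreviation pairing :: "('v \<Rightarrow> 'f) \<Rightarrow> ('f, 'v, 'v) tps \<Rightarrow> 'v \<Rightarrow> 'f fps" where
  "pairing \<omega> B \<equiv> ser (\<lambda>n. \<omega> \<circ> B n)"

lemma pairing_add: "pairing (\<omega> + \<theta>) B v = pairing \<omega> B v + pairing \<theta> B v"
  and pairing_scale: "pairing (scale_fun (*) c \<omega>) B v = fps_const c * pairing \<omega> B v"
  by (simp_all add: fps_eq_iff scale_fun_apply)

text \<open>
  The coefficients of a power are sums over lists of indices; since the constant term vanishes, only
  lists of positive indices contribute, and these index the tensor powers of a series.
\<close>
lemma power_nth_compositions:
  fixes b :: "'f fps"
  assumes "fps_nth b 0 = 0"
  shows "fps_nth (b ^ k) n =
    (\<Sum>is | length is = k \<and> (\<forall>i\<in>set is. 1 \<le> i) \<and> sum_list is = n. \<Prod>i\<leftarrow>is. fps_nth b i)"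
proof -
  have "fps_nth (b ^ k) n = (\<Sum>is\<in>natpermute n k. \<Prod>i\<leftarrow>is. fps_nth b i)"
  proof (cases k)
    case 0
    then show ?thesis by (simp add: natpermute_0)
  next
    case (Suc m)
    have "(\<Prod>j = 0..m. fps_nth b (is ! j)) = (\<Prod>i\<leftarrow>is. fps_nth b i)" if "is \<in> natpermute n k" for "is"
      using that Suc by (simp add: natpermute_def prod.list_conv_set_nth atLeastLessThanSuc_atLeastAtMost)
    then show ?thesis
      using Suc by (simp add: fps_power_nth del: power_Suc)
  qed
  also have "\<dots> = (\<Sum>is | length is = k \<and> (\<forall>i\<in>set is. 1 \<le> i) \<and> sum_list is = n.
      \<Prod>i\<leftarrow>is. fps_nth b i)"
  proof (rule sum.mono_neutral_right)
    show "\<forall>is\<in>natpermute n k - {is. length is = k \<and> (\<forall>i\<in>set is. 1 \<le> i) \<and> sum_list is = n}.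
        (\<Prod>i\<leftarrow>is. fps_nth b i) = 0"
      using assms by (force simp: natpermute_def prod_list_zero_iff not_le)
    show "finite (natpermute n k)" by (rule natpermute_finite)
  qed (auto simp: natpermute_def)
  finally show ?thesis .
qed

text \<open>
  Each value of the symmetric product on a list of functionals is a sum of products of functions that are
  representable in degrees adding up to n, hence representable.
\<close>
lemma tpow_summand:
  assumes "B \<in> Vseries" "length is = k" "sum_list is = n"
  defines "C \<equiv> pow_ext s tscale (sym_power s k) n (\<lambda>v. sym_prod s (map (\<lambda>i. B i (pw i v)) is))"
  shows "C \<in> lin_ops tscale tscale (Sym n) (Sym k)"
    and "C (pw n v) = sym_prod s (map (\<lambda>i. B i (pw i v)) is)"
proof -
  let ?\<phi> = "\<lambda>v. sym_prod s (map (\<lambda>i. B i (pw i v)) is)"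
  have "representable n (\<lambda>v. ?\<phi> v ws)" for ws
  proof (cases "length ws = k \<and> set ws \<subseteq> Dual")
    case True
    have "representable n (\<lambda>v. \<Prod>j<k. (ws ! j) (B (is ! \<pi> j) (pw (is ! \<pi> j) v)))"
      if "\<pi> permutes {..<k}" for \<pi>
    proof -
      have "(\<Sum>j<k. is ! \<pi> j) = n"
        using sum.permute[OF that, of "\<lambda>j. is ! j"] assms(2,3)
        by (simp add: sum_list_sum_nth atLeast0LessThan comp_def)
      moreover have "representable i (\<lambda>v. (ws ! j) (B i (pw i v)))" if "j < k" for j i
      proof -
        have "ws ! j \<in> Dual" using True that by auto
        then show ?thesis
          using representableI[OF tps_setD[OF dual_comp_Series[OF _ assms(1)]]] by (simp add: comp_def)
      qed
      ultimately show ?thesis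
        using representable_prod[of "{..<k}" "\<lambda>j. is ! \<pi> j"] by simp
    qed
    then have "representable n (\<lambda>v. 1 / fact k *
        (\<Sum>\<pi> | \<pi> permutes {..<k}. \<Prod>j<k. (ws ! j) (B (is ! \<pi> j) (pw (is ! \<pi> j) v))))"
      by (intro representable_scale representable_sum) auto
    moreover have "?\<phi> v ws = 1 / fact k *
        (\<Sum>\<pi> | \<pi> permutes {..<k}. \<Prod>j<k. (ws ! j) (B (is ! \<pi> j) (pw (is ! \<pi> j) v)))" for v
    proof -
      have "map (\<lambda>i. B i (pw i v)) is ! \<pi> j = B (is ! \<pi> j) (pw (is ! \<pi> j) v)"
        if "\<pi> permutes {..<k}" "j < k" for \<pi> j
        using that permutes_in_image[OF that(1), of j] assms(2) by simp
      then show ?thesis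
        using True assms(2) by (simp add: sym_prod_apply)
    qed
    ultimately show ?thesis by simp
  next
    case False
    then have "?\<phi> v ws = 0" for v using assms(2) by (auto simp: sym_prod_apply)
    then show ?thesis using representable_zero by simp
  qed
  then obtain D where "D \<in> lin_ops tscale tscale (Sym n) (Sym k)" "\<forall>v. D (pw n v) = ?\<phi> v"
    using tensor_valued_operator_exists[of ?\<phi> k n] assms(2) sym_prod_in_Sym by auto
  moreover from this have "C = D"
    unfolding C_def by (intro pow_ext_eqI vector_space_tscale) auto
  ultimately show "C \<in> lin_ops tscale tscale (Sym n) (Sym k)" "C (pw n v) = ?\<phi> v"
    by auto
qed

lemma tpow_in: "B \<in> Vseries \<Longrightarrow> tps_tpow s B k \<in> tps_set s tscale (Sym k)"
  unfolding tps_tpow_def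
  by (intro tps_setI lin_ops_sum vector_space_tscale subspace_Sym tpow_summand(1)) auto

lemma tpow_in_Sym: "B \<in> Vseries \<Longrightarrow> f \<in> Sym n \<Longrightarrow> tps_tpow s B k n f \<in> Sym k"
  using lin_opsD(1)[OF tps_setD[OF tpow_in]] .

lemma tpow_eq_0: "n < k \<Longrightarrow> tps_tpow s B k n = 0"
proof -
  assume "n < k"
  have "length is \<le> sum_list is" if "\<forall>i\<in>set is. 1 \<le> i" for "is" :: "nat list"
    using that by (induction "is") auto
  then have "{is. length is = k \<and> (\<forall>i\<in>set is. 1 \<le> i) \<and> sum_list is = n} = {}"
    using \<open>n < k\<close> by force
  then show ?thesis unfolding tps_tpow_def by (simp only: sum.empty)
qed

lemma tpow_diagonal:
  assumes "B \<in> Vseries" "\<omega> \<in> Dual"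
  shows "tps_tpow s B k n (pw n v) (replicate k \<omega>) = fps_nth (pairing \<omega> B v ^ k) n"
proof -
  have 0: "fps_nth (pairing \<omega> B v) 0 = 0"
    using assms Vseries_at0[OF assms(1)] by (simp add: dual_zero)
  show ?thesis
    unfolding tps_tpow_def sum_fun_apply power_nth_compositions[OF 0]
  proof (rule sum.cong[OF refl])
    fix "is" assume "is \<in> {is. length is = k \<and> (\<forall>i\<in>set is. 1 \<le> i) \<and> sum_list is = n}"
    then have "is": "length is = k" "sum_list is = n" by auto
    show "pow_ext s tscale (Sym k) n (\<lambda>v. sym_prod s (map (\<lambda>i. B i (pw i v)) is)) (pw n v)
        (replicate k \<omega>) = (\<Prod>i\<leftarrow>is. fps_nth (pairing \<omega> B v) i)"
      using dual_pow_sym_prod[OF assms(2), of "map (\<lambda>i. B i (pw i v)) is"] "is"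
      by (simp add: tpow_summand(2)[OF assms(1) "is"] dual_pow_def comp_def)
  qed
qed

lemma pairing_product_multilinear:
  assumes "B \<in> Vseries"
  shows "sym_multilinear (scale_fun (*)) (*) Dual (\<lambda>ws. fps_nth (\<Prod>w\<leftarrow>ws. pairing w B v) n)"
  unfolding sym_multilinear_def
proof (intro conjI allI impI ballI)
  fix xs ys :: "('v \<Rightarrow> 'f) list" assume "mset xs = mset ys"
  then have "prod_mset (mset (map (\<lambda>w. pairing w B v) xs)) = prod_mset (mset (map (\<lambda>w. pairing w B v) ys))"
    by simp
  then show "fps_nth (\<Prod>w\<leftarrow>xs. pairing w B v) n = fps_nth (\<Prod>w\<leftarrow>ys. pairing w B v) n"
    by (simp only: prod_mset_prod_list)
qed (simp_all only: list.map prod_list.Cons pairing_add pairing_scale distrib_right mult.assoc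
      fps_add_nth fps_mult_left_const_nth)

text \<open>
  The symmetrization inside each summand can be dropped, because the sum runs over all orders of the
  indices. Formally, both sides are symmetric multilinear in ws and agree on the diagonal.
\<close>
lemma tpow_apply:
  assumes "B \<in> Vseries" "length ws = k" "set ws \<subseteq> Dual"
  shows "tps_tpow s B k n (pw n v) ws = fps_nth (\<Prod>w\<leftarrow>ws. pairing w B v) n"
  using tpow_diagonal[OF assms(1)] assms
  by (subst polarization_eq[OF Sym_multilinear[OF tpow_in_Sym[OF assms(1) tensor_pow_in_Sym]]
        pairing_product_multilinear[OF assms(1)], of k])
    (simp_all add: map_replicate)

section \<open>Composition\<close>

lemma comp_in:
  assumes "A \<in> tps_set s sW W" "B \<in> Vseries" "vector_space sW" "module.subspace sW W"
  shows "tps_comp s A B \<in> tps_set s sW W"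
  unfolding tps_comp_def
  using lin_ops_comp[OF tps_setD[OF assms(1)] tps_setD[OF tpow_in[OF assms(2)]]]
  by (intro tps_setI lin_ops_sum assms(3,4))

lemma tps_comp_apply: "tps_comp s A B n f = (\<Sum>k\<le>n. A k (tps_tpow s B k n f))"
  by (simp add: tps_comp_def sum_fun_apply)

text \<open>
  Splitting the list of functionals splits the product of series in the previous description of tensor
  powers: restricted to a + b slots, the tensor power of B is a convolution of the tensor powers with
  a and b slots.
\<close>
lemma op_prod_tpow:
  assumes "A1 \<in> Functionals a" "A2 \<in> Functionals b" "B \<in> Vseries"
  shows "op_prod s (*) UNIV a b A1 A2 (tps_tpow s B (a + b) n (pw n v)) =
    (\<Sum>m\<le>n. A1 (tps_tpow s B a m (pw m v)) * A2 (tps_tpow s B b (n - m) (pw (n - m) v)))"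
proof -
  let ?h = "\<lambda>k n. tps_tpow s B k n (pw n v)"
  have h: "?h k n \<in> Sym k" for k n
    by (intro tpow_in_Sym tensor_pow_in_Sym assms(3))
  have split: "(\<lambda>us. ?h (a + b) n (us @ ws)) = (\<Sum>m\<le>n. tscale (?h b (n - m) ws) (?h a m))"
    if ws: "length ws = b" "set ws \<subseteq> Dual" for ws
  proof
    fix us
    show "?h (a + b) n (us @ ws) = (\<Sum>m\<le>n. tscale (?h b (n - m) ws) (?h a m)) us"
    proof (cases "length us = a \<and> set us \<subseteq> Dual")
      case True
      then show ?thesis
        using ws assms(3) by (simp add: sum_scale_fun_apply tpow_apply fps_mult_nth atLeast0AtMost mult.commute)
    next
      case False
      then have "?h (a + b) n (us @ ws) = 0" "\<And>m. ?h a m us = 0"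
        using ws Sym_apply_outside[OF h] by auto
      then show ?thesis by (simp add: sum_scale_fun_apply)
    qed
  qed
  have "contract b A1 (?h (a + b) n) = (\<Sum>m\<le>n. tscale (A1 (?h a m)) (?h b (n - m)))"
  proof
    fix ws
    show "contract b A1 (?h (a + b) n) ws = (\<Sum>m\<le>n. tscale (A1 (?h a m)) (?h b (n - m))) ws"
    proof (cases "length ws = b \<and> set ws \<subseteq> Dual")
      case True
      then show ?thesis
        unfolding contract_def sum_scale_fun_apply
        by (simp add: split lin_ops_sum_value[OF assms(1) subspace_Sym vector_space_tscale]
            lin_opsD(3)[OF assms(1)] Sym_scale h mult.commute)
    next
      case False
      then have "?h b m ws = 0" for m
        using Sym_apply_outside[OF h] by auto
      then show ?thesis using False by (auto simp: contract_def sum_scale_fun_apply)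
    qed
  qed
  then show ?thesis
    using lin_ops_sum_value[OF assms(2) subspace_Sym vector_space_tscale Sym_scale[OF h]]
      lin_opsD(3)[OF assms(2) h] h
    by (simp add: op_prod_eq_contract[OF assms(1,2) field_space])
qed

text \<open>
  Substitution is multiplicative, by collecting the convolutions above according to the number of slots
  on each side. All coefficient sums may be extended to a common range because tensor powers with more
  slots than their degree vanish.
\<close>
lemma comp_mult:
  assumes "A1 \<in> Series" "A2 \<in> Series" "B \<in> Vseries"
  shows "tps_comp s (tps_mult s (*) UNIV A1 A2) B =
    tps_mult s (*) UNIV (tps_comp s A1 B) (tps_comp s A2 B)"
proof (rule tps_eqI[OF vector_space_field_mult])
  note c = comp_in[OF _ assms(3) field_space]
  show "tps_comp s (tps_mult s (*) UNIV A1 A2) B \<in> Series"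
    "tps_mult s (*) UNIV (tps_comp s A1 B) (tps_comp s A2 B) \<in> Series"
    by (rule c ser_mult(1) assms)+
  fix n v
  let ?X = "\<lambda>a m. A1 a (tps_tpow s B a m (pw m v))" and ?Y = "\<lambda>a m. A2 a (tps_tpow s B a m (pw m v))"
  have X0: "?X a m = 0" and Y0: "?Y a m = 0" if "m < a" for a m :: nat
    using that lin_ops_zero_value[OF tps_setD[OF assms(1)]] lin_ops_zero_value[OF tps_setD[OF assms(2)]]
    by (simp_all add: tpow_eq_0)
  let ?F = "\<lambda>a b. \<Sum>m\<le>n. ?X a m * ?Y b (n - m)"
  have F0: "?F a b = 0" if "n < a + b" for a b :: nat
  proof (intro sum.neutral ballI)
    fix m assume "m \<in> {..n}"
    then have "m < a \<or> n - m < b" using that by auto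
    then show "?X a m * ?Y b (n - m) = 0" using X0 Y0 by auto
  qed
  have "tps_comp s (tps_mult s (*) UNIV A1 A2) B n (pw n v) = (\<Sum>k\<le>n. \<Sum>a\<le>k. ?F a (k - a))"
    unfolding tps_comp_apply tps_mult_def sum_fun_apply
  proof (intro sum.cong refl)
    fix k a :: nat assume "a \<in> {..k}"
    then have "a + (k - a) = k" by simp
    then show "op_prod s (*) UNIV a (k - a) (A1 a) (A2 (k - a)) (tps_tpow s B k n (pw n v)) = ?F a (k - a)"
      using op_prod_tpow[OF tps_setD[OF assms(1)] tps_setD[OF assms(2)] assms(3), of a "k - a"] by simp
  qed
  also have "\<dots> = (\<Sum>(a, b)\<in>{(a, b). a + b \<le> n}. ?F a b)"
    by (rule sum.triangle_reindex_eq[symmetric])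
  also have "\<dots> = (\<Sum>(a, b)\<in>{..n} \<times> {..n}. ?F a b)"
  proof (rule sum.mono_neutral_left)
    show "\<forall>i\<in>{..n} \<times> {..n} - {(a, b). a + b \<le> n}. (case i of (a, b) \<Rightarrow> ?F a b) = 0"
    proof
      fix p assume "p \<in> {..n} \<times> {..n} - {(a, b). a + b \<le> n}"
      then have "n < fst p + snd p" by auto
      then show "(case p of (a, b) \<Rightarrow> ?F a b) = 0"
        unfolding case_prod_beta by (rule F0)
    qed
  qed auto
  also have "\<dots> = (\<Sum>a\<le>n. \<Sum>b\<le>n. ?F a b)"
    by (rule sum.cartesian_product[symmetric])
  also have "\<dots> = (\<Sum>a\<le>n. \<Sum>m\<le>n. \<Sum>b\<le>n. ?X a m * ?Y b (n - m))"
    by (rule sum.cong[OF refl], rule sum.swap)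
  also have "\<dots> = (\<Sum>m\<le>n. (\<Sum>a\<le>n. ?X a m) * (\<Sum>b\<le>n. ?Y b (n - m)))"
    unfolding sum_product by (rule sum.swap)
  also have "\<dots> = (\<Sum>m\<le>n. (\<Sum>a\<le>m. ?X a m) * (\<Sum>b\<le>n - m. ?Y b (n - m)))"
  proof (rule sum.cong[OF refl])
    fix m assume "m \<in> {..n}"
    then have "(\<Sum>a\<le>n. ?X a m) = (\<Sum>a\<le>m. ?X a m)" "(\<Sum>b\<le>n. ?Y b (n - m)) = (\<Sum>b\<le>n - m. ?Y b (n - m))"
      by (auto intro!: sum.mono_neutral_right X0 Y0)
    then show "(\<Sum>a\<le>n. ?X a m) * (\<Sum>b\<le>n. ?Y b (n - m)) =
        (\<Sum>a\<le>m. ?X a m) * (\<Sum>b\<le>n - m. ?Y b (n - m))" by (simp only:)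
  qed
  also have "\<dots> = tps_mult s (*) UNIV (tps_comp s A1 B) (tps_comp s A2 B) n (pw n v)"
    using tps_mult_power[OF c[OF assms(1)] c[OF assms(2)] field_space] by (simp add: tps_comp_apply)
  finally show "tps_comp s (tps_mult s (*) UNIV A1 A2) B n (pw n v) =
    tps_mult s (*) UNIV (tps_comp s A1 B) (tps_comp s A2 B) n (pw n v)" .
qed

lemma tpow_0: "B \<in> Vseries \<Longrightarrow> tps_tpow s B 0 n (pw n v) = (if n = 0 then pw 0 v else 0)"
  by (rule Sym_eqI_diagonal[of _ 0])
    (auto simp: tpow_in_Sym tensor_pow_in_Sym Sym_zero tpow_apply tensor_pow_apply)

lemma comp_one: "B \<in> Vseries \<Longrightarrow> tps_comp s (tps_one s) B = tps_one s"
proof (rule tps_eqI[OF vector_space_field_mult])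
  assume B: "B \<in> Vseries"
  show "tps_comp s (tps_one s) B \<in> Series" by (intro comp_in ser_one B field_space)
  fix n v
  have "tps_one s k f = 0" if "k \<noteq> 0" for k f
    using that by (simp add: tps_one_def)
  then have "tps_comp s (tps_one s) B n (pw n v) = tps_one s 0 (tps_tpow s B 0 n (pw n v))"
    unfolding tps_comp_apply by (subst sum.mono_neutral_right[of _ "{0}"]) auto
  also have "\<dots> = tps_one s n (pw n v)"
    using tpow_0[OF B] lin_ops_zero_value[OF tps_setD[OF ser_one(1)], of 0]
      \<open>\<And>k f. k \<noteq> 0 \<Longrightarrow> tps_one s k f = 0\<close> by auto
  finally show "tps_comp s (tps_one s) B n (pw n v) = tps_one s n (pw n v)" .
qed (rule ser_one)

lemma comp_power:
  assumes "A \<in> Series" "B \<in> Vseries"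
  shows "tps_comp s (tps_power s A k) B = tps_power s (tps_comp s A B) k"
  by (induction k) (simp_all add: comp_one comp_mult ser_power assms)

lemma comp_Vseries:
  assumes "B \<in> Vseries" "C \<in> Vseries"
  shows "tps_comp s B C \<in> Vseries"
proof -
  have "tps_comp s B C 0 (pw 0 0) = B 0 (pw 0 0)"
    by (simp add: tps_comp_apply tpow_0[OF assms(2)])
  then show ?thesis
    using assms comp_in[of B s UNIV C] module_subspace_UNIV[OF vector_space_axioms]
    by (simp add: Vseries_def tps_at0_eq[of _ 0] vector_space_axioms)
qed

lemma dual_comp_comp:
  assumes "\<omega> \<in> Dual"
  shows "tps_comp s (\<lambda>n. \<omega> \<circ> B n) C = (\<lambda>n. \<omega> \<circ> tps_comp s B C n)"
  by (intro ext) (simp add: tps_comp_apply dual_sum[OF assms])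

lemma dual_pow_tpow:
  assumes "B \<in> Vseries" "\<omega> \<in> Dual" "f \<in> Sym n"
  shows "tps_tpow s B k n f (replicate k \<omega>) = tps_power s (\<lambda>n. \<omega> \<circ> B n) k n f"
  using assms(3)
proof (induction rule: Sym_induct)
  note S = tps_setD[OF ser_power(1)[OF dual_comp_Series[OF assms(2,1)]], of k n]
  note T = tps_setD[OF tpow_in[OF assms(1)], of k n]
  {
    case (power v)
    show ?case
      unfolding tpow_diagonal[OF assms(1,2)] ser_power(2)[OF dual_comp_Series[OF assms(2,1)], symmetric]
      by (rule ser_nth)
  next
    case (add f g)
    then show ?case
      unfolding lin_opsD(2)[OF S add(1,2)] lin_opsD(2)[OF T add(1,2)] by (simp only: plus_fun_apply)
  next
    case (scale c f)
    then show ?case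
      unfolding lin_opsD(3)[OF S scale(1)] lin_opsD(3)[OF T scale(1)] by (simp only: scale_fun_apply)
  }
qed

text \<open>
  The tensor powers of B are the rows of an infinite triangular matrix, and this identity says that
  composition of series is multiplication of these matrices. On the diagonal at \<omega> it is the fact that
  substituting C commutes with taking powers of the scalar series \<omega> B.
\<close>
lemma tpow_comp:
  assumes "B \<in> Vseries" "C \<in> Vseries"
  shows "tps_comp s (tps_tpow s B j) C = tps_tpow s (tps_comp s B C) j"
proof (rule tps_eqI[OF vector_space_tscale])
  show L: "tps_comp s (tps_tpow s B j) C \<in> tps_set s tscale (Sym j)"
    by (intro comp_in tpow_in assms vector_space_tscale subspace_Sym)
  show R: "tps_tpow s (tps_comp s B C) j \<in> tps_set s tscale (Sym j)"
    by (intro tpow_in comp_Vseries assms)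
  fix n v
  show "tps_comp s (tps_tpow s B j) C n (pw n v) = tps_tpow s (tps_comp s B C) j n (pw n v)"
  proof (rule Sym_eqI_diagonal)
    show "tps_comp s (tps_tpow s B j) C n (pw n v) \<in> Sym j"
      "tps_tpow s (tps_comp s B C) j n (pw n v) \<in> Sym j"
      using lin_opsD(1)[OF tps_setD[OF L] tensor_pow_in_Sym] lin_opsD(1)[OF tps_setD[OF R] tensor_pow_in_Sym]
      by auto
    fix \<omega> assume \<omega>: "\<omega> \<in> Dual"
    have "tps_comp s (tps_tpow s B j) C n (pw n v) (replicate j \<omega>) =
        tps_comp s (tps_power s (\<lambda>n. \<omega> \<circ> B n) j) C n (pw n v)"
      unfolding tps_comp_apply sum_fun_apply
      by (intro sum.cong refl dual_pow_tpow assms \<omega> tpow_in_Sym tensor_pow_in_Sym)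
    also have "\<dots> = tps_power s (\<lambda>n. \<omega> \<circ> tps_comp s B C n) j n (pw n v)"
      by (simp only: comp_power[OF dual_comp_Series[OF \<omega> assms(1)] assms(2)] dual_comp_comp[OF \<omega>])
    also have "\<dots> = tps_tpow s (tps_comp s B C) j n (pw n v) (replicate j \<omega>)"
      by (rule dual_pow_tpow[symmetric]) (intro comp_Vseries assms \<omega> tensor_pow_in_Sym)+
    finally show "tps_comp s (tps_tpow s B j) C n (pw n v) (replicate j \<omega>) =
        tps_tpow s (tps_comp s B C) j n (pw n v) (replicate j \<omega>)" .
  qed
qed

lemma comp_assoc:
  assumes "A \<in> tps_set s sW W" "B \<in> Vseries" "C \<in> Vseries" "vector_space sW" "module.subspace sW W"
  shows "tps_comp s (tps_comp s A B) C = tps_comp s A (tps_comp s B C)"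
proof (rule tps_eqI[OF assms(4)])
  show "tps_comp s (tps_comp s A B) C \<in> tps_set s sW W" "tps_comp s A (tps_comp s B C) \<in> tps_set s sW W"
    by (intro comp_in comp_Vseries assms)+
  fix n v
  let ?h = "\<lambda>k. tps_tpow s C k n (pw n v)"
  have h: "?h k \<in> Sym k" for k by (intro tpow_in_Sym tensor_pow_in_Sym assms)
  have "tps_comp s (tps_comp s A B) C n (pw n v) = (\<Sum>k\<le>n. \<Sum>j\<le>k. A j (tps_tpow s B j k (?h k)))"
    by (simp add: tps_comp_apply)
  also have "\<dots> = (\<Sum>k\<le>n. \<Sum>j\<le>n. A j (tps_tpow s B j k (?h k)))"
    using lin_ops_zero_value[OF tps_setD[OF assms(1)]]
    by (intro sum.cong refl sum.mono_neutral_left) (auto simp: tpow_eq_0)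
  also have "\<dots> = (\<Sum>j\<le>n. \<Sum>k\<le>n. A j (tps_tpow s B j k (?h k)))"
    by (rule sum.swap)
  also have "\<dots> = (\<Sum>j\<le>n. A j (tps_comp s (tps_tpow s B j) C n (pw n v)))"
    unfolding tps_comp_apply
    by (intro sum.cong refl lin_ops_sum_value[OF tps_setD[OF assms(1)] subspace_Sym
          vector_space_tscale, symmetric] tpow_in_Sym[OF assms(2) h])
  also have "\<dots> = tps_comp s A (tps_comp s B C) n (pw n v)"
    by (simp add: tpow_comp[OF assms(2,3)] tps_comp_apply[of A])
  finally show "tps_comp s (tps_comp s A B) C n (pw n v) = tps_comp s A (tps_comp s B C) n (pw n v)" .
qed

section \<open>Compositional inverse\<close>

lemma pw_1_linear: "pw 1 (x + y) = pw 1 x + pw 1 y" "pw 1 (s c x) = tscale c (pw 1 x)"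
  by (auto simp: fun_eq_iff tensor_pow_apply scale_fun_apply length_Suc_conv dual_add dual_scale)

lemma pw_1_bij: "bij_betw (pw 1) UNIV (Sym 1)"
  unfolding bij_betw_def
proof
  show "inj (pw 1)"
  proof (rule injI)
    fix x y assume e: "pw 1 x = pw 1 y"
    have "\<omega> x = \<omega> y" if "\<omega> \<in> Dual" for \<omega>
      using fun_cong[OF e, of "[\<omega>]"] that by (simp add: tensor_pow_apply)
    then show "x = y" by (rule dual_separates)
  qed
  have "T.subspace (range (pw 1))"
  proof (rule T.subspaceI)
    show "0 \<in> range (pw 1)"
      using pw_1_linear(2)[of 0 0] by (intro range_eqI[of _ _ 0]) simp
    show "f + g \<in> range (pw 1)" if fg: "f \<in> range (pw 1)" "g \<in> range (pw 1)" for f g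
    proof -
      obtain x y where "f = pw 1 x" "g = pw 1 y" using fg by blast
      then show ?thesis by (simp only: pw_1_linear(1)[symmetric] rangeI)
    qed
    show "tscale c f \<in> range (pw 1)" if f: "f \<in> range (pw 1)" for c f
    proof -
      obtain x where "f = pw 1 x" using f by blast
      then show ?thesis by (simp only: pw_1_linear(2)[symmetric] rangeI)
    qed
  qed
  then show "range (pw 1) = Sym 1"
    unfolding Sym_eq_span_powers by (simp only: T.span_eq_iff[THEN iffD2])
qed

lemma Sym_1_cases: "f \<in> Sym 1 \<Longrightarrow> (\<And>x. f = pw 1 x \<Longrightarrow> thesis) \<Longrightarrow> thesis"
  using pw_1_bij unfolding bij_betw_def by auto

lemma ident_1:
  "tps_ident s 1 \<in> lin_ops tscale s (Sym 1) UNIV" "tps_ident s 1 (pw 1 x) = x"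
  "n \<noteq> 1 \<Longrightarrow> tps_ident s n = 0"
proof -
  let ?C = "\<lambda>f. if f \<in> Sym 1 then inv (pw 1) f else 0"
  have v: "?C (pw 1 x) = x" for x
    using pw_1_bij by (simp add: tensor_pow_in_Sym inv_f_f bij_betw_def)
  have "?C \<in> lin_ops tscale s (Sym 1) UNIV"
  proof (rule lin_opsI)
    fix f g assume "f \<in> Sym 1" "g \<in> Sym 1"
    then obtain x y where "f = pw 1 x" "g = pw 1 y" using Sym_1_cases by metis
    then show "?C (f + g) = ?C f + ?C g"
      by (simp only: pw_1_linear(1)[symmetric] v)
  next
    fix c f assume "f \<in> Sym 1"
    then obtain x where "f = pw 1 x" using Sym_1_cases by metis
    then show "?C (tscale c f) = s c (?C f)"
      by (simp only: pw_1_linear(2)[symmetric] v)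
  qed auto
  then have "pow_ext s s UNIV 1 (\<lambda>v. v) = ?C"
    by (rule pow_ext_eqI[OF vector_space_axioms]) (rule v)
  then have "tps_ident s 1 = ?C"
    unfolding tps_ident_def by (simp only: if_True refl)
  then show "tps_ident s 1 \<in> lin_ops tscale s (Sym 1) UNIV" "tps_ident s 1 (pw 1 x) = x"
    using v[of x] \<open>?C \<in> _\<close> by (simp_all only:)
  show "n \<noteq> 1 \<Longrightarrow> tps_ident s n = 0" by (simp add: tps_ident_def)
qed

lemmas V_space = vector_space_axioms module_subspace_UNIV[OF vector_space_axioms]

lemma ident_in: "tps_ident s n \<in> lin_ops tscale s (Sym n) UNIV"
  using ident_1 lin_ops_zero[OF V_space] by (cases "n = 1") auto

lemma ident_Vseries: "tps_ident s \<in> Vseries"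
  using ident_in by (auto simp: Vseries_def tps_set_def tps_at0_def tps_ident_def)

lemma tpow_ident: "tps_tpow s (tps_ident s) j n (pw n v) = (if n = j then pw n v else 0)"
proof (rule Sym_eqI_diagonal)
  show "tps_tpow s (tps_ident s) j n (pw n v) \<in> Sym j"
    by (intro tpow_in_Sym ident_Vseries tensor_pow_in_Sym)
  fix \<omega> assume \<omega>: "\<omega> \<in> Dual"
  have "pairing \<omega> (tps_ident s) v = fps_const (\<omega> v) * fps_X"
  proof (rule fps_ext)
    fix n
    show "fps_nth (pairing \<omega> (tps_ident s) v) n = fps_nth (fps_const (\<omega> v) * fps_X) n"
      using ident_1(2)[of v] ident_1(3)[of n] \<omega> by (cases "n = 1") (auto simp: dual_zero)
  qed
  moreover have "set (replicate j \<omega>) \<subseteq> Dual" using \<omega> by auto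
  ultimately show "tps_tpow s (tps_ident s) j n (pw n v) (replicate j \<omega>) =
      (if n = j then pw n v else 0) (replicate j \<omega>)"
    using \<omega> by (simp add: tpow_diagonal[OF ident_Vseries \<omega>] power_mult_distrib fps_const_power
        tensor_pow_apply map_replicate)
qed (auto simp: tensor_pow_in_Sym Sym_zero)

lemma comp_ident_right:
  assumes "A \<in> tps_set s sW W" "vector_space sW" "module.subspace sW W"
  shows "tps_comp s A (tps_ident s) = A"
proof (rule tps_eqI[OF assms(2) _ assms(1)])
  show "tps_comp s A (tps_ident s) \<in> tps_set s sW W"
    by (intro comp_in assms ident_Vseries)
  fix n v
  show "tps_comp s A (tps_ident s) n (pw n v) = A n (pw n v)"
    unfolding tps_comp_apply tpow_ident using lin_ops_zero_value[OF tps_setD[OF assms(1)]]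
    by (subst sum.mono_neutral_right[of _ "{n}"]) auto
qed

lemma tpow_1: "B \<in> Vseries \<Longrightarrow> tps_tpow s B 1 n (pw n v) = pw 1 (B n (pw n v))"
  by (rule Sym_eqI_diagonal[of _ 1])
    (auto simp: tpow_in_Sym tensor_pow_in_Sym tpow_apply tensor_pow_apply)

lemma comp_ident_left:
  assumes "B \<in> Vseries"
  shows "tps_comp s (tps_ident s) B = B"
proof (rule tps_eqI[OF vector_space_axioms])
  show "tps_comp s (tps_ident s) B \<in> tps_set s s UNIV" "B \<in> tps_set s s UNIV"
    using assms comp_Vseries[OF ident_Vseries assms] by (auto simp: Vseries_tps_set)
  fix n v
  show "tps_comp s (tps_ident s) B n (pw n v) = B n (pw n v)"
  proof (cases "n = 0")
    case True
    then show ?thesis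
      using Vseries_at0[OF assms] Vseries_at0[OF comp_Vseries[OF ident_Vseries assms]] by simp
  next
    case False
    then have "tps_comp s (tps_ident s) B n (pw n v) = tps_ident s 1 (tps_tpow s B 1 n (pw n v))"
      unfolding tps_comp_apply by (subst sum.mono_neutral_right[of _ "{1}"]) (auto simp: ident_1(3))
    then show ?thesis by (simp only: tpow_1[OF assms] ident_1(2))
  qed
qed

text \<open>
  The equation B o L = id in degree n reads b(L_n) = id_n - \<Sum> B_k L^k_n, summed over 2 \<le> k \<le> n, where b is
  the linear part of B and L^k_n is the coefficient of degree n of the k-th tensor power of L. Since
  k \<ge> 2, that coefficient involves only L_i with i < n, so the equation determines L recursively.
\<close>
lemma right_inverse_exists:
  assumes "B \<in> tps_F1 s"
  shows "\<exists>L\<in>tps_F1 s. tps_comp s B L = tps_ident s"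
proof -
  have B: "B \<in> Vseries" and bij: "bij_betw (B 1) (Sym 1) UNIV"
    using assms by (auto simp: tps_F1_def Vseries_def)
  define b where "b = B 1 \<circ> pw 1"
  have b: "bij b" unfolding b_def using pw_1_bij bij by (rule bij_betw_trans)
  have B1: "B 1 \<in> lin_ops tscale s (Sym 1) UNIV" using B by (auto simp: Vseries_def tps_set_def)
  have b_lin: "b (x + y) = b x + b y" "b (s c x) = s c (b x)" for x y c
    unfolding b_def o_apply pw_1_linear
    using lin_opsD(2,3)[OF B1] by (simp_all add: tensor_pow_in_Sym)
  have inv_b: "inv b (b x) = x" "b (inv b x) = x" for x
    using b by (auto simp: bij_is_inj bij_is_surj surj_f_inv_f)
  have "inv b (x + y) = inv b x + inv b y" "inv b (s c x) = s c (inv b x)" for x y c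
    by (metis inv_b b_lin)+
  then have binv: "inv b \<in> lin_ops s s UNIV UNIV" by (intro lin_opsI) auto
  \<comment> \<open>The recursion may use only earlier coefficients; the others are cut off by zero.\<close>
  let ?tr = "\<lambda>f n i. if i < n then f i else 0"
  define G where "G f n = inv b \<circ> (tps_ident s n - (\<Sum>k=2..n. B k \<circ> tps_tpow s (?tr f n) k n))"
    for f n
  have "\<exists>L. \<forall>n. L n = G L n"
  proof (rule dependent_wellorder_choice)
    fix r :: "('f, 'v) tensor \<Rightarrow> 'v" and f g :: "nat \<Rightarrow> ('f, 'v) tensor \<Rightarrow> 'v" and n :: nat
    assume "\<And>y. y < n \<Longrightarrow> f y = g y"
    then have "?tr f n = ?tr g n" by auto
    then show "(r = G f n) = (r = G g n)" by (simp add: G_def)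
  qed auto
  then obtain L where L: "\<And>n. L n = G L n" by blast
  have sub: "b' - c \<in> lin_ops tscale s (Sym n) UNIV"
    if "b' \<in> lin_ops tscale s (Sym n) UNIV" "c \<in> lin_ops tscale s (Sym n) UNIV" for b' c n
    using lin_opsD[OF that(1)] lin_opsD[OF that(2)]
    by (intro lin_opsI) (simp_all add: scale_right_diff_distrib)
  have L0: "L 0 = 0"
    using lin_ops_zero_value[OF binv] by (subst L) (simp add: G_def tps_ident_def fun_eq_iff)
  have tr: "?tr L n \<in> Vseries" if "\<And>i. i < n \<Longrightarrow> L i \<in> lin_ops tscale s (Sym i) UNIV" for n
    using that L0 by (auto simp: Vseries_def tps_set_def tps_at0_def lin_ops_zero[OF V_space])
  have Lin: "L n \<in> lin_ops tscale s (Sym n) UNIV" for n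
  proof (induction n rule: less_induct)
    case (less n)
    show ?case
      unfolding L[of n] G_def
      using Vseries_tps_set[OF B] tr[OF less]
      by (intro lin_ops_comp[OF binv] sub ident_in lin_ops_sum V_space
          lin_ops_comp[OF tps_setD tps_setD[OF tpow_in]]) auto
  qed
  have LV: "L \<in> Vseries" using Lin L0 by (auto simp: Vseries_def tps_set_def tps_at0_def)
  have tpow_tr: "tps_tpow s (?tr L n) k n = tps_tpow s L k n" if "2 \<le> k" for k n
    unfolding tps_tpow_def
  proof (intro sum.cong refl)
    fix "is" assume "is": "is \<in> {is. length is = k \<and> (\<forall>i\<in>set is. 1 \<le> i) \<and> sum_list is = n}"
    have "i < n" if i: "i \<in> set is" for i
    proof -
      obtain xs ys where e: "is = xs @ i # ys" using split_list[OF i] by blast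
      then obtain j where "j \<in> set (xs @ ys)"
        using "is" \<open>2 \<le> k\<close> by (cases "xs @ ys") auto
      then have "1 \<le> j" "j \<le> sum_list (xs @ ys)"
        using "is" e member_le_sum_list[of j "xs @ ys"] by auto
      then show ?thesis using "is" e by auto
    qed
    then have eq: "map (\<lambda>i. ?tr L n i (pw i v)) is = map (\<lambda>i. L i (pw i v)) is" for v by auto
    show "pow_ext s tscale (Sym k) n (\<lambda>v. sym_prod s (map (\<lambda>i. ?tr L n i (pw i v)) is)) =
        pow_ext s tscale (Sym k) n (\<lambda>v. sym_prod s (map (\<lambda>i. L i (pw i v)) is))"
      unfolding eq ..
  qed
  have "tps_comp s B L = tps_ident s"
  proof (rule tps_eqI[OF vector_space_axioms])
    show "tps_comp s B L \<in> tps_set s s UNIV" "tps_ident s \<in> tps_set s s UNIV"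
      using comp_Vseries[OF B LV] ident_Vseries by (auto intro: Vseries_tps_set)
    fix n v
    let ?h = "\<lambda>k. B k (tps_tpow s L k n (pw n v))"
    show "tps_comp s B L n (pw n v) = tps_ident s n (pw n v)"
    proof (cases "n = 0")
      case True
      then show ?thesis
        using Vseries_at0[OF ident_Vseries] Vseries_at0[OF comp_Vseries[OF B LV]] by simp
    next
      case False
      have B0: "B 0 = 0"
        by (rule lin_ops_Sym_eqI[OF vector_space_axioms _ lin_ops_zero[OF V_space]])
          (use B Vseries_at0[OF B] in \<open>auto simp: Vseries_def tps_set_def\<close>)
      have "{..n} = insert 0 (insert 1 {2..n})" using False by auto
      then have "tps_comp s B L n (pw n v) = ?h 1 + (\<Sum>k=2..n. ?h k)"
        by (simp add: tps_comp_apply B0)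
      also have "?h 1 = b (L n (pw n v))"
        unfolding tpow_1[OF LV] b_def by simp
      also have "\<dots> = tps_ident s n (pw n v) - (\<Sum>k=2..n. ?h k)"
        by (subst L) (simp add: G_def inv_b sum_fun_apply tpow_tr)
      finally show ?thesis by simp
    qed
  qed
  moreover have "L \<in> tps_F1 s"
  proof -
    have "L 1 = inv b \<circ> tps_ident s 1" by (subst L) (simp add: G_def)
    moreover have "bij_betw (tps_ident s 1) (Sym 1) UNIV"
      by (rule bij_betw_byWitness[where f' = "pw 1"])
        (auto elim!: Sym_1_cases simp del: One_nat_def simp: ident_1(2) tensor_pow_in_Sym)
    moreover have "bij (inv b)" using b by (rule bij_imp_bij_inv)
    ultimately have "bij_betw (L 1) (Sym 1) UNIV"
      by (auto intro: bij_betw_trans)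
    then show ?thesis using LV by (simp add: tps_F1_def Vseries_def)
  qed
  ultimately show ?thesis by blast
qed

text \<open>
  In a monoid in which every element has a right inverse, right inverses are two-sided and unique.
\<close>
lemma comp_inverse:
  assumes "B \<in> tps_F1 s"
  shows "tps_comp_inverse s B \<in> tps_F1 s" "tps_comp s (tps_comp_inverse s B) B = tps_ident s"
proof -
  have assoc: "tps_comp s (tps_comp s X Y) Z = tps_comp s X (tps_comp s Y Z)"
    if "X \<in> tps_F1 s" "Y \<in> tps_F1 s" "Z \<in> tps_F1 s" for X Y Z
    using that by (intro comp_assoc[OF _ F1_Vseries F1_Vseries V_space]) (simp_all add: tps_F1_def)
  have id: "tps_comp s X (tps_ident s) = X" "tps_comp s (tps_ident s) X = X" if "X \<in> tps_F1 s" for X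
    using that comp_ident_left[OF F1_Vseries[OF that]] comp_ident_right[OF _ V_space, of X]
    by (simp_all add: tps_F1_def)
  obtain L where L: "L \<in> tps_F1 s" "tps_comp s B L = tps_ident s"
    using right_inverse_exists[OF assms] by blast
  obtain C where C: "C \<in> tps_F1 s" "tps_comp s L C = tps_ident s"
    using right_inverse_exists[OF L(1)] by blast
  have "B = C"
    using assoc[OF assms L(1) C(1)] L(2) C(2) id(1)[OF assms] id(2)[OF C(1)] by simp
  then have LB: "tps_comp s L B = tps_ident s" using C by simp
  have "L' = L" if "L' \<in> tps_F1 s" "tps_comp s B L' = tps_ident s" for L'
    using assoc[OF L(1) assms that(1)] that(2) LB id(1)[OF L(1)] id(2)[OF that(1)] by simp
  then have "tps_comp_inverse s B = L"
    unfolding tps_comp_inverse_def using L LB by (intro the_equality) blast+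
  then show "tps_comp_inverse s B \<in> tps_F1 s" "tps_comp s (tps_comp_inverse s B) B = tps_ident s"
    using L LB by auto
qed

section \<open>Polynomials on the dual space\<close>

abbreviation fscale :: "'f \<Rightarrow> (('v \<Rightarrow> 'f) \<Rightarrow> 'f) \<Rightarrow> ('v \<Rightarrow> 'f) \<Rightarrow> 'f" where
  "fscale \<equiv> scale_fun (*)"

lemma vector_space_fscale: "vector_space fscale"
  by (intro vector_space_scale_fun vector_space_field_mult)

interpretation F: vector_space fscale
  by (rule vector_space_fscale)

abbreviation Polys :: "(('v \<Rightarrow> 'f) \<Rightarrow> 'f) set" where "Polys \<equiv> polys s"
abbreviation mon :: "nat \<Rightarrow> ('f, 'v) tensor \<Rightarrow> ('v \<Rightarrow> 'f) \<Rightarrow> 'f" where "mon \<equiv> monomial s"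

lemma mon_apply: "mon n f \<omega> = (if \<omega> \<in> Dual then f (replicate n \<omega>) else 0)"
  by (simp add: monomial_def dual_pow_def)

lemma mon_add: "mon n (f + g) = mon n f + mon n g"
  and mon_scale: "mon n (tscale c f) = fscale c (mon n f)"
  and mon_zero: "mon n 0 = 0"
  by (auto simp: mon_apply scale_fun_def fun_eq_iff)

lemma set_replicate_Dual: "\<omega> \<in> Dual \<Longrightarrow> set (replicate n \<omega>) \<subseteq> Dual"
  by auto

lemma mon_power: "\<omega> \<in> Dual \<Longrightarrow> mon n (pw n v) \<omega> = \<omega> v ^ n"
  by (auto simp: mon_apply tensor_pow_apply map_replicate)

lemma Sym_diagonal_homogeneous:
  assumes "f \<in> Sym n" "\<omega> \<in> Dual"
  shows "f (replicate n (scale_fun (*) t \<omega>)) = t ^ n * f (replicate n \<omega>)"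
proof -
  have "f (replicate n (scale_fun (*) t \<omega>) @ zs) = t ^ n * f (replicate n \<omega> @ zs)"
    if "set zs \<subseteq> Dual" for n zs
    using that
  proof (induction n arbitrary: zs)
    case (Suc n)
    note m = sym_multilinearD[OF Sym_multilinear[OF assms(1)]]
    let ?r = "replicate n (scale_fun (*) t \<omega>)"
    have "f (replicate (Suc n) (scale_fun (*) t \<omega>) @ zs) = t * f (\<omega> # ?r @ zs)"
      using m(3)[of \<omega> "?r @ zs" t] Suc.prems assms(2)
        set_replicate_Dual[OF scale_in_Dual[OF assms(2)]] by simp
    also have "f (\<omega> # ?r @ zs) = f (?r @ \<omega> # zs)"
      by (rule m(1)) simp
    also have "\<dots> = t ^ n * f (replicate n \<omega> @ \<omega> # zs)"
      using Suc assms(2) by simp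
    also have "f (replicate n \<omega> @ \<omega> # zs) = f (replicate (Suc n) \<omega> @ zs)"
      by (rule m(1)) simp
    finally show ?case by simp
  qed simp
  from this[of "[]"] show ?thesis by simp
qed

subsection \<open>The homogeneous components of a polynomial\<close>

text \<open>
  The degree bound n is kept apart from the family f of homogeneous components, because f is determined
  by the polynomial while n is not.
\<close>
definition has_components ::
  "(('v \<Rightarrow> 'f) \<Rightarrow> 'f) \<Rightarrow> (nat \<Rightarrow> ('f, 'v) tensor) \<Rightarrow> nat \<Rightarrow> bool"
where
  "has_components p f n \<longleftrightarrow>
     (\<forall>k. f k \<in> Sym k) \<and> (\<forall>k>n. f k = 0) \<and> p = (\<Sum>k\<le>n. mon k (f k))"

lemma has_components_le:
  assumes "has_components p f n" "n \<le> m"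
  shows "has_components p f m"
proof -
  have "(\<Sum>k\<le>m. mon k (f k)) = (\<Sum>k\<le>n. mon k (f k))"
    using assms by (intro sum.mono_neutral_right) (auto simp: has_components_def mon_zero)
  then show ?thesis using assms by (auto simp: has_components_def)
qed

text \<open>
  On the line through \<omega> the component of degree k is multiplied by t^k, so the coefficients of a
  polynomial in t that vanishes identically show that every component vanishes on the diagonal.
\<close>
lemma has_components_zero_unique:
  assumes "has_components 0 f n"
  shows "f = (\<lambda>_. 0)"
proof
  fix k
  have f: "f k \<in> Sym k" for k using assms by (simp add: has_components_def)
  show "f k = 0"
  proof (cases "k \<le> n")
    case True
    show ?thesis
    proof (rule Sym_eqI_diagonal[OF f Sym_zero])
      fix \<omega> assume \<omega>: "\<omega> \<in> Dual"
      have "(\<Sum>k\<le>n. t ^ k * f k (replicate k \<omega>)) \<in> {0}" for t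
      proof -
        have "0 = (\<Sum>k\<le>n. mon k (f k)) (scale_fun (*) t \<omega>)"
          using assms by (simp add: has_components_def)
        then show ?thesis
          using \<omega> by (simp add: sum_fun_apply mon_apply scale_in_Dual Sym_diagonal_homogeneous f)
      qed
      then have "f k (replicate k \<omega>) \<in> {0}"
        using True by (rule subspace_coefficients[OF vector_space_field_mult
              subspace_zero[OF vector_space_field_mult]])
      then show "f k (replicate k \<omega>) = 0 (replicate k \<omega>)" by simp
    qed
  next
    case False
    then show ?thesis using assms by (simp add: has_components_def)
  qed
qed

lemma has_components_add:
  assumes "has_components p f n" "has_components q g m"
  shows "has_components (p + q) (\<lambda>k. f k + g k) (max n m)"
  using has_components_le[OF assms(1), of "max n m"] has_components_le[OF assms(2), of "max n m"]
  by (simp add: has_components_def Sym_add mon_add sum.distrib)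

lemma has_components_scale:
  assumes "has_components p f n"
  shows "has_components (fscale c p) (\<lambda>k. tscale c (f k)) n"
  using assms by (simp add: has_components_def Sym_scale mon_scale F.scale_sum_right)

lemma has_components_unique:
  assumes "has_components p f n" "has_components p g m"
  shows "f = g"
proof -
  have "has_components 0 (\<lambda>k. f k + tscale (-1) (g k)) (max n m)"
    using has_components_add[OF assms(1) has_components_scale[OF assms(2), of "-1"]] by simp
  from fun_cong[OF has_components_zero_unique[OF this]] have "f k = g k" for k
    by (simp add: T.scale_minus_left)
  then show ?thesis by (rule ext)
qed

lemma has_components_mon: "f \<in> Sym n \<Longrightarrow> has_components (mon n f) (\<lambda>k. if k = n then f else 0) n"
  by (auto simp: has_components_def Sym_zero if_distrib[of "mon _"] mon_zero cong: if_cong)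

lemma polys_iff: "p \<in> Polys \<longleftrightarrow> (\<exists>f n. has_components p f n)"
proof
  assume "p \<in> Polys"
  then obtain n f where f: "\<forall>k\<le>n. f k \<in> Sym k" "p = (\<Sum>k\<le>n. mon k (f k))"
    unfolding polys_def by blast
  then have "has_components p (\<lambda>k. if k \<le> n then f k else 0) n"
    by (auto simp: has_components_def Sym_zero)
  then show "\<exists>f n. has_components p f n" by blast
next
  assume "\<exists>f n. has_components p f n"
  then obtain f n where "has_components p f n" by blast
  then have "p = (\<Sum>k\<le>n. mon k (f k))" "\<forall>k\<le>n. f k \<in> Sym k"
    by (auto simp: has_components_def)
  then show "p \<in> Polys" unfolding polys_def by blast
qed

definition component :: "(('v \<Rightarrow> 'f) \<Rightarrow> 'f) \<Rightarrow> nat \<Rightarrow> ('f, 'v) tensor" where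
  "component p = (THE f. \<exists>n. has_components p f n)"

lemma component_eqI:
  assumes "has_components p f n"
  shows "component p = f"
  unfolding component_def
proof (rule the_equality)
  show "g = f" if g: "\<exists>n. has_components p g n" for g
    using g has_components_unique[OF _ assms] by auto
qed (use assms in blast)

lemma has_components_component:
  assumes "p \<in> Polys"
  obtains n where "has_components p (component p) n"
proof -
  obtain f n where f: "has_components p f n" using assms unfolding polys_iff by blast
  then show thesis using that component_eqI[OF f] by simp
qed

lemma mon_in_polys: "f \<in> Sym n \<Longrightarrow> mon n f \<in> Polys"
  using has_components_mon polys_iff by blast

lemma subspace_polys: "F.subspace Polys"
proof (rule F.subspaceI)
  show "0 \<in> Polys"
    using mon_in_polys[OF Sym_zero, of 0] by (simp add: mon_zero)
  fix p assume "p \<in> Polys"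
  then obtain f n where f: "has_components p f n" unfolding polys_iff by blast
  show "fscale c p \<in> Polys" for c
    using has_components_scale[OF f] polys_iff by blast
  fix q assume "q \<in> Polys"
  then obtain g m where g: "has_components q g m" unfolding polys_iff by blast
  show "p + q \<in> Polys"
    using has_components_add[OF f g] polys_iff by blast
qed

lemma polys_zero: "0 \<in> Polys"
  and polys_add: "p \<in> Polys \<Longrightarrow> q \<in> Polys \<Longrightarrow> p + q \<in> Polys"
  and polys_diff: "p \<in> Polys \<Longrightarrow> q \<in> Polys \<Longrightarrow> p - q \<in> Polys"
  and polys_scale: "p \<in> Polys \<Longrightarrow> fscale c p \<in> Polys"
  and polys_sum: "(\<And>i. i \<in> I \<Longrightarrow> P i \<in> Polys) \<Longrightarrow> (\<Sum>i\<in>I. P i) \<in> Polys"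
  using subspace_polys
  by (simp_all add: F.subspace_0 F.subspace_add F.subspace_diff F.subspace_scale F.subspace_sum)

lemma component_in_Sym: "p \<in> Polys \<Longrightarrow> component p k \<in> Sym k"
  using has_components_component[of p] by (auto simp: has_components_def)

lemma component_add:
  assumes "p \<in> Polys" "q \<in> Polys"
  shows "component (p + q) k = component p k + component q k"
proof -
  obtain n where n: "has_components p (component p) n" using has_components_component[OF assms(1)] .
  obtain m where m: "has_components q (component q) m" using has_components_component[OF assms(2)] .
  show ?thesis using fun_cong[OF component_eqI[OF has_components_add[OF n m]]] .
qed

lemma component_scale:
  assumes "p \<in> Polys"
  shows "component (fscale c p) k = tscale c (component p k)"
proof -
  obtain n where n: "has_components p (component p) n" using has_components_component[OF assms] .
  show ?thesis using fun_cong[OF component_eqI[OF has_components_scale[OF n]]] .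
qed

lemma component_mon: "f \<in> Sym n \<Longrightarrow> component (mon n f) k = (if k = n then f else 0)"
  using component_eqI[OF has_components_mon] by simp

lemma polys_outside: "p \<in> Polys \<Longrightarrow> \<omega> \<notin> Dual \<Longrightarrow> p \<omega> = 0"
  unfolding polys_iff has_components_def by (auto simp: sum_fun_apply mon_apply)

lemma polys_eqI: "p \<in> Polys \<Longrightarrow> q \<in> Polys \<Longrightarrow> (\<And>\<omega>. \<omega> \<in> Dual \<Longrightarrow> p \<omega> = q \<omega>) \<Longrightarrow> p = q"
proof (rule ext)
  fix \<omega> assume "p \<in> Polys" "q \<in> Polys" "\<And>\<omega>. \<omega> \<in> Dual \<Longrightarrow> p \<omega> = q \<omega>"
  then show "p \<omega> = q \<omega>"
    using polys_outside[of p \<omega>] polys_outside[of q \<omega>] by (cases "\<omega> \<in> Dual") simp_all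
qed

lemma polys_eq_iff: "p \<in> Polys \<Longrightarrow> q \<in> Polys \<Longrightarrow> p = q \<longleftrightarrow> (\<forall>\<omega>\<in>Dual. p \<omega> = q \<omega>)"
  using polys_eqI by blast

lemma mon_inject:
  assumes "\<And>k. k \<le> n \<Longrightarrow> f k \<in> Sym k" "\<And>k. k \<le> n \<Longrightarrow> g k \<in> Sym k"
    and "(\<Sum>k\<le>n. mon k (f k)) = (\<Sum>k\<le>n. mon k (g k))" "k \<le> n"
  shows "f k = g k"
proof -
  have "has_components (\<Sum>k\<le>n. mon k (h k)) (\<lambda>k. if k \<le> n then h k else 0) n"
    if "\<And>k. k \<le> n \<Longrightarrow> h k \<in> Sym k" for h
    using that by (auto simp: has_components_def Sym_zero)
  from has_components_unique[OF this[of f, OF assms(1)] this[of g, OF assms(2), folded assms(3)]]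
  have "(if k \<le> n then f k else 0) = (if k \<le> n then g k else 0)" by (rule fun_cong)
  then show ?thesis using assms(4) by simp
qed

lemma polys_eq_span: "Polys = F.span {mon n (pw n v) | n v. True}" (is "_ = F.span ?G")
proof
  have mon: "mon n f \<in> F.span ?G" if "f \<in> Sym n" for n f
  proof -
    have sub: "T.subspace {f. mon n f \<in> F.span ?G}"
      by (rule T.subspaceI)
        (simp_all only: mem_Collect_eq mon_zero mon_add mon_scale F.span_zero F.span_add F.span_scale)
    have "range (pw n) \<subseteq> {f. mon n f \<in> F.span ?G}"
      using F.span_base[of _ ?G] by blast
    then show ?thesis
      using T.span_minimal[OF _ sub] that unfolding Sym_eq_span_powers by blast
  qed
  show "Polys \<subseteq> F.span ?G"
  proof
    fix p assume "p \<in> Polys"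
    then obtain f n where "\<And>k. f k \<in> Sym k" "p = (\<Sum>k\<le>n. mon k (f k))"
      unfolding polys_iff has_components_def by blast
    then show "p \<in> F.span ?G" using mon by (simp add: F.span_sum)
  qed
  show "F.span ?G \<subseteq> Polys"
    by (rule F.span_minimal[OF _ subspace_polys]) (auto intro: mon_in_polys tensor_pow_in_Sym)
qed

lemma lin_ops_polys_eqI:
  assumes "vector_space sW" "A \<in> lin_ops fscale sW Polys W" "B \<in> lin_ops fscale sW Polys W'"
    and "\<And>n v. A (mon n (pw n v)) = B (mon n (pw n v))"
  shows "A = B"
  by (rule lin_ops_eqI_span[OF vector_space_fscale assms(1-3) polys_eq_span]) (auto simp: assms(4))

lemma polys_subspace_induct:
  assumes "F.subspace {p. Q p}" "\<And>n v. Q (mon n (pw n v))" "p \<in> Polys"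
  shows "Q p"
proof -
  have "{mon n (pw n v) | n v. True} \<subseteq> {p. Q p}" using assms(2) by blast
  from F.span_minimal[OF this assms(1)] show ?thesis
    using assms(3) unfolding polys_eq_span by (rule subsetD[THEN CollectD])
qed

text \<open>
  Uniqueness of the components makes it possible to define an operator on polynomials degree by degree.
\<close>
lemma polys_operator_exists:
  assumes W: "vector_space sW" "module.subspace sW W"
    and \<Phi>: "\<And>n. \<Phi> n \<in> lin_ops tscale sW (Sym n) W"
  shows "\<exists>A\<in>lin_ops fscale sW Polys W. \<forall>n. \<forall>f\<in>Sym n. A (mon n f) = \<Phi> n f"
proof -
  interpret W: vector_space sW by fact
  define A where "A p = (if p \<in> Polys then \<Sum>k | component p k \<noteq> 0. \<Phi> k (component p k) else 0)" for p
  have A: "A p = (\<Sum>k\<le>n. \<Phi> k (component p k))" if "has_components p (component p) n" for p n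
  proof -
    have p: "p \<in> Polys" using that unfolding polys_iff by blast
    have "{k. component p k \<noteq> 0} \<subseteq> {..n}"
      using that unfolding has_components_def by (auto intro: leI)
    then have "(\<Sum>k | component p k \<noteq> 0. \<Phi> k (component p k)) = (\<Sum>k\<le>n. \<Phi> k (component p k))"
      using lin_ops_zero_value[OF \<Phi>] by (intro sum.mono_neutral_left) auto
    then show ?thesis using p by (simp add: A_def)
  qed
  have "A \<in> lin_ops fscale sW Polys W"
  proof (rule lin_opsI)
    fix p q assume p: "p \<in> Polys" and q: "q \<in> Polys"
    obtain n where n: "has_components p (component p) n" using has_components_component[OF p] .
    obtain m where m: "has_components q (component q) m" using has_components_component[OF q] .
    let ?N = "max n m"
    have pq: "has_components (p + q) (component (p + q)) ?N"
      using has_components_add[OF n m] component_eqI[OF has_components_add[OF n m]] by simp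
    have "A (p + q) = (\<Sum>k\<le>?N. \<Phi> k (component p k) + \<Phi> k (component q k))"
      by (simp add: A[OF pq] component_add p q lin_opsD(2)[OF \<Phi>] component_in_Sym)
    also have "\<dots> = A p + A q"
      using A[OF has_components_le[OF n, of ?N]] A[OF has_components_le[OF m, of ?N]]
      by (simp add: sum.distrib)
    finally show "A (p + q) = A p + A q" .
  next
    fix c p assume p: "p \<in> Polys"
    obtain n where n: "has_components p (component p) n"
      using has_components_component[OF p] .
    have cp: "has_components (fscale c p) (component (fscale c p)) n"
      using has_components_scale[OF n] component_eqI[OF has_components_scale[OF n]] by simp
    show "A (fscale c p) = sW c (A p)"
      by (simp add: A[OF n] A[OF cp] p component_scale lin_opsD(3)[OF \<Phi>] component_in_Sym W.scale_sum_right)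
  next
    fix p assume p: "p \<in> Polys"
    then show "A p \<in> W"
      by (simp add: A_def) (intro W.subspace_sum[OF W(2)] lin_opsD(1)[OF \<Phi>] component_in_Sym)
  qed (simp add: A_def)
  moreover have "A (mon n f) = \<Phi> n f" if f: "f \<in> Sym n" for n f
  proof -
    have c: "component (mon n f) = (\<lambda>k. if k = n then f else 0)"
      using component_mon[OF f] by auto
    have "A (mon n f) = (\<Sum>k\<le>n. \<Phi> k (if k = n then f else 0))"
      using A[of "mon n f" n] has_components_mon[OF f] unfolding c by simp
    also have "\<dots> = (\<Sum>k\<in>{n}. \<Phi> k (if k = n then f else 0))"
      using lin_ops_zero_value[OF \<Phi>] by (intro sum.mono_neutral_right) auto
    finally show ?thesis by simp
  qed
  ultimately show ?thesis by blast
qed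

subsection \<open>Operators with triangular matrix are bijective\<close>

definition polys_below :: "nat \<Rightarrow> (('v \<Rightarrow> 'f) \<Rightarrow> 'f) set" where
  "polys_below n = {p \<in> Polys. \<forall>k\<ge>n. component p k = 0}"

lemma subspace_polys_below: "F.subspace (polys_below n)"
proof (rule F.subspaceI)
  show "0 \<in> polys_below n"
    using component_mon[OF Sym_zero, of 0] by (simp add: polys_below_def polys_zero mon_zero)
qed (simp_all add: polys_below_def polys_add polys_scale component_add component_scale)

lemma mon_in_polys_below: "f \<in> Sym k \<Longrightarrow> k < n \<Longrightarrow> mon k f \<in> polys_below n"
  by (simp add: polys_below_def mon_in_polys component_mon)

lemma polys_below_eq_sum:
  assumes "p \<in> polys_below n"
  shows "p = (\<Sum>k<n. mon k (component p k))"
proof -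
  have "p \<in> Polys" using assms by (simp add: polys_below_def)
  then obtain m where m: "has_components p (component p) m" by (rule has_components_component)
  have "p = (\<Sum>k\<le>max n m. mon k (component p k))"
    using has_components_le[OF m, of "max n m"] by (simp add: has_components_def)
  also have "\<dots> = (\<Sum>k<n. mon k (component p k))"
    using assms by (intro sum.mono_neutral_right) (auto simp: polys_below_def mon_zero not_less)
  finally show ?thesis .
qed

lemma polys_below_cases:
  assumes "p \<in> Polys"
  obtains n where "p \<in> polys_below n"
proof -
  obtain m where "has_components p (component p) m" using has_components_component[OF assms] .
  then have "p \<in> polys_below (Suc m)"
    using assms by (simp add: polys_below_def has_components_def)
  then show thesis by (rule that)
qed

lemma polys_below_Suc:
  assumes "p \<in> polys_below (Suc n)"
  shows "p - mon n (component p n) \<in> polys_below n"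
proof -
  have "p \<in> Polys" using assms by (simp add: polys_below_def)
  then have "p - mon n (component p n) = (\<Sum>k<n. mon k (component p k))"
    using polys_below_eq_sum[OF assms] by (metis add_diff_cancel_right' sum.lessThan_Suc)
  also have "\<dots> \<in> polys_below n"
    using component_in_Sym[OF \<open>p \<in> Polys\<close>]
    by (intro F.subspace_sum subspace_polys_below mon_in_polys_below) auto
  finally show ?thesis .
qed

lemma poly_lin_opsD:
  assumes "S \<in> poly_lin_ops s"
  shows "p \<in> Polys \<Longrightarrow> S p \<in> Polys" "p \<in> Polys \<Longrightarrow> q \<in> Polys \<Longrightarrow> S (p + q) = S p + S q"
    "p \<in> Polys \<Longrightarrow> S (fscale c p) = fscale c (S p)" "p \<notin> Polys \<Longrightarrow> S p = 0"
    "(\<And>i. i \<in> I \<Longrightarrow> P i \<in> Polys) \<Longrightarrow> S (\<Sum>i\<in>I. P i) = (\<Sum>i\<in>I. S (P i))"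
  using assms lin_opsD[of S fscale fscale Polys Polys]
    lin_ops_sum_value[of S fscale fscale Polys Polys, OF _ subspace_polys vector_space_fscale]
  unfolding poly_lin_ops_def by blast+

lemma poly_lin_ops_diff:
  assumes "S \<in> poly_lin_ops s" "p \<in> Polys" "q \<in> Polys"
  shows "S (p - q) = S p - S q"
  using poly_lin_opsD(2)[OF assms(1) polys_diff[OF assms(2,3)] assms(3)] by simp

context
  fixes S M
  assumes S: "S \<in> poly_lin_ops s" and M: "op_matrix s S M"
begin

lemma matrix_in: "M k n \<in> lin_ops tscale tscale (Sym n) (Sym k)"
  and matrix_diag: "bij_betw (M n n) (Sym n) (Sym n)"
  and matrix_mon: "f \<in> Sym n \<Longrightarrow> S (mon n f) = (\<Sum>k\<le>n. mon k (M k n f))"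
  using M unfolding op_matrix_def by blast+

text \<open>
  Only the top component of the image of a homogeneous polynomial is controlled by the invertible
  diagonal entry; what remains has smaller degree. This is the induction step for injectivity and for
  surjectivity.
\<close>
lemma triangular_leading:
  assumes "f \<in> Sym n"
  shows "S (mon n f) - mon n (M n n f) \<in> polys_below n"
proof -
  have "S (mon n f) - mon n (M n n f) = (\<Sum>k<n. mon k (M k n f))"
    using matrix_mon[OF assms] by (simp add: lessThan_Suc_atMost[symmetric])
  also have "\<dots> \<in> polys_below n"
    using lin_opsD(1)[OF matrix_in assms]
    by (intro F.subspace_sum subspace_polys_below mon_in_polys_below) auto
  finally show ?thesis .
qed

lemma triangular_polys_below:
  assumes "p \<in> polys_below n"
  shows "S p \<in> polys_below n"
proof -
  have p: "p \<in> Polys" using assms by (simp add: polys_below_def)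
  have "S p = (\<Sum>k<n. S (mon k (component p k)))"
    by (subst polys_below_eq_sum[OF assms], rule poly_lin_opsD(5)[OF S])
      (intro mon_in_polys component_in_Sym p)
  also have "\<dots> \<in> polys_below n"
  proof (intro F.subspace_sum subspace_polys_below)
    fix k assume "k \<in> {..<n}"
    then show "S (mon k (component p k)) \<in> polys_below n"
      unfolding matrix_mon[OF component_in_Sym[OF p]]
      by (intro F.subspace_sum subspace_polys_below mon_in_polys_below
          lin_opsD(1)[OF matrix_in] component_in_Sym p) auto
  qed
  finally show ?thesis .
qed

lemma triangular_bij: "bij_betw S Polys Polys"
proof -
  have ker: "p = 0" if "p \<in> polys_below n" "S p = 0" for p n
    using that
  proof (induction n)
    case 0
    then show ?case using polys_below_eq_sum[of p 0] by simp
  next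
    case (Suc n)
    have p: "p \<in> Polys" using Suc.prems by (simp add: polys_below_def)
    have S0: "S p = 0" by (rule Suc.prems(2))
    define f where "f = component p n"
    have f: "f \<in> Sym n" unfolding f_def by (rule component_in_Sym[OF p])
    have q: "p - mon n f \<in> polys_below n"
      unfolding f_def by (rule polys_below_Suc[OF Suc.prems(1)])
    have "mon n (M n n f) = - ((S (mon n f) - mon n (M n n f)) + S (p - mon n f))"
      unfolding poly_lin_ops_diff[OF S p mon_in_polys[OF f]] S0 by simp
    also have "\<dots> \<in> polys_below n"
      by (intro F.subspace_neg F.subspace_add subspace_polys_below triangular_leading f
          triangular_polys_below q)
    finally have "component (mon n (M n n f)) n = 0" by (simp add: polys_below_def)
    then have "M n n f = 0"
      using component_mon[OF lin_opsD(1)[OF matrix_in f]] by simp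
    moreover have "M n n 0 = 0" by (rule lin_ops_zero_value[OF matrix_in])
    ultimately have "f = 0"
      using matrix_diag f Sym_zero unfolding bij_betw_def inj_on_def by metis
    then show ?case using Suc.IH[OF _ Suc.prems(2)] q by (simp add: mon_zero)
  qed
  have "inj_on S Polys"
  proof (rule inj_onI)
    fix p q assume p: "p \<in> Polys" and q: "q \<in> Polys" and eq: "S p = S q"
    obtain n where "p - q \<in> polys_below n" using polys_below_cases[OF polys_diff[OF p q]] .
    then show "p = q" using ker[of "p - q" n] poly_lin_ops_diff[OF S p q] eq by simp
  qed
  moreover have "\<exists>q\<in>Polys. S q = p" if "p \<in> polys_below n" for p n
    using that
  proof (induction n arbitrary: p)
    case 0
    then have "p = 0" using polys_below_eq_sum[of p 0] by simp
    moreover have "S 0 = 0" using poly_lin_opsD(5)[OF S, of "{}"] by simp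
    ultimately show ?case using polys_zero by blast
  next
    case (Suc n)
    have p: "p \<in> Polys" using Suc.prems by (simp add: polys_below_def)
    obtain f where f: "f \<in> Sym n" "M n n f = component p n"
      using matrix_diag component_in_Sym[OF p] unfolding bij_betw_def by (metis imageE)
    have "(p - mon n (component p n)) - (S (mon n f) - mon n (M n n f)) \<in> polys_below n"
      by (intro F.subspace_diff subspace_polys_below polys_below_Suc Suc.prems triangular_leading f)
    then obtain r where r: "r \<in> Polys" "S r = p - S (mon n f)"
      using Suc.IH f(2) by auto
    have "S (mon n f + r) = p"
      using poly_lin_opsD(2)[OF S mon_in_polys[OF f(1)] r(1)] r(2) by simp
    then show ?case using polys_add[OF mon_in_polys[OF f(1)] r(1)] by blast
  qed
  ultimately show ?thesis
    unfolding bij_betw_def using poly_lin_opsD(1)[OF S] polys_below_cases by (metis image_subsetI rev_image_eqI subsetI subset_antisym)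
qed

lemma op_inverse_left: "p \<in> Polys \<Longrightarrow> op_inverse s S (S p) = p"
  and op_inverse_right: "p \<in> Polys \<Longrightarrow> S (op_inverse s S p) = p"
  using triangular_bij poly_lin_opsD(1)[OF S]
  by (auto simp: op_inverse_def bij_betw_inv_into_left bij_betw_inv_into_right)

lemma op_inverse_in: "op_inverse s S \<in> poly_lin_ops s"
  unfolding poly_lin_ops_def
proof (rule lin_opsI)
  let ?R = "op_inverse s S"
  show in_polys: "?R p \<in> Polys" if "p \<in> Polys" for p
    using that triangular_bij by (auto simp: op_inverse_def bij_betw_def inv_into_into)
  fix p assume p: "p \<in> Polys"
  show "?R (p + q) = ?R p + ?R q" if "q \<in> Polys" for q
    using poly_lin_opsD(2)[OF S in_polys[OF p] in_polys[OF that]] op_inverse_right p that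
      op_inverse_left[OF polys_add[OF in_polys[OF p] in_polys[OF that]]] by simp
  show "?R (fscale c p) = fscale c (?R p)" for c
    using poly_lin_opsD(3)[OF S in_polys[OF p]] op_inverse_right p
      op_inverse_left[OF polys_scale[OF in_polys[OF p]]] by simp
qed (simp add: op_inverse_def)

end

subsection \<open>Vector-valued polynomials and shifts\<close>

lemma polys_in_subspace: "vector_space sW \<Longrightarrow> module.subspace (scale_fun sW) (polys_in s sW W)"
  unfolding polys_in_def
  by (rule module.subspace_span) (simp add: module_iff_vector_space vector_space_scale_fun)

lemma polys_in_base:
  assumes "vector_space sW" "p \<in> Polys" "w \<in> W"
  shows "(\<lambda>\<omega>. sW (p \<omega>) w) \<in> polys_in s sW W"
  unfolding polys_in_def
  by (rule module.span_base) (use assms in \<open>auto simp: module_iff_vector_space vector_space_scale_fun\<close>)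

lemma polys_in_outside:
  assumes "vector_space sW" "q \<in> polys_in s sW W" "\<omega> \<notin> Dual"
  shows "q \<omega> = 0"
proof -
  interpret W: vector_space sW by fact
  interpret FW: vector_space "scale_fun sW" by (rule vector_space_scale_fun[OF assms(1)])
  have sub: "FW.subspace {q. q \<omega> = 0}"
    by (rule FW.subspaceI) (auto simp: scale_fun_apply)
  have "polys_in s sW W \<subseteq> {q. q \<omega> = 0}"
    unfolding polys_in_def
    by (rule FW.span_minimal[OF _ sub]) (auto simp: polys_outside[OF _ assms(3)])
  then show ?thesis using assms(2) by blast
qed

lemma shift_power:
  assumes "\<theta> \<in> Dual"
  shows "shift_op s \<theta> (mon n (pw n v)) =
    (\<Sum>k\<le>n. fscale (of_nat (n choose k) * \<theta> v ^ (n - k)) (mon k (pw k v)))"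
proof
  fix \<omega>
  show "shift_op s \<theta> (mon n (pw n v)) \<omega> =
    (\<Sum>k\<le>n. fscale (of_nat (n choose k) * \<theta> v ^ (n - k)) (mon k (pw k v))) \<omega>"
  proof (cases "\<omega> \<in> Dual")
    case True
    then show ?thesis
      using binomial_ring[of "\<omega> v" "\<theta> v" n] add_in_Dual[OF True assms]
      by (simp add: shift_op_def mon_in_polys tensor_pow_in_Sym mon_power sum_scale_fun_apply mult_ac)
  next
    case False
    then show ?thesis
      by (simp add: shift_op_def mon_in_polys tensor_pow_in_Sym sum_scale_fun_apply mon_apply)
  qed
qed

lemma shift_in: "\<theta> \<in> Dual \<Longrightarrow> shift_op s \<theta> \<in> poly_lin_ops s"
  unfolding poly_lin_ops_def
proof (rule lin_opsI)
  assume \<theta>: "\<theta> \<in> Dual"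
  show add: "shift_op s \<theta> (p + q) = shift_op s \<theta> p + shift_op s \<theta> q" if "p \<in> Polys" "q \<in> Polys" for p q
    using that by (auto simp: shift_op_def polys_add fun_eq_iff)
  show scale: "shift_op s \<theta> (fscale c p) = fscale c (shift_op s \<theta> p)" if "p \<in> Polys" for c p
    using that by (auto simp: shift_op_def polys_scale fun_eq_iff scale_fun_apply)
  have sub: "F.subspace {p. p \<in> Polys \<and> shift_op s \<theta> p \<in> Polys}"
  proof (rule F.subspaceI)
    have "shift_op s \<theta> 0 = 0" by (auto simp: shift_op_def fun_eq_iff)
    then show "0 \<in> {p. p \<in> Polys \<and> shift_op s \<theta> p \<in> Polys}" by (simp add: polys_zero)
  qed (simp_all add: add scale polys_add polys_scale)
  fix p assume "p \<in> Polys"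
  then have "p \<in> Polys \<and> shift_op s \<theta> p \<in> Polys"
  proof (rule polys_subspace_induct[OF sub, rotated])
    fix n v
    show "mon n (pw n v) \<in> Polys \<and> shift_op s \<theta> (mon n (pw n v)) \<in> Polys"
      unfolding shift_power[OF \<theta>]
      by (intro conjI polys_sum polys_scale mon_in_polys tensor_pow_in_Sym)
  qed
  then show "shift_op s \<theta> p \<in> Polys" ..
qed (simp add: shift_op_def)

subsection \<open>Higher derivatives and series in the derivative\<close>

definition falling :: "nat \<Rightarrow> nat \<Rightarrow> 'f" where
  "falling n k = (\<Prod>i<k. of_nat n - of_nat i)"

lemma falling_eq: "k \<le> n \<Longrightarrow> falling n k = fact n / fact (n - k)"
  and falling_zero: "n < k \<Longrightarrow> falling n k = 0"
proof -
  show "n < k \<Longrightarrow> falling n k = 0"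
    unfolding falling_def by (auto intro!: prod_zero bexI[of _ n])
  show "k \<le> n \<Longrightarrow> falling n k = fact n / fact (n - k)"
  proof (induction k)
    case (Suc k)
    then have "n - k = Suc (n - Suc k)" by simp
    then have "(fact (n - k) :: 'f) = of_nat (n - k) * fact (n - Suc k)" by simp
    then show ?case
      using Suc by (simp add: falling_def of_nat_diff divide_simps mult.assoc)
  qed (simp add: falling_def)
qed

text \<open>
  The restriction of D^k to homogeneous polynomials of degree n: insert \<omega> into all but k slots.
\<close>
definition diff_coeff :: "nat \<Rightarrow> nat \<Rightarrow> ('f, 'v) tensor \<Rightarrow> ('v \<Rightarrow> 'f) \<Rightarrow> ('f, 'v) tensor" where
  "diff_coeff k n f = (\<lambda>\<omega>. if f \<in> Sym n \<and> \<omega> \<in> Dual \<and> k \<le> n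
     then tscale (falling n k) (\<lambda>us. f (us @ replicate (n - k) \<omega>)) else 0)"

lemma diff_coeff_power:
  "diff_coeff k n (pw n v) \<omega> =
    tscale (falling n k * mon (n - k) (pw (n - k) v) \<omega>) (pw k v)"
proof (cases "\<omega> \<in> Dual \<and> k \<le> n")
  case True
  then have "set (replicate (n - k) \<omega>) \<subseteq> Dual" by auto
  then have "(\<lambda>us. pw n v (us @ replicate (n - k) \<omega>)) = tscale (\<omega> v ^ (n - k)) (pw k v)"
    using True by (auto simp: fun_eq_iff tensor_pow_apply scale_fun_apply map_replicate)
  then show ?thesis
    using True by (simp add: diff_coeff_def tensor_pow_in_Sym mon_power)
next
  case False
  then show ?thesis
    by (auto simp: diff_coeff_def mon_apply falling_zero not_le)
qed

lemma diff_coeff_in: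
  "diff_coeff k n \<in> lin_ops tscale (scale_fun tscale) (Sym n) (polys_in s tscale (Sym k))"
proof (rule lin_opsI)
  interpret FT: vector_space "scale_fun tscale :: 'f \<Rightarrow> (('v \<Rightarrow> 'f) \<Rightarrow> ('f, 'v) tensor) \<Rightarrow> _"
    by (intro vector_space_scale_fun vector_space_field_mult)
  show add: "diff_coeff k n (f + g) = diff_coeff k n f + diff_coeff k n g" if "f \<in> Sym n" "g \<in> Sym n" for f g
    using that by (auto simp: diff_coeff_def Sym_add fun_eq_iff scale_fun_apply algebra_simps)
  show scale: "diff_coeff k n (tscale c f) = scale_fun tscale c (diff_coeff k n f)" if "f \<in> Sym n" for c f
    using that by (auto simp: diff_coeff_def Sym_scale fun_eq_iff scale_fun_apply)
  note sub = polys_in_subspace[OF vector_space_tscale, of "Sym k"]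
  have "T.subspace {f. f \<in> Sym n \<and> diff_coeff k n f \<in> polys_in s tscale (Sym k)}"
  proof (rule T.subspaceI)
    have "diff_coeff k n 0 = 0" by (auto simp: diff_coeff_def fun_eq_iff scale_fun_apply)
    then show "0 \<in> {f. f \<in> Sym n \<and> diff_coeff k n f \<in> polys_in s tscale (Sym k)}"
      by (simp add: Sym_zero FT.subspace_0[OF sub])
  qed (simp_all add: Sym_add Sym_scale add scale FT.subspace_add[OF sub] FT.subspace_scale[OF sub])
  moreover have "diff_coeff k n (pw n v) \<in> polys_in s tscale (Sym k)" for v
  proof -
    have "diff_coeff k n (pw n v) =
        (\<lambda>\<omega>. tscale ((fscale (falling n k) (mon (n - k) (pw (n - k) v))) \<omega>) (pw k v))"
      by (auto simp: diff_coeff_power scale_fun_apply)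
    then show ?thesis
      by (simp only: polys_in_base vector_space_tscale polys_scale mon_in_polys tensor_pow_in_Sym)
  qed
  ultimately have "Sym n \<subseteq> {f. f \<in> Sym n \<and> diff_coeff k n f \<in> polys_in s tscale (Sym k)}"
    unfolding Sym_eq_span_powers[of n]
    by (intro T.span_minimal) (use tensor_pow_in_Sym in \<open>auto simp: Sym_eq_span_powers[symmetric]\<close>)
  then show "diff_coeff k n f \<in> polys_in s tscale (Sym k)" if "f \<in> Sym n" for f
    using that by blast
qed (auto simp: diff_coeff_def fun_eq_iff)

lemma diff_pow_mon:
  "diff_pow s k \<in> lin_ops fscale (scale_fun tscale) Polys (polys_in s tscale (Sym k))"
  "f \<in> Sym n \<Longrightarrow> diff_pow s k (mon n f) = diff_coeff k n f"
proof -
  let ?L = "lin_ops fscale (scale_fun tscale) Polys (polys_in s tscale (Sym k))"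
  note sub = polys_in_subspace[OF vector_space_tscale, of "Sym k"]
  note FT = vector_space_scale_fun[OF vector_space_tscale]
  let ?P = "\<lambda>D. D \<in> ?L \<and> (\<forall>n v. \<forall>\<omega>\<in>Dual. D (mon n (pw n v)) \<omega> =
      tscale ((\<Prod>i<k. of_nat n - of_nat i) * \<omega> v ^ (n - k)) (pw k v))"
  obtain D where D: "D \<in> ?L" "\<And>n f. f \<in> Sym n \<Longrightarrow> D (mon n f) = diff_coeff k n f"
    using polys_operator_exists[OF FT sub diff_coeff_in] by blast
  have "?P D"
    using D(1) by (auto simp: D(2)[OF tensor_pow_in_Sym] diff_coeff_power mon_power falling_def)
  moreover have "D' = D" if "?P D'" for D'
  proof (rule lin_ops_polys_eqI[OF FT conjunct1[OF that] D(1)])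
    fix n v
    show "D' (mon n (pw n v)) = D (mon n (pw n v))"
    proof
      fix \<omega>
      show "D' (mon n (pw n v)) \<omega> = D (mon n (pw n v)) \<omega>"
      proof (cases "\<omega> \<in> Dual")
        case True
        then show ?thesis
          using that by (simp add: D(2)[OF tensor_pow_in_Sym] diff_coeff_power mon_power falling_def)
      next
        case False
        have "E (mon n (pw n v)) \<omega> = 0" if "E \<in> ?L" for E
          by (rule polys_in_outside[OF vector_space_tscale lin_opsD(1)[OF that] False])
            (intro mon_in_polys tensor_pow_in_Sym)
        then show ?thesis using that D(1) by auto
      qed
    qed
  qed
  ultimately have "diff_pow s k = D"
    unfolding diff_pow_def by (intro the_equality) blast+
  then show "diff_pow s k \<in> ?L" "f \<in> Sym n \<Longrightarrow> diff_pow s k (mon n f) = diff_coeff k n f"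
    using D by auto
qed

lemma diff_pow_below:
  assumes "p \<in> polys_below n" "n \<le> k"
  shows "diff_pow s k p = 0"
proof -
  have p: "p \<in> Polys" using assms by (simp add: polys_below_def)
  have "diff_pow s k p = (\<Sum>j<n. diff_pow s k (mon j (component p j)))"
    by (subst polys_below_eq_sum[OF assms(1)], rule lin_ops_sum_value[OF diff_pow_mon(1)
          subspace_polys vector_space_fscale]) (intro mon_in_polys component_in_Sym p)
  also have "\<dots> = 0"
    using assms(2) diff_pow_mon(2)[OF component_in_Sym[OF p]]
    by (intro sum.neutral) (auto simp: diff_coeff_def fun_eq_iff)
  finally show ?thesis .
qed

text \<open>
  Replaces the sum over the k with non-vanishing D^k p, which depends on p, by a sum over a fixed range;
  only then is linearity in p visible.
\<close>
lemma diff_subst_below: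
  assumes "p \<in> polys_below (Suc n)" "\<tau> \<in> Series"
  shows "diff_subst s \<tau> p \<omega> = tps_at0 s \<tau> * p \<omega> + (\<Sum>k=1..n. \<tau> k (diff_pow s k p \<omega>))"
proof -
  have p: "p \<in> Polys" using assms by (simp add: polys_below_def)
  have "{k. 1 \<le> k \<and> diff_pow s k p \<noteq> 0} \<subseteq> {1..n}"
  proof
    fix k assume "k \<in> {k. 1 \<le> k \<and> diff_pow s k p \<noteq> 0}"
    then show "k \<in> {1..n}"
      using diff_pow_below[OF assms(1), of k] by (cases "k \<le> n") auto
  qed
  then have "(\<Sum>k | 1 \<le> k \<and> diff_pow s k p \<noteq> 0. \<tau> k (diff_pow s k p \<omega>)) =
      (\<Sum>k=1..n. \<tau> k (diff_pow s k p \<omega>))"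
    using lin_ops_zero_value[OF tps_setD[OF assms(2)]] by (intro sum.mono_neutral_left) auto
  then show ?thesis by (simp add: diff_subst_def p)
qed

lemma polys_in_Sym_apply:
  assumes "q \<in> polys_in s tscale (Sym k)"
  shows "q \<omega> \<in> Sym k"
proof -
  interpret FT: vector_space "scale_fun tscale :: 'f \<Rightarrow> (('v \<Rightarrow> 'f) \<Rightarrow> ('f, 'v) tensor) \<Rightarrow> _"
    by (intro vector_space_scale_fun vector_space_field_mult)
  have sub: "FT.subspace {q. q \<omega> \<in> Sym k}"
    by (rule FT.subspaceI) (simp_all add: Sym_zero Sym_add Sym_scale scale_fun_apply[of tscale])
  have "polys_in s tscale (Sym k) \<subseteq> {q. q \<omega> \<in> Sym k}"
    unfolding polys_in_def by (rule FT.span_minimal[OF _ sub]) (auto intro: Sym_scale)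
  then show ?thesis using assms by blast
qed

lemma diff_subst_in:
  assumes "\<tau> \<in> Series"
  shows "diff_subst s \<tau> \<in> lin_ops fscale fscale Polys UNIV"
proof (rule lin_opsI)
  note D = lin_opsD(2,3)[OF diff_pow_mon(1)]
  note dS = polys_in_Sym_apply[OF lin_opsD(1)[OF diff_pow_mon(1)]]
  note \<tau> = lin_opsD(2,3)[OF tps_setD[OF assms] dS]
  fix p assume p: "p \<in> Polys"
  then obtain n where n: "p \<in> polys_below n" by (rule polys_below_cases)
  have up: "r \<in> polys_below (Suc N)" if "r \<in> polys_below m" "m \<le> N" for r m N
    using that by (auto simp: polys_below_def)
  show "diff_subst s \<tau> (fscale c p) = fscale c (diff_subst s \<tau> p)" for c
  proof
    fix \<omega>
    have "fscale c p \<in> polys_below n" using n by (rule F.subspace_scale[OF subspace_polys_below])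
    then show "diff_subst s \<tau> (fscale c p) \<omega> = fscale c (diff_subst s \<tau> p) \<omega>"
      using up[OF n order.refl] up[of "fscale c p" n n] D(2)[OF p] \<tau>(2)[OF p]
      by (simp add: diff_subst_below[OF _ assms, of _ n] scale_fun_apply[of "(*)"] scale_fun_apply[of tscale]
          sum_distrib_left algebra_simps)
  qed
  fix q assume q: "q \<in> Polys"
  then obtain m where m: "q \<in> polys_below m" by (rule polys_below_cases)
  show "diff_subst s \<tau> (p + q) = diff_subst s \<tau> p + diff_subst s \<tau> q"
  proof
    fix \<omega>
    let ?N = "max n m"
    have pN: "p \<in> polys_below (Suc ?N)" and qN: "q \<in> polys_below (Suc ?N)"
      using up[OF n] up[OF m] by auto
    have "p + q \<in> polys_below (Suc ?N)" by (rule F.subspace_add[OF subspace_polys_below pN qN])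
    then show "diff_subst s \<tau> (p + q) \<omega> = (diff_subst s \<tau> p + diff_subst s \<tau> q) \<omega>"
      using pN qN D(1)[OF p q] \<tau>(1)[OF p dS[OF q]]
      by (simp add: diff_subst_below[OF _ assms, of _ ?N] sum.distrib algebra_simps)
  qed
qed (auto simp: diff_subst_def)

subsection \<open>The exponential of a functional\<close>

text \<open>
  The coefficients of exp \<omega>(v), i.e. \<omega>^n / n!.
\<close>
definition exp_series :: "('v \<Rightarrow> 'f) \<Rightarrow> ('f, 'v, 'f) tps" where
  "exp_series \<omega> = (\<lambda>n f. if f \<in> Sym n then 1 / fact n * f (replicate n \<omega>) else 0)"

lemma exp_series_in: "exp_series \<omega> \<in> Series"
  by (intro tps_setI lin_opsI)
    (auto simp: exp_series_def Sym_add Sym_scale scale_fun_apply algebra_simps)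

text \<open>
  The exponential of the series \<omega> B arises from the exponential of \<omega> by substituting B.
\<close>
lemma exp_series_comp:
  assumes "\<omega> \<in> Dual" "B \<in> Vseries"
  shows "tps_comp s (exp_series \<omega>) B = tps_exp s (\<lambda>n. \<omega> \<circ> B n)"
proof (rule tps_eqI[OF vector_space_field_mult])
  show "tps_comp s (exp_series \<omega>) B \<in> Series"
    by (intro comp_in exp_series_in assms field_space)
  show "tps_exp s (\<lambda>n. \<omega> \<circ> B n) \<in> Series"
    by (intro ser_exp dual_comp_Series assms)
  fix n v
  show "tps_comp s (exp_series \<omega>) B n (pw n v) = tps_exp s (\<lambda>n. \<omega> \<circ> B n) n (pw n v)"
    unfolding tps_comp_apply tps_exp_def sum_scale_fun_apply
    by (intro sum.cong refl)
      (simp add: exp_series_def tpow_in_Sym assms tensor_pow_in_Sym dual_pow_tpow)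
qed

text \<open>
  This is \<tau>(D) exp(\<omega>(v)) = \<tau>(v) exp(\<omega>(v)), compared in degree n in v.
\<close>
lemma diff_subst_mon:
  assumes "\<tau> \<in> Series" "f \<in> Sym n" "\<omega> \<in> Dual"
  shows "diff_subst s \<tau> (mon n f) \<omega> = fact n * tps_mult s (*) UNIV \<tau> (exp_series \<omega>) n f"
proof -
  let ?A = "\<lambda>f. if f \<in> Sym n then diff_subst s \<tau> (mon n f) \<omega> else 0"
  let ?B = "scale_fun (*) (fact n) (tps_mult s (*) UNIV \<tau> (exp_series \<omega>) n)"
  have "?A = ?B"
  proof (rule lin_ops_Sym_eqI[OF vector_space_field_mult])
    show "?A \<in> Functionals n"
      using lin_opsD(2,3)[OF diff_subst_in[OF assms(1)]]
      by (intro lin_opsI) (auto simp: Sym_add Sym_scale mon_add mon_scale mon_in_polys scale_fun_apply)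
    show "?B \<in> Functionals n"
      by (intro lin_ops_scale field_space tps_setD[OF ser_mult(1)] assms exp_series_in)
    fix v
    have "set (replicate m \<omega>) \<subseteq> Dual" for m using assms(3) by auto
    then have e: "exp_series \<omega> m (pw m v) = \<omega> v ^ m / fact m" for m
      by (simp add: exp_series_def tensor_pow_in_Sym tensor_pow_apply map_replicate)
    have "mon n (pw n v) \<in> polys_below (Suc n)" by (simp add: mon_in_polys_below tensor_pow_in_Sym)
    then have "?A (pw n v) = tps_at0 s \<tau> * \<omega> v ^ n +
        (\<Sum>k=1..n. falling n k * \<omega> v ^ (n - k) * \<tau> k (pw k v))"
      using lin_opsD(3)[OF tps_setD[OF assms(1)] tensor_pow_in_Sym]
      by (simp add: diff_subst_below[OF _ assms(1)] tensor_pow_in_Sym diff_pow_mon(2) diff_coeff_power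
          mon_power assms(3))
    also have "\<dots> = (\<Sum>k\<le>n. falling n k * \<omega> v ^ (n - k) * \<tau> k (pw k v))"
      by (simp add: atMost_atLeast0 sum.atLeast_Suc_atMost tps_at0_eq[of _ v] falling_eq mult.commute)
    also have "\<dots> = ?B (pw n v)"
      unfolding scale_fun_apply tps_mult_power[OF assms(1) exp_series_in field_space] sum_distrib_left
      by (intro sum.cong refl) (simp add: e falling_eq)
    finally show "?A (pw n v) = ?B (pw n v)" .
  qed
  from fun_cong[OF this, of f] show ?thesis
    using assms(2) by (simp add: scale_fun_apply)
qed

end

section \<open>Directional derivatives and lowering differentials\<close>

locale normed_sym_tensors = sym_tensors s
  for s :: "'f::real_normed_field \<Rightarrow> 'v::ab_group_add \<Rightarrow> 'v"
begin

interpretation T: vector_space "tscale :: 'f \<Rightarrow> ('f, 'v) tensor \<Rightarrow> _"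
  by (rule vector_space_tscale)

interpretation F: vector_space fscale
  by (rule vector_space_fscale)

lemma line_differentiable:
  assumes "p \<in> Polys" "\<omega> \<in> Dual" "\<theta> \<in> Dual"
  shows "(\<lambda>t. p (\<omega> + scale_fun (*) t \<theta>)) field_differentiable at t"
  using assms(1)
proof (rule polys_subspace_induct[rotated 2])
  show "F.subspace {p. (\<lambda>t. p (\<omega> + scale_fun (*) t \<theta>)) field_differentiable at t}"
    by (rule F.subspaceI)
      (auto simp: scale_fun_apply intro: field_differentiable_add field_differentiable_mult)
  fix n v
  have "mon n (pw n v) (\<omega> + scale_fun (*) t \<theta>) = (\<omega> v + t * \<theta> v) ^ n" for t
    using assms by (simp add: mon_power add_in_Dual scale_in_Dual scale_fun_apply)
  moreover have "(\<lambda>t. (\<omega> v + t * \<theta> v) ^ n) field_differentiable at t"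
    unfolding field_differentiable_def by (rule exI) (rule derivative_eq_intros refl)+
  ultimately show "(\<lambda>t. mon n (pw n v) (\<omega> + scale_fun (*) t \<theta>)) field_differentiable at t"
    by simp
qed

lemma deriv_power:
  assumes "\<theta> \<in> Dual"
  shows "deriv_op s \<theta> (mon n (pw n v)) = fscale (of_nat n * \<theta> v) (mon (n - 1) (pw (n - 1) v))"
proof
  fix \<omega>
  show "deriv_op s \<theta> (mon n (pw n v)) \<omega> = fscale (of_nat n * \<theta> v) (mon (n - 1) (pw (n - 1) v)) \<omega>"
  proof (cases "\<omega> \<in> Dual")
    case True
    have "mon n (pw n v) (\<omega> + scale_fun (*) t \<theta>) = (\<omega> v + t * \<theta> v) ^ n" for t
      using assms True by (simp add: mon_power add_in_Dual scale_in_Dual scale_fun_apply)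
    moreover have "((\<lambda>t. (\<omega> v + t * \<theta> v) ^ n) has_field_derivative of_nat n * \<theta> v * \<omega> v ^ (n - 1)) (at 0)"
      by (rule derivative_eq_intros refl)+ simp
    ultimately show ?thesis
      using True by (simp add: deriv_op_def mon_in_polys tensor_pow_in_Sym DERIV_imp_deriv
          scale_fun_apply mon_power)
  next
    case False
    then show ?thesis
      by (simp add: deriv_op_def mon_in_polys tensor_pow_in_Sym scale_fun_apply mon_apply)
  qed
qed

lemma deriv_in:
  assumes \<theta>: "\<theta> \<in> Dual"
  shows "deriv_op s \<theta> \<in> poly_lin_ops s"
  unfolding poly_lin_ops_def
proof (rule lin_opsI)
  show add: "deriv_op s \<theta> (p + q) = deriv_op s \<theta> p + deriv_op s \<theta> q" if "p \<in> Polys" "q \<in> Polys" for p q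
    using that deriv_add[OF line_differentiable[OF that(1) _ \<theta>] line_differentiable[OF that(2) _ \<theta>]]
    by (auto simp: deriv_op_def polys_add fun_eq_iff)
  show scale: "deriv_op s \<theta> (fscale c p) = fscale c (deriv_op s \<theta> p)" if "p \<in> Polys" for c p
    using that deriv_cmult[OF line_differentiable[OF that _ \<theta>]]
    by (auto simp: deriv_op_def polys_scale fun_eq_iff scale_fun_apply)
  have sub: "F.subspace {p. p \<in> Polys \<and> deriv_op s \<theta> p \<in> Polys}"
  proof (rule F.subspaceI)
    have "deriv_op s \<theta> 0 = 0" by (auto simp: deriv_op_def fun_eq_iff)
    then show "0 \<in> {p. p \<in> Polys \<and> deriv_op s \<theta> p \<in> Polys}" by (simp add: polys_zero)
  qed (simp_all add: add scale polys_add polys_scale)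
  fix p assume "p \<in> Polys"
  then have "p \<in> Polys \<and> deriv_op s \<theta> p \<in> Polys"
  proof (rule polys_subspace_induct[OF sub, rotated])
    fix n v
    show "mon n (pw n v) \<in> Polys \<and> deriv_op s \<theta> (mon n (pw n v)) \<in> Polys"
      unfolding deriv_power[OF \<theta>]
      by (intro conjI polys_scale mon_in_polys tensor_pow_in_Sym)
  qed
  then show "deriv_op s \<theta> p \<in> Polys" ..
qed (simp add: deriv_op_def)

text \<open>
  Along the line through \<omega> the derivative at the parameter t is the directional derivative at the point
  t\<omega>, so the polynomial is constant on every line through 0.
\<close>
lemma constant_if_derivatives_vanish:
  assumes p: "p \<in> Polys" and "\<And>\<theta>. \<theta> \<in> Dual \<Longrightarrow> deriv_op s \<theta> p = 0" and \<omega>: "\<omega> \<in> Dual"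
  shows "p \<omega> = p 0"
proof -
  have "((\<lambda>t. p (scale_fun (*) t \<omega>)) has_field_derivative 0) (at t)" for t
  proof -
    let ?g = "\<lambda>h. p (scale_fun (*) t \<omega> + scale_fun (*) h \<omega>)"
    have "deriv ?g 0 = deriv_op s \<omega> p (scale_fun (*) t \<omega>)"
      using p \<omega> by (simp add: deriv_op_def scale_in_Dual)
    also have "\<dots> = 0" by (simp add: assms(2)[OF \<omega>])
    finally have "(?g has_field_derivative 0) (at 0)"
      using line_differentiable[OF p scale_in_Dual[OF \<omega>] \<omega>] field_differentiable_derivI by metis
    moreover have "?g h = p (scale_fun (*) (h + t) \<omega>)" for h
      by (rule arg_cong[of _ _ p]) (auto simp: scale_fun_def algebra_simps)
    ultimately show ?thesis
      using DERIV_shift[of "\<lambda>t. p (scale_fun (*) t \<omega>)" 0 0 t] by simp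
  qed
  then obtain c where "\<And>t. p (scale_fun (*) t \<omega>) = c"
    using has_field_derivative_zero_constant[of UNIV "\<lambda>t. p (scale_fun (*) t \<omega>)"] by auto
  from this[of 1] this[of 0] show ?thesis
    by (simp add: scale_fun_def zero_fun_def)
qed

text \<open>
  The vector whose pairing with \<theta> is the value at \<omega> of S applied to the derivative along \<theta> of the
  homogeneous polynomial f. All slots but one are consumed by that functional, and the remaining
  tensor of degree 1 is a vector.
\<close>
definition lowering_coeff :: "('f, 'v) poly_op \<Rightarrow> nat \<Rightarrow> ('f, 'v) tensor \<Rightarrow> ('v \<Rightarrow> 'f) \<Rightarrow> 'v" where
  "lowering_coeff S n f = (\<lambda>\<omega>. if f \<in> Sym n \<and> n \<noteq> 0
     then tps_ident s 1 (contract 1 (\<lambda>g. if g \<in> Sym (n - 1) then of_nat n * S (mon (n - 1) g) \<omega> else 0) f)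
     else 0)"

lemma lowering_coeff_power:
  assumes "S \<in> poly_lin_ops s"
  shows "lowering_coeff S n (pw n v) \<omega> = s (of_nat n * S (mon (n - 1) (pw (n - 1) v)) \<omega>) v"
    and "lowering_coeff S n \<in> lin_ops tscale (scale_fun s) (Sym n) (polys_in s s UNIV)"
proof -
  let ?A = "\<lambda>\<omega> g. if g \<in> Sym (n - 1) then of_nat n * S (mon (n - 1) g) \<omega> else 0"
  have A: "?A \<omega> \<in> Functionals (n - 1)" for \<omega>
    using poly_lin_opsD(2,3)[OF assms]
    by (intro lin_opsI)
      (auto simp: Sym_add Sym_scale mon_add mon_scale mon_in_polys scale_fun_apply algebra_simps)
  note c = contract_add[OF A, where l = 1] contract_scale[OF A, where l = 1]
    contract_in_Sym[OF A, where l = 1] contract_power[OF A, where l = 1]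
  show power: "lowering_coeff S n (pw n v) \<omega> = s (of_nat n * S (mon (n - 1) (pw (n - 1) v)) \<omega>) v" for v \<omega>
  proof (cases "n = 0")
    case False
    then have "n - 1 + 1 = n" by simp
    then have "contract 1 (?A \<omega>) (pw n v) = tscale (?A \<omega> (pw (n - 1) v)) (pw 1 v)"
      using c(4)[of \<omega> v] by simp
    moreover have "tps_ident s 1 (tscale d (pw 1 v)) = s d v" for d
      using lin_opsD(3)[OF ident_1(1) tensor_pow_in_Sym] ident_1(2) by simp
    ultimately show ?thesis
      using False by (simp add: lowering_coeff_def tensor_pow_in_Sym del: One_nat_def)
  qed (simp add: lowering_coeff_def)
  show "lowering_coeff S n \<in> lin_ops tscale (scale_fun s) (Sym n) (polys_in s s UNIV)"
  proof (rule lin_opsI)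
    interpret FV: vector_space "scale_fun s :: 'f \<Rightarrow> (('v \<Rightarrow> 'f) \<Rightarrow> 'v) \<Rightarrow> _"
      by (intro vector_space_scale_fun vector_space_axioms)
    show add: "lowering_coeff S n (f + g) = lowering_coeff S n f + lowering_coeff S n g"
      if "f \<in> Sym n" "g \<in> Sym n" for f g
    proof (cases "n = 0")
      case False
      then have "n - 1 + 1 = n" by simp
      then show ?thesis
        using that False c(1,3) lin_opsD(2)[OF ident_1(1)]
        by (intro ext) (simp add: lowering_coeff_def Sym_add del: One_nat_def)
    qed (simp add: lowering_coeff_def fun_eq_iff)
    show scale: "lowering_coeff S n (tscale d f) = scale_fun s d (lowering_coeff S n f)"
      if "f \<in> Sym n" for d f
    proof (cases "n = 0")
      case False
      then have "n - 1 + 1 = n" by simp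
      then show ?thesis
        using that False c(2,3) lin_opsD(3)[OF ident_1(1)]
        by (intro ext) (simp add: lowering_coeff_def Sym_scale scale_fun_apply[of s] del: One_nat_def)
    qed (simp add: lowering_coeff_def fun_eq_iff scale_fun_apply)
    note sub = polys_in_subspace[OF vector_space_axioms, of UNIV]
    have sub': "T.subspace {f. f \<in> Sym n \<and> lowering_coeff S n f \<in> polys_in s s UNIV}"
    proof (rule T.subspaceI)
      have "lowering_coeff S n 0 = 0"
        using scale[OF Sym_zero, of 0] by simp
      then show "0 \<in> {f. f \<in> Sym n \<and> lowering_coeff S n f \<in> polys_in s s UNIV}"
        by (simp add: Sym_zero FV.subspace_0[OF sub])
    qed (simp_all add: Sym_add Sym_scale add scale FV.subspace_add[OF sub] FV.subspace_scale[OF sub])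
    have "lowering_coeff S n (pw n v) \<in> polys_in s s UNIV" for v
    proof -
      have "lowering_coeff S n (pw n v) =
          (\<lambda>\<omega>. s ((fscale (of_nat n) (S (mon (n - 1) (pw (n - 1) v)))) \<omega>) v)"
        using power by (auto simp: scale_fun_apply)
      then show ?thesis
        by (simp only: polys_in_base vector_space_axioms polys_scale poly_lin_opsD(1)[OF assms]
            mon_in_polys tensor_pow_in_Sym UNIV_I)
    qed
    then have "range (pw n) \<subseteq> {f. f \<in> Sym n \<and> lowering_coeff S n f \<in> polys_in s s UNIV}"
      using tensor_pow_in_Sym by blast
    from T.span_minimal[OF this sub', folded Sym_eq_span_powers]
    show "lowering_coeff S n f \<in> polys_in s s UNIV" if "f \<in> Sym n" for f
      using that by blast
  qed (simp add: lowering_coeff_def fun_eq_iff)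
qed

context
  fixes S M
  assumes S: "S \<in> poly_lin_ops s" and M: "op_matrix s S M"
begin

text \<open>
  The lifting of the coefficients above to all polynomials, composed with the inverse of S, has the
  defining property of the lowering differential; uniqueness holds because the dual separates points.
\<close>
lemma lowering_differential_apply:
  assumes "p \<in> Polys" "\<theta> \<in> Dual" "\<omega> \<in> Dual"
  shows "\<theta> (lowering_differential s S p \<omega>) = S (deriv_op s \<theta> (op_inverse s S p)) \<omega>"
proof -
  let ?L = "lin_ops fscale (scale_fun s) Polys (polys_in s s UNIV)"
  let ?P = "\<lambda>Q. Q \<in> ?L \<and> (\<forall>p\<in>Polys. \<forall>\<theta>\<in>Dual. \<forall>\<omega>\<in>Dual.
      \<theta> (Q p \<omega>) = S (deriv_op s \<theta> (op_inverse s S p)) \<omega>)"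
  note inv = op_inverse_in[OF S M]
  obtain E where E: "E \<in> ?L" "\<And>n f. f \<in> Sym n \<Longrightarrow> E (mon n f) = lowering_coeff S n f"
    using polys_operator_exists[OF vector_space_scale_fun[OF vector_space_axioms]
        polys_in_subspace[OF vector_space_axioms] lowering_coeff_power(2)[OF S]] by blast
  have "\<theta> (E q \<omega>) = S (deriv_op s \<theta> q) \<omega>" if q: "q \<in> Polys" and \<theta>: "\<theta> \<in> Dual" for q \<theta> \<omega>
  proof -
    note D = deriv_in[OF \<theta>]
    have "q \<in> Polys \<and> \<theta> (E q \<omega>) = S (deriv_op s \<theta> q) \<omega>"
      using q
    proof (rule polys_subspace_induct[rotated 2])
      show "F.subspace {q. q \<in> Polys \<and> \<theta> (E q \<omega>) = S (deriv_op s \<theta> q) \<omega>}"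
      proof (rule F.subspaceI)
        have "E 0 = 0" "deriv_op s \<theta> 0 = 0" "S 0 = 0"
          using lin_ops_zero_value[OF E(1)] poly_lin_opsD(5)[OF D, of "{}"] poly_lin_opsD(5)[OF S, of "{}"]
          by auto
        then show "0 \<in> {q. q \<in> Polys \<and> \<theta> (E q \<omega>) = S (deriv_op s \<theta> q) \<omega>}"
          by (simp add: polys_zero dual_zero[OF \<theta>])
      qed (simp_all add: polys_add polys_scale lin_opsD(2,3)[OF E(1)] poly_lin_opsD(1,2,3)[OF D]
          poly_lin_opsD(2,3)[OF S] dual_add[OF \<theta>] dual_scale[OF \<theta>] scale_fun_apply)
      show "mon n (pw n v) \<in> Polys \<and> \<theta> (E (mon n (pw n v)) \<omega>) = S (deriv_op s \<theta> (mon n (pw n v))) \<omega>" for n v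
        unfolding deriv_power[OF \<theta>] E(2)[OF tensor_pow_in_Sym] lowering_coeff_power(1)[OF S]
          dual_scale[OF \<theta>] poly_lin_opsD(3)[OF S mon_in_polys[OF tensor_pow_in_Sym]] scale_fun_apply
        by (simp add: mon_in_polys tensor_pow_in_Sym)
    qed
    then show ?thesis ..
  qed
  then have P: "?P (E \<circ> op_inverse s S)"
    using poly_lin_opsD(1)[OF inv] lin_ops_comp[OF E(1) inv[unfolded poly_lin_ops_def]] by simp
  have "Q = E \<circ> op_inverse s S" if "?P Q" for Q
  proof (intro ext)
    fix p \<omega>
    show "Q p \<omega> = (E \<circ> op_inverse s S) p \<omega>"
    proof (cases "p \<in> Polys \<and> \<omega> \<in> Dual")
      case True
      then show ?thesis using that P by (intro dual_separates) simp
    next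
      case False
      have "R p \<omega> = 0" if "R \<in> ?L" for R
        using False lin_opsD(4)[OF that, of p]
          polys_in_outside[OF vector_space_axioms lin_opsD(1)[OF that, of p], of \<omega>]
        by (cases "p \<in> Polys") auto
      then show ?thesis using that P by metis
    qed
  qed
  then have "lowering_differential s S = E \<circ> op_inverse s S"
    unfolding lowering_differential_def using P by (intro the_equality) blast+
  then show ?thesis using P assms by simp
qed

end

text \<open>
  If the operators on the right agree, then the two lowering differentials satisfy the same defining
  condition; the converse needs that the lowering differentials exist.
\<close>
lemma lowering_differential_eq_iff:
  assumes S: "S \<in> poly_lin_ops s" "op_matrix s S M" and P: "P \<in> poly_lin_ops s" "op_matrix s P N"
  shows "lowering_differential s S = lowering_differential s P \<longleftrightarrow>
    (\<forall>\<theta>\<in>Dual. \<forall>p\<in>Polys. S (deriv_op s \<theta> (op_inverse s S p)) = P (deriv_op s \<theta> (op_inverse s P p)))"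
    (is "_ \<longleftrightarrow> ?R")
proof
  assume eq: "lowering_differential s S = lowering_differential s P"
  show ?R
  proof (intro ballI)
    fix \<theta> p assume \<theta>: "\<theta> \<in> Dual" and p: "p \<in> Polys"
    note in_polys = poly_lin_opsD(1)[OF S(1)] poly_lin_opsD(1)[OF P(1)] poly_lin_opsD(1)[OF deriv_in[OF \<theta>]]
      poly_lin_opsD(1)[OF op_inverse_in[OF S]] poly_lin_opsD(1)[OF op_inverse_in[OF P]]
    show "S (deriv_op s \<theta> (op_inverse s S p)) = P (deriv_op s \<theta> (op_inverse s P p))"
      using lowering_differential_apply[OF S p \<theta>] lowering_differential_apply[OF P p \<theta>] eq
      by (intro polys_eqI in_polys p) simp
  qed
next
  assume ?R
  then show "lowering_differential s S = lowering_differential s P"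
    unfolding lowering_differential_def by simp
qed

section \<open>Exponential generating series\<close>

lemma egf_product_iff:
  fixes c a b :: "nat \<Rightarrow> 'f"
  shows "(\<forall>n. c n = (\<Sum>k\<le>n. of_nat (n choose k) * (a k * b (n - k)))) \<longleftrightarrow>
    Abs_fps (\<lambda>n. c n / fact n) = Abs_fps (\<lambda>n. a n / fact n) * Abs_fps (\<lambda>n. b n / fact n)"
proof -
  have "(\<Sum>k\<le>n. of_nat (n choose k) * (a k * b (n - k))) =
      fact n * (\<Sum>k\<le>n. a k / fact k * (b (n - k) / fact (n - k)))" for n
    unfolding sum_distrib_left
    by (intro sum.cong refl) (simp add: binomial_fact)
  then show ?thesis
    by (simp add: fps_eq_iff fps_mult_nth atLeast0AtMost field_simps)
qed

lemma poly_seq_in: "S \<in> poly_lin_ops s \<Longrightarrow> poly_seq s S n \<omega> \<in> Functionals n"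
  using poly_lin_opsD(2,3)[of S]
  by (intro lin_opsI) (auto simp: poly_seq_def Sym_add Sym_scale mon_add mon_scale mon_in_polys scale_fun_apply)

lemma poly_seq_power: "poly_seq s S n \<omega> (pw n v) = S (mon n (pw n v)) \<omega>"
  by (simp add: poly_seq_def tensor_pow_in_Sym)

lemma gen_fun_in: "S \<in> poly_lin_ops s \<Longrightarrow> gen_fun s S \<omega> \<in> Series"
  unfolding gen_fun_def by (intro tps_setI lin_ops_scale field_space poly_seq_in)

lemma ser_gen_fun: "ser (gen_fun s S \<omega>) v = Abs_fps (\<lambda>n. S (mon n (pw n v)) \<omega> / fact n)"
  by (simp add: fps_eq_iff gen_fun_def scale_fun_apply poly_seq_power)

lemma ser_rescaled: "ser (\<lambda>k. scale_fun (*) (1 / fact k) (\<rho> k)) v = Abs_fps (\<lambda>n. \<rho> n (pw n v) / fact n)"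
  by (simp add: fps_eq_iff scale_fun_apply)

text \<open>
  Translates an identity between functionals, in terms of products of operators, into an identity between
  scalars by evaluating at powers.
\<close>
lemma functional_binomial_iff:
  assumes "\<And>n. c n \<in> Functionals n" "\<And>n. a n \<in> Functionals n" "\<And>n. b n \<in> Functionals n"
  shows "c n = (\<Sum>k\<le>n. scale_fun (*) (of_nat (n choose k)) (op_prod s (*) UNIV k (n - k) (a k) (b (n - k))))
    \<longleftrightarrow> (\<forall>v. c n (pw n v) = (\<Sum>k\<le>n. of_nat (n choose k) * (a k (pw k v) * b (n - k) (pw (n - k) v))))"
    (is "c n = ?R \<longleftrightarrow> _")
proof -
  have R: "?R (pw n v) = (\<Sum>k\<le>n. of_nat (n choose k) * (a k (pw k v) * b (n - k) (pw (n - k) v)))" for v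
    unfolding sum_scale_fun_apply
    by (intro sum.cong refl arg_cong2[of _ _ _ _ "(*)"] op_prod_power[OF assms(2,3) field_space]) simp
  have "op_prod s (*) UNIV k (n - k) (a k) (b (n - k)) \<in> Functionals n" if "k \<le> n" for k
    using op_prod_lin_ops[OF assms(2,3) field_space, of k "n - k"] that by simp
  then have "?R \<in> Functionals n"
    by (intro lin_ops_sum lin_ops_scale field_space) simp
  note eqI = lin_ops_Sym_eqI[OF vector_space_field_mult assms(1) this]
  show ?thesis
  proof
    assume "c n = ?R"
    then show "\<forall>v. c n (pw n v) = (\<Sum>k\<le>n. of_nat (n choose k) * (a k (pw k v) * b (n - k) (pw (n - k) v)))"
      by (simp only: R) simp
  next
    assume "\<forall>v. c n (pw n v) = (\<Sum>k\<le>n. of_nat (n choose k) * (a k (pw k v) * b (n - k) (pw (n - k) v)))"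
    then show "c n = ?R" by (intro eqI) (simp only: R)
  qed
qed

lemma all_nat_split_0: "(\<And>v. Q 0 v) \<Longrightarrow> (\<forall>n\<ge>1. \<forall>v. Q n v) \<longleftrightarrow> (\<forall>v n. Q (n :: nat) v)"
  by (metis less_one not_le)

section \<open>Sheffer operators relative to an umbral operator\<close>

context
  fixes P M S N B
  assumes umbral: "P \<in> umbral_ops s" and PM: "op_matrix s P M"
    and B: "B \<in> tps_F1 s"
    and gen: "\<forall>\<omega>\<in>Dual. gen_fun s P \<omega> = tps_exp s (\<lambda>n. \<omega> \<circ> B n)"
    and S: "S \<in> poly_lin_ops s" and SN: "op_matrix s S N"
begin

lemma P: "P \<in> poly_lin_ops s"
  using umbral by (simp add: umbral_ops_def poly_seq_ops_def)

lemmas BV = F1_Vseries[OF B]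

text \<open>
  The generating functions of P and S on the line through v. All conditions on S are expressed by these
  two series.
\<close>
abbreviation gP :: "('v \<Rightarrow> 'f) \<Rightarrow> 'v \<Rightarrow> 'f fps" where "gP \<omega> v \<equiv> ser (gen_fun s P \<omega>) v"
abbreviation gS :: "('v \<Rightarrow> 'f) \<Rightarrow> 'v \<Rightarrow> 'f fps" where "gS \<omega> v \<equiv> ser (gen_fun s S \<omega>) v"

lemma P_one: "\<omega> \<in> Dual \<Longrightarrow> P (mon 0 (pw 0 v)) \<omega> = 1"
  using umbral poly_seq_power[of P 0 \<omega> v] by (auto simp: umbral_ops_def tensor_pow_def)

text \<open>
  The image of the constant 1 under a polynomial sequence operator is a non-zero constant. This settles
  degree 0, which the binomial identity does not mention.
\<close>
lemma constant_component:
  assumes "R \<in> poly_lin_ops s" "op_matrix s R K" "\<omega> \<in> Dual"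
  shows "R (mon 0 (pw 0 v)) \<omega> = R (mon 0 (pw 0 v)) 0" "R (mon 0 (pw 0 v)) 0 \<noteq> 0"
proof -
  have eq: "R (mon 0 (pw 0 v)) \<theta> = K 0 0 (pw 0 v) []" if "\<theta> \<in> Dual" for \<theta>
    using matrix_mon[OF assms(1,2) tensor_pow_in_Sym] that by (simp add: mon_apply)
  then show "R (mon 0 (pw 0 v)) \<omega> = R (mon 0 (pw 0 v)) 0"
    using assms(3) zero_in_Dual by simp
  show "R (mon 0 (pw 0 v)) 0 \<noteq> 0"
  proof
    assume "R (mon 0 (pw 0 v)) 0 = 0"
    then have "R (mon 0 (pw 0 v)) \<theta> = R 0 \<theta>" if "\<theta> \<in> Dual" for \<theta>
      using eq[OF that] eq[OF zero_in_Dual] poly_lin_opsD(5)[OF assms(1), of "{}"] by simp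
    then have "R (mon 0 (pw 0 v)) = R 0"
      by (intro polys_eqI poly_lin_opsD(1)[OF assms(1)] mon_in_polys tensor_pow_in_Sym polys_zero) simp
    then have "mon 0 (pw 0 v) = 0"
      using triangular_bij[OF assms(1,2)] mon_in_polys[OF tensor_pow_in_Sym] polys_zero
      unfolding bij_betw_def inj_on_def by blast
    then show False using mon_power[OF zero_in_Dual, of 0 v] by simp
  qed
qed

lemma gP_add: "\<omega> \<in> Dual \<Longrightarrow> \<theta> \<in> Dual \<Longrightarrow> gP (\<omega> + \<theta>) v = gP \<omega> v * gP \<theta> v"
  unfolding ser_gen_fun
proof (rule egf_product_iff[THEN iffD1, rule_format])
  fix n assume \<omega>: "\<omega> \<in> Dual" and \<theta>: "\<theta> \<in> Dual"
  show "P (mon n (pw n v)) (\<omega> + \<theta>) =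
      (\<Sum>k\<le>n. of_nat (n choose k) * (P (mon k (pw k v)) \<omega> * P (mon (n - k) (pw (n - k) v)) \<theta>))"
  proof (cases "n = 0")
    case True
    then show ?thesis using \<omega> \<theta> by (simp add: P_one add_in_Dual)
  next
    case False
    then have "poly_seq s P n (\<omega> + \<theta>) = (\<Sum>k\<le>n. scale_fun (*) (of_nat (n choose k))
        (op_prod s (*) UNIV k (n - k) (poly_seq s P k \<omega>) (poly_seq s P (n - k) \<theta>)))"
      using umbral \<omega> \<theta> by (simp add: umbral_ops_def)
    from iffD1[OF functional_binomial_iff[OF poly_seq_in[OF P] poly_seq_in[OF P] poly_seq_in[OF P]] this]
    show ?thesis by (simp only: poly_seq_power)
  qed
qed

lemma gP_nth:
  assumes "\<omega> \<in> Dual"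
  shows "fps_nth (gP \<omega> v) n = (\<Sum>k\<le>n. 1 / fact k * fps_nth (pairing \<omega> B v ^ k) n)"
  using gen assms by (simp add: ser_exp(2)[OF dual_comp_Series[OF _ BV]] del: ser_nth)

lemma gP_zero: "gP 0 v = 1"
proof (rule fps_ext)
  fix n
  have "pairing 0 B v = 0" by (simp add: fps_eq_iff)
  then have "fps_nth (gP 0 v) n = (\<Sum>k\<le>n. 1 / fact k * fps_nth (0 ^ k) n)"
    using gP_nth[OF zero_in_Dual, of v n] by simp
  also have "\<dots> = (\<Sum>k\<in>{0}. 1 / fact k * fps_nth (0 ^ k) n)"
    by (rule sum.mono_neutral_right) (auto simp: power_0_left)
  finally show "fps_nth (gP 0 v) n = fps_nth 1 n" by simp
qed

text \<open>
  The matrix of the umbral operator consists of the tensor powers of B, up to factorials.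
\<close>
lemma P_power:
  "P (mon n (pw n v)) = (\<Sum>k\<le>n. mon k (tscale (fact n / fact k) (tps_tpow s B k n (pw n v))))"
proof (rule polys_eqI)
  show "P (mon n (pw n v)) \<in> Polys"
    by (intro poly_lin_opsD(1)[OF P] mon_in_polys tensor_pow_in_Sym)
  show "(\<Sum>k\<le>n. mon k (tscale (fact n / fact k) (tps_tpow s B k n (pw n v)))) \<in> Polys"
    by (intro polys_sum mon_in_polys Sym_scale tpow_in_Sym tensor_pow_in_Sym BV)
  fix \<omega> assume \<omega>: "\<omega> \<in> Dual"
  have "P (mon n (pw n v)) \<omega> = fact n * fps_nth (gP \<omega> v) n"
    by (simp add: ser_gen_fun del: ser_nth)
  then show "P (mon n (pw n v)) \<omega> =
      (\<Sum>k\<le>n. mon k (tscale (fact n / fact k) (tps_tpow s B k n (pw n v)))) \<omega>"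
    using \<omega> by (simp add: gP_nth sum_distrib_left sum_fun_apply mon_apply scale_fun_apply
        tpow_diagonal[OF BV] del: ser_nth)
qed

lemma generating_function_iff:
  assumes "A \<in> tps_F0 s"
  shows "(\<forall>\<omega>\<in>Dual. gen_fun s S \<omega> = tps_mult s (*) UNIV (tps_exp s (\<lambda>n. \<omega> \<circ> B n)) A) \<longleftrightarrow>
    (\<forall>\<omega>\<in>Dual. \<forall>v. gS \<omega> v = gP \<omega> v * ser A v)"
proof (intro ball_cong refl)
  fix \<omega> assume \<omega>: "\<omega> \<in> Dual"
  have A: "A \<in> Series" using assms by (simp add: tps_F0_def)
  have e: "tps_exp s (\<lambda>n. \<omega> \<circ> B n) = gen_fun s P \<omega>" using gen \<omega> by simp
  show "gen_fun s S \<omega> = tps_mult s (*) UNIV (tps_exp s (\<lambda>n. \<omega> \<circ> B n)) A \<longleftrightarrow>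
      (\<forall>v. gS \<omega> v = gP \<omega> v * ser A v)"
    unfolding e
  proof
    assume "gen_fun s S \<omega> = tps_mult s (*) UNIV (gen_fun s P \<omega>) A"
    then show "\<forall>v. gS \<omega> v = gP \<omega> v * ser A v"
      by (simp only: ser_mult(2)[OF gen_fun_in[OF P] A]) simp
  next
    assume "\<forall>v. gS \<omega> v = gP \<omega> v * ser A v"
    then show "gen_fun s S \<omega> = tps_mult s (*) UNIV (gen_fun s P \<omega>) A"
      by (intro ser_inject gen_fun_in[OF S] ser_mult(1) gen_fun_in[OF P] A)
        (simp only: ser_mult(2)[OF gen_fun_in[OF P] A])
  qed
qed

lemma binomial_type_iff:
  "(\<forall>\<omega>\<in>Dual. \<forall>\<theta>\<in>Dual. \<forall>n\<ge>1. poly_seq s S n (\<omega> + \<theta>) =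
      (\<Sum>k\<le>n. scale_fun (*) (of_nat (n choose k))
        (op_prod s (*) UNIV k (n - k) (poly_seq s S k \<omega>) (poly_seq s P (n - k) \<theta>)))) \<longleftrightarrow>
   (\<forall>\<omega>\<in>Dual. \<forall>\<theta>\<in>Dual. \<forall>v. gS (\<omega> + \<theta>) v = gS \<omega> v * gP \<theta> v)"
proof (intro ball_cong refl)
  fix \<omega> \<theta> assume \<omega>: "\<omega> \<in> Dual" and \<theta>: "\<theta> \<in> Dual"
  let ?Q = "\<lambda>n v. S (mon n (pw n v)) (\<omega> + \<theta>) =
    (\<Sum>k\<le>n. of_nat (n choose k) * (S (mon k (pw k v)) \<omega> * P (mon (n - k) (pw (n - k) v)) \<theta>))"
  have "(poly_seq s S n (\<omega> + \<theta>) =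
      (\<Sum>k\<le>n. scale_fun (*) (of_nat (n choose k))
        (op_prod s (*) UNIV k (n - k) (poly_seq s S k \<omega>) (poly_seq s P (n - k) \<theta>)))) \<longleftrightarrow> (\<forall>v. ?Q n v)" for n
    using functional_binomial_iff[OF poly_seq_in[OF S, where \<omega> = "\<omega> + \<theta>"]
          poly_seq_in[OF S, where \<omega> = \<omega>] poly_seq_in[OF P, where \<omega> = \<theta>], where n = n]
    by (simp add: poly_seq_power)
  moreover have "?Q 0 v" for v
    using constant_component(1)[OF S SN, of _ v] \<omega> \<theta> by (simp add: P_one add_in_Dual)
  ultimately have "(\<forall>n\<ge>1. poly_seq s S n (\<omega> + \<theta>) =
      (\<Sum>k\<le>n. scale_fun (*) (of_nat (n choose k))
        (op_prod s (*) UNIV k (n - k) (poly_seq s S k \<omega>) (poly_seq s P (n - k) \<theta>)))) \<longleftrightarrow> (\<forall>v n. ?Q n v)"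
    using all_nat_split_0[of ?Q] by simp
  then show "(\<forall>n\<ge>1. poly_seq s S n (\<omega> + \<theta>) =
      (\<Sum>k\<le>n. scale_fun (*) (of_nat (n choose k))
        (op_prod s (*) UNIV k (n - k) (poly_seq s S k \<omega>) (poly_seq s P (n - k) \<theta>)))) \<longleftrightarrow>
      (\<forall>v. gS (\<omega> + \<theta>) v = gS \<omega> v * gP \<theta> v)"
    unfolding ser_gen_fun egf_product_iff[symmetric] .
qed

lemma binomial_expansion_iff:
  assumes "\<And>n. \<rho> n \<in> Functionals n"
  shows "(\<forall>\<omega>\<in>Dual. \<forall>n. poly_seq s S n \<omega> =
      (\<Sum>k\<le>n. scale_fun (*) (of_nat (n choose k))
        (op_prod s (*) UNIV k (n - k) (\<rho> k) (poly_seq s P (n - k) \<omega>)))) \<longleftrightarrow>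
   (\<forall>\<omega>\<in>Dual. \<forall>v. gS \<omega> v = ser (\<lambda>k. scale_fun (*) (1 / fact k) (\<rho> k)) v * gP \<omega> v)"
proof (intro ball_cong refl)
  fix \<omega> assume \<omega>: "\<omega> \<in> Dual"
  have "(\<forall>n. poly_seq s S n \<omega> =
      (\<Sum>k\<le>n. scale_fun (*) (of_nat (n choose k))
        (op_prod s (*) UNIV k (n - k) (\<rho> k) (poly_seq s P (n - k) \<omega>)))) \<longleftrightarrow>
    (\<forall>v n. S (mon n (pw n v)) \<omega> =
      (\<Sum>k\<le>n. of_nat (n choose k) * (\<rho> k (pw k v) * P (mon (n - k) (pw (n - k) v)) \<omega>)))"
    using functional_binomial_iff[OF poly_seq_in[OF S, where \<omega> = \<omega>] assms poly_seq_in[OF P, where \<omega> = \<omega>]]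
    by (auto simp: poly_seq_power)
  then show "(\<forall>n. poly_seq s S n \<omega> =
      (\<Sum>k\<le>n. scale_fun (*) (of_nat (n choose k))
        (op_prod s (*) UNIV k (n - k) (\<rho> k) (poly_seq s P (n - k) \<omega>)))) \<longleftrightarrow>
    (\<forall>v. gS \<omega> v = ser (\<lambda>k. scale_fun (*) (1 / fact k) (\<rho> k)) v * gP \<omega> v)"
    unfolding ser_gen_fun ser_rescaled egf_product_iff[symmetric] .
qed

text \<open>
  Put \<omega> = 0 in the binomial identity. The series A is the value of the generating function of S at 0.
\<close>
lemma binomial_type_imp_sheffer:
  assumes "\<forall>\<omega>\<in>Dual. \<forall>\<theta>\<in>Dual. \<forall>v. gS (\<omega> + \<theta>) v = gS \<omega> v * gP \<theta> v"
  shows "gen_fun s S 0 \<in> tps_F0 s" "\<forall>\<omega>\<in>Dual. \<forall>v. gS \<omega> v = gP \<omega> v * ser (gen_fun s S 0) v"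
proof -
  have "tps_at0 s (gen_fun s S 0) = S (mon 0 (pw 0 0)) 0"
    by (simp add: tps_at0_eq[of _ 0] gen_fun_def scale_fun_apply poly_seq_power)
  then show "gen_fun s S 0 \<in> tps_F0 s"
    using constant_component(2)[OF S SN zero_in_Dual] gen_fun_in[OF S] by (simp add: tps_F0_def)
  show "\<forall>\<omega>\<in>Dual. \<forall>v. gS \<omega> v = gP \<omega> v * ser (gen_fun s S 0) v"
    using assms zero_in_Dual by (metis add_0 mult.commute)
qed

subsection \<open>Shift invariance\<close>

text \<open>
  The operator T, which maps S_n to P_n.
\<close>
definition right_quotient :: "('f, 'v) poly_op" where "right_quotient = P \<circ> op_inverse s S"

lemma right_quotient_in: "right_quotient \<in> poly_lin_ops s"
  unfolding right_quotient_def using lin_ops_comp P op_inverse_in[OF S SN] unfolding poly_lin_ops_def by blast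

lemma right_quotient_S: "p \<in> Polys \<Longrightarrow> right_quotient (S p) = P p"
  by (simp add: right_quotient_def op_inverse_left[OF S SN])

lemma right_quotient_inj: "p \<in> Polys \<Longrightarrow> q \<in> Polys \<Longrightarrow> right_quotient p = right_quotient q \<Longrightarrow> p = q"
  using op_inverse_left[OF P PM] op_inverse_right[OF S SN] poly_lin_opsD(1)[OF op_inverse_in[OF S SN]]
  unfolding right_quotient_def by (metis comp_apply)

text \<open>
  The shift of a polynomial sequence, expanded in the sequence itself with coefficients taken from P.
  It applies both to S and to P, where it holds by the binomial identity for P.
\<close>
lemma shift_expansion:
  assumes R: "R \<in> poly_lin_ops s" and "\<theta> \<in> Dual"
  shows "(\<forall>\<omega>\<in>Dual. \<forall>v. ser (gen_fun s R (\<omega> + \<theta>)) v = ser (gen_fun s R \<omega>) v * gP \<theta> v) \<longleftrightarrow>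
    (\<forall>n v. shift_op s \<theta> (R (mon n (pw n v))) =
      (\<Sum>k\<le>n. fscale (of_nat (n choose k) * P (mon (n - k) (pw (n - k) v)) \<theta>) (R (mon k (pw k v)))))"
    (is "?L \<longleftrightarrow> (\<forall>n v. ?l n v = ?r n v)")
proof -
  have Rp: "R (mon n (pw n v)) \<in> Polys" for n v
    by (intro poly_lin_opsD(1)[OF R] mon_in_polys tensor_pow_in_Sym)
  have "?l n v = ?r n v \<longleftrightarrow> (\<forall>\<omega>\<in>Dual. R (mon n (pw n v)) (\<omega> + \<theta>) =
      (\<Sum>k\<le>n. of_nat (n choose k) * (R (mon k (pw k v)) \<omega> * P (mon (n - k) (pw (n - k) v)) \<theta>)))" for n v
  proof -
    have r: "?r n v \<omega> =
      (\<Sum>k\<le>n. of_nat (n choose k) * (R (mon k (pw k v)) \<omega> * P (mon (n - k) (pw (n - k) v)) \<theta>))" for \<omega>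
      by (simp add: sum_scale_fun_apply mult_ac)
    have l: "?l n v \<omega> = R (mon n (pw n v)) (\<omega> + \<theta>)" if "\<omega> \<in> Dual" for \<omega>
      using that Rp by (simp add: shift_op_def)
    have "?l n v \<in> Polys" "?r n v \<in> Polys"
      by (intro poly_lin_opsD(1)[OF shift_in[OF assms(2)]] polys_sum polys_scale Rp)+
    from polys_eq_iff[OF this] show ?thesis by (simp only: r l cong: ball_cong)
  qed
  then show ?thesis
    unfolding ser_gen_fun egf_product_iff[symmetric] by blast
qed

text \<open>
  T maps the expected expansion of the shift of S_n to the expansion of the shift of P_n, which is the
  shift of T S_n. Since T is injective, it commutes with the shift at S_n exactly when S_n has the
  expected expansion; and the S_n(v^n) span all polynomials.
\<close>
lemma shift_invariant_iff_binomial_type: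
  "shift_invariant s right_quotient \<longleftrightarrow> (\<forall>\<omega>\<in>Dual. \<forall>\<theta>\<in>Dual. \<forall>v. gS (\<omega> + \<theta>) v = gS \<omega> v * gP \<theta> v)"
proof -
  have mp: "mon n (pw n v) \<in> Polys" for n v by (intro mon_in_polys tensor_pow_in_Sym)
  have "right_quotient \<circ> shift_op s \<theta> = shift_op s \<theta> \<circ> right_quotient \<longleftrightarrow>
      (\<forall>n v. shift_op s \<theta> (S (mon n (pw n v))) =
      (\<Sum>k\<le>n. fscale (of_nat (n choose k) * P (mon (n - k) (pw (n - k) v)) \<theta>) (S (mon k (pw k v)))))"
    (is "_ \<longleftrightarrow> (\<forall>n v. ?l n v = ?r n v)") if \<theta>: "\<theta> \<in> Dual" for \<theta>
  proof -
    note E = shift_in[OF \<theta>]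
    have r: "right_quotient (?r n v) = shift_op s \<theta> (right_quotient (S (mon n (pw n v))))" for n v
    proof -
      have "right_quotient (?r n v) = (\<Sum>k\<le>n. right_quotient (fscale (of_nat (n choose k) * P (mon (n - k) (pw (n - k) v)) \<theta>) (S (mon k (pw k v)))))"
        by (intro poly_lin_opsD(5)[OF right_quotient_in] polys_scale poly_lin_opsD(1)[OF S] mp)
      also have "\<dots> = (\<Sum>k\<le>n. fscale (of_nat (n choose k) * P (mon (n - k) (pw (n - k) v)) \<theta>) (P (mon k (pw k v))))"
        by (simp only: poly_lin_opsD(3)[OF right_quotient_in poly_lin_opsD(1)[OF S mp]] right_quotient_S mp)
      also have "\<dots> = shift_op s \<theta> (P (mon n (pw n v)))"
        by (rule iffD1[OF shift_expansion[OF P \<theta>], rule_format, symmetric]) (rule gP_add[OF _ \<theta>])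
      finally show ?thesis by (simp only: right_quotient_S mp)
    qed
    have in_polys: "?l n v \<in> Polys" "?r n v \<in> Polys" for n v
      by (intro poly_lin_opsD(1)[OF E] polys_sum polys_scale poly_lin_opsD(1)[OF S] mp)+
    show ?thesis
    proof
      assume comm: "right_quotient \<circ> shift_op s \<theta> = shift_op s \<theta> \<circ> right_quotient"
      show "\<forall>n v. ?l n v = ?r n v"
      proof (intro allI)
        fix n v
        have "right_quotient (?l n v) = right_quotient (?r n v)"
          unfolding r using fun_cong[OF comm, of "S (mon n (pw n v))"] by simp
        then show "?l n v = ?r n v" by (rule right_quotient_inj[OF in_polys])
      qed
    next
      assume eq: "\<forall>n v. ?l n v = ?r n v"
      have X: "(right_quotient \<circ> shift_op s \<theta>) \<circ> S = (shift_op s \<theta> \<circ> right_quotient) \<circ> S"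
      proof (rule lin_ops_polys_eqI[OF vector_space_fscale])
        note lin = right_quotient_in[unfolded poly_lin_ops_def] E[unfolded poly_lin_ops_def] S[unfolded poly_lin_ops_def]
        show "(right_quotient \<circ> shift_op s \<theta>) \<circ> S \<in> lin_ops fscale fscale Polys Polys"
          by (rule lin_ops_comp[OF lin_ops_comp[OF lin(1,2)] lin(3)])
        show "(shift_op s \<theta> \<circ> right_quotient) \<circ> S \<in> lin_ops fscale fscale Polys Polys"
          by (rule lin_ops_comp[OF lin_ops_comp[OF lin(2,1)] lin(3)])
        fix n v
        show "((right_quotient \<circ> shift_op s \<theta>) \<circ> S) (mon n (pw n v)) = ((shift_op s \<theta> \<circ> right_quotient) \<circ> S) (mon n (pw n v))"
          using eq r[of n v] by simp
      qed
      show "right_quotient \<circ> shift_op s \<theta> = shift_op s \<theta> \<circ> right_quotient"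
      proof
        fix p
        show "(right_quotient \<circ> shift_op s \<theta>) p = (shift_op s \<theta> \<circ> right_quotient) p"
        proof (cases "p \<in> Polys")
          case True
          then show ?thesis
            using fun_cong[OF X, of "op_inverse s S p"] by (simp add: op_inverse_right[OF S SN])
        next
          case False
          have "right_quotient 0 = 0" "shift_op s \<theta> 0 = 0"
            using poly_lin_opsD(5)[OF right_quotient_in, of "{}"] poly_lin_opsD(5)[OF E, of "{}"] by auto
          then show ?thesis
            using False poly_lin_opsD(4)[OF right_quotient_in] poly_lin_opsD(4)[OF E] by simp
        qed
      qed
    qed
  qed
  then have "shift_invariant s right_quotient \<longleftrightarrow> (\<forall>\<theta>\<in>Dual. \<forall>\<omega>\<in>Dual. \<forall>v. gS (\<omega> + \<theta>) v = gS \<omega> v * gP \<theta> v)"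
    using shift_expansion[OF S] right_quotient_in by (simp add: shift_invariant_def)
  then show ?thesis by blast
qed

subsection \<open>Equal lowering differentials\<close>

text \<open>
  The operator U = P^(-1) S: it expresses S in the coordinates in which P becomes the sequence of powers.
\<close>
definition left_quotient :: "('f, 'v) poly_op" where "left_quotient = op_inverse s P \<circ> S"

lemma left_quotient_in: "left_quotient \<in> poly_lin_ops s"
  unfolding left_quotient_def using lin_ops_comp S op_inverse_in[OF P PM] unfolding poly_lin_ops_def by blast

lemma P_left_quotient: "p \<in> Polys \<Longrightarrow> P (left_quotient p) = S p"
  by (simp add: left_quotient_def op_inverse_right[OF P PM] poly_lin_opsD(1)[OF S])

text \<open>
  The equation S D S^(-1) = P D P^(-1) is multiplied by P^(-1) from the left and by S from the right.
\<close>
lemma lowering_eq_iff_commute: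
  "lowering_differential s S = lowering_differential s P \<longleftrightarrow>
    (\<forall>\<theta>\<in>Dual. \<forall>p\<in>Polys. left_quotient (deriv_op s \<theta> p) = deriv_op s \<theta> (left_quotient p))"
  unfolding lowering_differential_eq_iff[OF S SN P PM]
proof (rule ball_cong[OF refl])
  fix \<theta> assume \<theta>: "\<theta> \<in> Dual"
  let ?D = "deriv_op s \<theta>" and ?S' = "op_inverse s S" and ?P' = "op_inverse s P"
  note D = poly_lin_opsD(1)[OF deriv_in[OF \<theta>]] and S' = poly_lin_opsD(1)[OF op_inverse_in[OF S SN]]
    and P' = poly_lin_opsD(1)[OF op_inverse_in[OF P PM]] and Sp = poly_lin_opsD(1)[OF S]
  show "(\<forall>p\<in>Polys. S (?D (?S' p)) = P (?D (?P' p))) \<longleftrightarrow> (\<forall>p\<in>Polys. left_quotient (?D p) = ?D (left_quotient p))"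
  proof safe
    fix p assume eq: "\<forall>p\<in>Polys. S (?D (?S' p)) = P (?D (?P' p))" and p: "p \<in> Polys"
    have "S (?D p) = P (?D (?P' (S p)))"
      using eq[rule_format, OF Sp[OF p]] op_inverse_left[OF S SN p] by simp
    then show "left_quotient (?D p) = ?D (left_quotient p)"
      using op_inverse_left[OF P PM D[OF P'[OF Sp[OF p]]]] by (simp add: left_quotient_def)
  next
    fix p assume eq: "\<forall>p\<in>Polys. left_quotient (?D p) = ?D (left_quotient p)" and p: "p \<in> Polys"
    have "S (?D (?S' p)) = P (left_quotient (?D (?S' p)))" by (simp only: P_left_quotient D S' p)
    also have "\<dots> = P (?D (left_quotient (?S' p)))" using eq S'[OF p] by simp
    also have "left_quotient (?S' p) = ?P' p" by (simp add: left_quotient_def op_inverse_right[OF S SN p])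
    finally show "S (?D (?S' p)) = P (?D (?P' p))" .
  qed
qed

text \<open>
  The Appell polynomials with values c_n at 0, built on the powers of v.
\<close>
definition appell :: "(nat \<Rightarrow> 'f) \<Rightarrow> nat \<Rightarrow> 'v \<Rightarrow> ('v \<Rightarrow> 'f) \<Rightarrow> 'f" where
  "appell c n v = (\<Sum>k\<le>n. fscale (of_nat (n choose k) * c k) (mon (n - k) (pw (n - k) v)))"

lemma appell_in: "appell c n v \<in> Polys"
  unfolding appell_def by (intro polys_sum polys_scale mon_in_polys tensor_pow_in_Sym)

lemma deriv_appell:
  assumes \<theta>: "\<theta> \<in> Dual"
  shows "deriv_op s \<theta> (appell c n v) = fscale (of_nat n * \<theta> v) (appell c (n - 1) v)"
proof -
  have mp: "mon n (pw n v) \<in> Polys" for n v by (intro mon_in_polys tensor_pow_in_Sym)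
  have "deriv_op s \<theta> (appell c n v) =
      (\<Sum>k\<le>n. deriv_op s \<theta> (fscale (of_nat (n choose k) * c k) (mon (n - k) (pw (n - k) v))))"
    unfolding appell_def by (intro poly_lin_opsD(5)[OF deriv_in[OF \<theta>]] polys_scale mp)
  also have "\<dots> = (\<Sum>k\<le>n. fscale (of_nat (n choose k) * c k * (of_nat (n - k) * \<theta> v))
      (mon (n - k - 1) (pw (n - k - 1) v)))"
    by (simp only: poly_lin_opsD(3)[OF deriv_in[OF \<theta>] mp] deriv_power[OF \<theta>] F.scale_scale)
  also have "\<dots> = fscale (of_nat n * \<theta> v) (appell c (n - 1) v)"
  proof (cases n)
    case (Suc m)
    have coeff: "of_nat (Suc m choose k) * c k * (of_nat (Suc m - k) * \<theta> v) =
        of_nat (Suc m) * \<theta> v * (of_nat (m choose k) * c k)" for k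
    proof -
      have "(of_nat ((Suc m - k) * (Suc m choose k)) :: 'f) = of_nat (Suc m * (m choose k))"
        using binomial_absorb_comp[of "Suc m" k] by (simp only: diff_Suc_1)
      then show ?thesis by (simp only: of_nat_mult mult_ac)
    qed
    have "(\<Sum>k\<le>n. fscale (of_nat (n choose k) * c k * (of_nat (n - k) * \<theta> v))
        (mon (n - k - 1) (pw (n - k - 1) v))) =
        (\<Sum>k\<le>m. fscale (of_nat (Suc m) * \<theta> v * (of_nat (m choose k) * c k)) (mon (m - k) (pw (m - k) v)))"
      unfolding Suc coeff by (simp add: Suc_diff_le)
    then show ?thesis
      unfolding appell_def F.scale_sum_right F.scale_scale using Suc by simp
  qed simp
  finally show ?thesis .
qed

lemma appell_zero: "appell c n v 0 = c n"
proof -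
  have "appell c n v 0 = (\<Sum>k\<le>n. of_nat (n choose k) * c k * 0 ^ (n - k))"
    by (simp add: appell_def sum_scale_fun_apply mon_power zero_in_Dual)
  also have "\<dots> = (\<Sum>k\<in>{n}. of_nat (n choose k) * c k * 0 ^ (n - k))"
    by (rule sum.mono_neutral_right) auto
  finally show ?thesis by simp
qed

text \<open>
  The polynomials U v^n and the Appell polynomials with the same values at 0 satisfy the same recursion
  for their derivatives, so their difference is a constant that vanishes at 0.
\<close>
lemma commute_iff_appell:
  "(\<forall>\<theta>\<in>Dual. \<forall>p\<in>Polys. left_quotient (deriv_op s \<theta> p) = deriv_op s \<theta> (left_quotient p)) \<longleftrightarrow>
    (\<forall>n v. left_quotient (mon n (pw n v)) = appell (\<lambda>k. left_quotient (mon k (pw k v)) 0) n v)"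
proof
  have mp: "mon n (pw n v) \<in> Polys" for n v by (intro mon_in_polys tensor_pow_in_Sym)
  {
    assume comm: "\<forall>\<theta>\<in>Dual. \<forall>p\<in>Polys. left_quotient (deriv_op s \<theta> p) = deriv_op s \<theta> (left_quotient p)"
    have "left_quotient (mon n (pw n v)) = appell (\<lambda>k. left_quotient (mon k (pw k v)) 0) n v" for n v
    proof (induction n)
      let ?u = "\<lambda>k. left_quotient (mon k (pw k v)) 0"
      have step: "left_quotient (mon n (pw n v)) = appell ?u n v"
        if "\<And>\<theta>. \<theta> \<in> Dual \<Longrightarrow> deriv_op s \<theta> (left_quotient (mon n (pw n v))) = deriv_op s \<theta> (appell ?u n v)" for n
      proof (rule polys_eqI)
        show U: "left_quotient (mon n (pw n v)) \<in> Polys" by (intro poly_lin_opsD(1)[OF left_quotient_in] mp)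
        show "appell ?u n v \<in> Polys" by (rule appell_in)
        fix \<omega> assume \<omega>: "\<omega> \<in> Dual"
        have "(left_quotient (mon n (pw n v)) - appell ?u n v) \<omega> = (left_quotient (mon n (pw n v)) - appell ?u n v) 0"
        proof (rule constant_if_derivatives_vanish[OF polys_diff[OF U appell_in] _ \<omega>])
          fix \<theta> assume "\<theta> \<in> Dual"
          then show "deriv_op s \<theta> (left_quotient (mon n (pw n v)) - appell ?u n v) = 0"
            using poly_lin_ops_diff[OF deriv_in U appell_in] that by simp
        qed
        then show "left_quotient (mon n (pw n v)) \<omega> = appell ?u n v \<omega>"
          by (simp add: appell_zero)
      qed
      have U_deriv: "deriv_op s \<theta> (left_quotient (mon n (pw n v))) =
          fscale (of_nat n * \<theta> v) (left_quotient (mon (n - 1) (pw (n - 1) v)))" if "\<theta> \<in> Dual" for n \<theta>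
        using comm[rule_format, OF that mp, of n v, symmetric]
        by (simp only: deriv_power[OF that] poly_lin_opsD(3)[OF left_quotient_in mp])
      {
        case 0
        show ?case by (rule step) (simp add: U_deriv deriv_appell)
      next
        case (Suc n)
        show ?case by (rule step) (simp only: U_deriv deriv_appell diff_Suc_1 Suc)
      }
    qed
    then show "\<forall>n v. left_quotient (mon n (pw n v)) = appell (\<lambda>k. left_quotient (mon k (pw k v)) 0) n v" by blast
  }
  assume U: "\<forall>n v. left_quotient (mon n (pw n v)) = appell (\<lambda>k. left_quotient (mon k (pw k v)) 0) n v"
  show "\<forall>\<theta>\<in>Dual. \<forall>p\<in>Polys. left_quotient (deriv_op s \<theta> p) = deriv_op s \<theta> (left_quotient p)"
  proof (intro ballI)
    fix \<theta> p assume \<theta>: "\<theta> \<in> Dual"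
    have "left_quotient \<circ> deriv_op s \<theta> = deriv_op s \<theta> \<circ> left_quotient"
    proof (rule lin_ops_polys_eqI[OF vector_space_fscale])
      show "left_quotient \<circ> deriv_op s \<theta> \<in> lin_ops fscale fscale Polys Polys"
        using left_quotient_in deriv_in[OF \<theta>] unfolding poly_lin_ops_def by (rule lin_ops_comp)
      show "deriv_op s \<theta> \<circ> left_quotient \<in> lin_ops fscale fscale Polys Polys"
        using deriv_in[OF \<theta>] left_quotient_in unfolding poly_lin_ops_def by (rule lin_ops_comp)
      fix n v
      define u where "u = (\<lambda>k. left_quotient (mon k (pw k v)) 0)"
      have U': "left_quotient (mon m (pw m v)) = appell u m v" for m
        unfolding u_def using U by blast
      have "left_quotient (deriv_op s \<theta> (mon n (pw n v))) = fscale (of_nat n * \<theta> v) (left_quotient (mon (n - 1) (pw (n - 1) v)))"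
        by (simp only: deriv_power[OF \<theta>] poly_lin_opsD(3)[OF left_quotient_in mp])
      also have "\<dots> = deriv_op s \<theta> (left_quotient (mon n (pw n v)))"
        by (simp only: U' deriv_appell[OF \<theta>])
      finally show "(left_quotient \<circ> deriv_op s \<theta>) (mon n (pw n v)) = (deriv_op s \<theta> \<circ> left_quotient) (mon n (pw n v))"
        by simp
    qed
    from fun_cong[OF this, of p] show "left_quotient (deriv_op s \<theta> p) = deriv_op s \<theta> (left_quotient p)" by simp
  qed
qed

lemma P_appell:
  "P (appell c n v) = (\<Sum>k\<le>n. fscale (of_nat (n choose k) * c k) (P (mon (n - k) (pw (n - k) v))))"
proof -
  have mp: "mon n (pw n v) \<in> Polys" for n v by (intro mon_in_polys tensor_pow_in_Sym)
  have "P (appell c n v) = (\<Sum>k\<le>n. P (fscale (of_nat (n choose k) * c k) (mon (n - k) (pw (n - k) v))))"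
    unfolding appell_def by (intro poly_lin_opsD(5)[OF P] polys_scale mp)
  then show ?thesis by (simp only: poly_lin_opsD(3)[OF P mp])
qed

lemma appell_coordinates_iff:
  "(\<forall>n. S (mon n (pw n v)) = P (appell c n v)) \<longleftrightarrow>
    (\<forall>\<omega>\<in>Dual. gS \<omega> v = Abs_fps (\<lambda>n. c n / fact n) * gP \<omega> v)"
proof -
  have "S (mon n (pw n v)) = P (appell c n v) \<longleftrightarrow> (\<forall>\<omega>\<in>Dual. S (mon n (pw n v)) \<omega> =
      (\<Sum>k\<le>n. of_nat (n choose k) * (c k * P (mon (n - k) (pw (n - k) v)) \<omega>)))" for n
  proof -
    have "S (mon n (pw n v)) \<in> Polys" "P (appell c n v) \<in> Polys"
      by (intro poly_lin_opsD(1)[OF S] poly_lin_opsD(1)[OF P] appell_in mon_in_polys tensor_pow_in_Sym)+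
    from polys_eq_iff[OF this] show ?thesis
      by (simp only: P_appell sum_scale_fun_apply mult.assoc)
  qed
  then show ?thesis
    unfolding ser_gen_fun egf_product_iff[symmetric] by blast
qed

lemma lowering_differential_iff_sheffer:
  "lowering_differential s S = lowering_differential s P \<longleftrightarrow>
    (\<exists>A\<in>tps_F0 s. \<forall>\<omega>\<in>Dual. \<forall>v. gS \<omega> v = gP \<omega> v * ser A v)"
proof -
  have mp: "mon n (pw n v) \<in> Polys" for n v by (intro mon_in_polys tensor_pow_in_Sym)
  have left_quotient_eq: "left_quotient (mon n (pw n v)) = appell c n v \<longleftrightarrow> S (mon n (pw n v)) = P (appell c n v)" for c n v
    using op_inverse_left[OF P PM appell_in] P_left_quotient[OF mp] by (metis left_quotient_def comp_apply)
  show ?thesis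
    unfolding lowering_eq_iff_commute commute_iff_appell
  proof
    assume U: "\<forall>n v. left_quotient (mon n (pw n v)) = appell (\<lambda>k. left_quotient (mon k (pw k v)) 0) n v"
    have g: "gS \<omega> v = gP \<omega> v * ser (gen_fun s left_quotient 0) v" if "\<omega> \<in> Dual" for \<omega> v
      using appell_coordinates_iff[of v "\<lambda>k. left_quotient (mon k (pw k v)) 0"] U that
      unfolding left_quotient_eq by (simp add: ser_gen_fun[of left_quotient] mult.commute)
    have at0: "fps_nth (ser (gen_fun s left_quotient 0) v) 0 = fps_nth (gS 0 v) 0" for v
      using g[OF zero_in_Dual, of v] by (simp add: gP_zero)
    have "tps_at0 s (gen_fun s left_quotient 0) = S (mon 0 (pw 0 0)) 0"
      using at0[of 0] by (simp add: tps_at0_eq[of _ 0] ser_gen_fun[of S])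
    then have "gen_fun s left_quotient 0 \<in> tps_F0 s"
      using constant_component(2)[OF S SN zero_in_Dual] gen_fun_in[OF left_quotient_in] by (simp add: tps_F0_def)
    then show "\<exists>A\<in>tps_F0 s. \<forall>\<omega>\<in>Dual. \<forall>v. gS \<omega> v = gP \<omega> v * ser A v"
      using g by blast
  next
    assume "\<exists>A\<in>tps_F0 s. \<forall>\<omega>\<in>Dual. \<forall>v. gS \<omega> v = gP \<omega> v * ser A v"
    then obtain A where A: "\<And>\<omega> v. \<omega> \<in> Dual \<Longrightarrow> gS \<omega> v = gP \<omega> v * ser A v" by blast
    show "\<forall>n v. left_quotient (mon n (pw n v)) = appell (\<lambda>k. left_quotient (mon k (pw k v)) 0) n v"
    proof (intro allI)
      fix n v
      let ?c = "\<lambda>k. fact k * A k (pw k v)"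
      have "Abs_fps (\<lambda>n. ?c n / fact n) = ser A v" by (simp add: fps_eq_iff)
      then have U: "left_quotient (mon n (pw n v)) = appell ?c n v" for n
        unfolding left_quotient_eq using appell_coordinates_iff[of v ?c] A by (simp add: mult.commute)
      have "(\<lambda>k. left_quotient (mon k (pw k v)) 0) = ?c" by (simp add: U appell_zero)
      then show "left_quotient (mon n (pw n v)) = appell (\<lambda>k. left_quotient (mon k (pw k v)) 0) n v"
        using U by simp
    qed
  qed
qed

subsection \<open>Matrix entries\<close>

text \<open>
  Both sides of gS(\<omega>, v) = gP(\<omega>, v) A(v) are, in degree n in v, polynomials in \<omega>. Comparing their components
  of degree k gives the equation for the matrix entry with indices k and n.
\<close>
lemma matrix_entries_iff:
  assumes A: "A \<in> Series"
  shows "(\<forall>k. (\<lambda>n. if k \<le> n then scale_fun tscale (fact k / fact n) (N k n) else 0) =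
      tps_mult s tscale (Sym k) A (tps_tpow s B k)) \<longleftrightarrow>
    (\<forall>\<omega>\<in>Dual. \<forall>v. gS \<omega> v = gP \<omega> v * ser A v)"
proof -
  let ?X = "\<lambda>k. tps_mult s tscale (Sym k) A (tps_tpow s B k)"
  note tens = vector_space_tscale subspace_Sym
  have X_in: "?X k \<in> tps_set s tscale (Sym k)" for k
    by (intro tps_mult_in A tpow_in BV tens)
  have X_Sym: "?X k n (pw n v) \<in> Sym k" for k n v
    by (rule lin_opsD(1)[OF tps_setD[OF X_in] tensor_pow_in_Sym])
  have X: "?X k n (pw n v) = (\<Sum>j\<le>n. tscale (A j (pw j v)) (tps_tpow s B k (n - j) (pw (n - j) v)))" for k n v
    by (rule tps_mult_power[OF A tpow_in[OF BV] tens])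
  have X_zero: "?X k n (pw n v) = 0" if "n < k" for k n v
    using that by (simp add: X tpow_eq_0)
  have N_Sym: "N k n (pw n v) \<in> Sym k" for k n v
    by (rule lin_opsD(1)[OF matrix_in[OF S SN] tensor_pow_in_Sym])
  have gPA: "fps_nth (gP \<omega> v * ser A v) n = (\<Sum>k\<le>n. mon k (tscale (1 / fact k) (?X k n (pw n v)))) \<omega>"
    if \<omega>: "\<omega> \<in> Dual" for \<omega> v n
  proof -
    let ?b = "pairing \<omega> B v"
    have b0: "fps_nth ?b 0 = 0"
      using Vseries_at0[OF BV] dual_zero[OF \<omega>] by simp
    have "fps_nth (gP \<omega> v * ser A v) n = (\<Sum>j\<le>n. A j (pw j v) * fps_nth (gP \<omega> v) (n - j))"
      by (subst mult.commute) (simp add: fps_mult_nth atLeast0AtMost)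
    also have "\<dots> = (\<Sum>j\<le>n. \<Sum>k\<le>n. 1 / fact k * (A j (pw j v) * fps_nth (?b ^ k) (n - j)))"
    proof (rule sum.cong[OF refl])
      fix j assume "j \<in> {..n}"
      have "(\<Sum>k\<le>n - j. 1 / fact k * fps_nth (?b ^ k) (n - j)) = (\<Sum>k\<le>n. 1 / fact k * fps_nth (?b ^ k) (n - j))"
        using startsby_zero_power_prefix[OF b0] by (intro sum.mono_neutral_left) auto
      then show "A j (pw j v) * fps_nth (gP \<omega> v) (n - j) =
          (\<Sum>k\<le>n. 1 / fact k * (A j (pw j v) * fps_nth (?b ^ k) (n - j)))"
        by (simp only: gP_nth[OF \<omega>] sum_distrib_left mult_ac)
    qed
    also have "\<dots> = (\<Sum>k\<le>n. \<Sum>j\<le>n. 1 / fact k * (A j (pw j v) * fps_nth (?b ^ k) (n - j)))"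
      by (rule sum.swap)
    also have "\<dots> = (\<Sum>k\<le>n. mon k (tscale (1 / fact k) (?X k n (pw n v)))) \<omega>"
      unfolding sum_fun_apply mon_apply X scale_fun_apply sum_scale_fun_apply
      using \<omega> by (simp add: tpow_diagonal[OF BV \<omega>] sum_distrib_left del: ser_nth)
    finally show ?thesis .
  qed
  have gS_eq: "fps_nth (gS \<omega> v) n = (\<Sum>k\<le>n. mon k (tscale (1 / fact n) (N k n (pw n v)))) \<omega>" for \<omega> v n
    by (simp add: ser_gen_fun matrix_mon[OF S SN tensor_pow_in_Sym] sum_fun_apply mon_scale
        scale_fun_apply sum_divide_distrib del: ser_nth)
  have entry: "(\<forall>\<omega>\<in>Dual. fps_nth (gS \<omega> v) n = fps_nth (gP \<omega> v * ser A v) n) \<longleftrightarrow>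
      (\<forall>k\<le>n. tscale (fact k / fact n) (N k n (pw n v)) = ?X k n (pw n v))" for n v
  proof -
    let ?l = "\<lambda>k. tscale (1 / fact n) (N k n (pw n v))" and ?r = "\<lambda>k. tscale (1 / fact k) (?X k n (pw n v))"
    have lr: "?l k \<in> Sym k" "?r k \<in> Sym k" for k
      by (intro Sym_scale N_Sym X_Sym)+
    have "(\<forall>\<omega>\<in>Dual. fps_nth (gS \<omega> v) n = fps_nth (gP \<omega> v * ser A v) n) \<longleftrightarrow>
        (\<Sum>k\<le>n. mon k (?l k)) = (\<Sum>k\<le>n. mon k (?r k))"
    proof
      assume "\<forall>\<omega>\<in>Dual. fps_nth (gS \<omega> v) n = fps_nth (gP \<omega> v * ser A v) n"
      then show "(\<Sum>k\<le>n. mon k (?l k)) = (\<Sum>k\<le>n. mon k (?r k))"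
        by (intro polys_eqI polys_sum mon_in_polys lr) (simp only: gPA gS_eq)
    next
      assume eq: "(\<Sum>k\<le>n. mon k (?l k)) = (\<Sum>k\<le>n. mon k (?r k))"
      show "\<forall>\<omega>\<in>Dual. fps_nth (gS \<omega> v) n = fps_nth (gP \<omega> v * ser A v) n"
        by (intro ballI) (simp only: gPA gS_eq eq)
    qed
    also have "\<dots> \<longleftrightarrow> (\<forall>k\<le>n. ?l k = ?r k)"
    proof
      assume "(\<Sum>k\<le>n. mon k (?l k)) = (\<Sum>k\<le>n. mon k (?r k))"
      from mon_inject[OF lr(1) lr(2) this] show "\<forall>k\<le>n. ?l k = ?r k" by blast
    next
      assume "\<forall>k\<le>n. ?l k = ?r k"
      then show "(\<Sum>k\<le>n. mon k (?l k)) = (\<Sum>k\<le>n. mon k (?r k))"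
        by (intro sum.cong refl) (simp only: atMost_iff)
    qed
    also have "\<dots> \<longleftrightarrow> (\<forall>k\<le>n. tscale (fact k / fact n) (N k n (pw n v)) = ?X k n (pw n v))"
    proof -
      have "?l k = ?r k \<longleftrightarrow> tscale (fact k / fact n) (N k n (pw n v)) = ?X k n (pw n v)" for k
        using T.scale_cancel_left[of "fact k" "?l k" "?r k"] by (simp only: T.scale_scale) simp
      then show ?thesis by simp
    qed
    finally show ?thesis .
  qed
  let ?N = "\<lambda>k n. if k \<le> n then scale_fun tscale (fact k / fact n) (N k n) else 0"
  have N_in: "?N k \<in> tps_set s tscale (Sym k)" for k
    using lin_ops_scale[OF tens matrix_in[OF S SN]] lin_ops_zero[OF tens] by (auto simp: tps_set_def)
  have "(?N k = ?X k) \<longleftrightarrow>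
      (\<forall>n v. k \<le> n \<longrightarrow> tscale (fact k / fact n) (N k n (pw n v)) = ?X k n (pw n v))" for k
  proof
    assume eq: "?N k = ?X k"
    show "\<forall>n v. k \<le> n \<longrightarrow> tscale (fact k / fact n) (N k n (pw n v)) = ?X k n (pw n v)"
    proof (intro allI impI)
      fix n v assume "k \<le> n"
      then show "tscale (fact k / fact n) (N k n (pw n v)) = ?X k n (pw n v)"
        using fun_cong[OF fun_cong[OF eq, of n], of "pw n v"] by (simp add: scale_fun_apply[of tscale])
    qed
  next
    assume eq: "\<forall>n v. k \<le> n \<longrightarrow> tscale (fact k / fact n) (N k n (pw n v)) = ?X k n (pw n v)"
    show "?N k = ?X k"
    proof (rule tps_eqI[OF vector_space_tscale N_in X_in])
      fix n v
      show "?N k n (pw n v) = ?X k n (pw n v)"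
        using eq X_zero[of n k v] by (cases "k \<le> n") (simp_all add: scale_fun_apply[of tscale])
    qed
  qed
  then have "(\<forall>k. ?N k = ?X k) \<longleftrightarrow>
      (\<forall>n v. \<forall>k\<le>n. tscale (fact k / fact n) (N k n (pw n v)) = ?X k n (pw n v))"
    by (simp only:) blast
  also have "\<dots> \<longleftrightarrow> (\<forall>n v. \<forall>\<omega>\<in>Dual. fps_nth (gS \<omega> v) n = fps_nth (gP \<omega> v * ser A v) n)"
    by (simp only: entry)
  also have "\<dots> \<longleftrightarrow> (\<forall>\<omega>\<in>Dual. \<forall>v. gS \<omega> v = gP \<omega> v * ser A v)"
    unfolding fps_eq_iff by blast
  finally show ?thesis .
qed

subsection \<open>The shift-invariant operator as a power series in the derivative\<close>

lemma diff_subst_outside: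
  assumes "\<tau> \<in> Series" "p \<in> Polys" "\<omega> \<notin> Dual"
  shows "diff_subst s \<tau> p \<omega> = 0"
proof -
  have "diff_pow s k p \<omega> = 0" for k
    by (rule polys_in_outside[OF vector_space_tscale lin_opsD(1)[OF diff_pow_mon(1) assms(2)] assms(3)])
  then show ?thesis
    using polys_outside[OF assms(2,3)] lin_ops_zero_value[OF tps_setD[OF assms(1)]]
    by (simp add: diff_subst_def)
qed

lemma comp_F0:
  assumes "A \<in> tps_F0 s" "C \<in> Vseries"
  shows "tps_comp s A C \<in> tps_F0 s"
proof -
  have "tps_at0 s (tps_comp s A C) = tps_at0 s A"
    by (simp add: tps_at0_eq[of _ 0] tps_comp_apply tpow_0[OF assms(2)])
  then show ?thesis
    using assms comp_in[OF _ assms(2) field_space] by (simp add: tps_F0_def)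
qed

text \<open>
  Apply \<tau>(D) to each component of P_n. This gives the coefficients of the series \<tau>(v) exp(\<omega>(v)) into
  which B is then substituted, and substitution is multiplicative.
\<close>
lemma diff_subst_P:
  assumes "\<tau> \<in> Series" "\<omega> \<in> Dual"
  shows "diff_subst s \<tau> (P (mon n (pw n v))) \<omega> = fact n * fps_nth (ser (tps_comp s \<tau> B) v * gP \<omega> v) n"
proof -
  let ?h = "\<lambda>k. tps_tpow s B k n (pw n v)"
  let ?E = "tps_mult s (*) UNIV \<tau> (exp_series \<omega>)"
  have h: "?h k \<in> Sym k" for k by (intro tpow_in_Sym BV tensor_pow_in_Sym)
  have E: "?E \<in> Series" by (intro ser_mult assms exp_series_in)
  have "diff_subst s \<tau> (P (mon n (pw n v))) = (\<Sum>k\<le>n. diff_subst s \<tau> (mon k (tscale (fact n / fact k) (?h k))))"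
    unfolding P_power
    by (rule lin_ops_sum_value[OF diff_subst_in[OF assms(1)] subspace_polys vector_space_fscale])
      (intro mon_in_polys Sym_scale h)
  then have "diff_subst s \<tau> (P (mon n (pw n v))) \<omega> =
      (\<Sum>k\<le>n. fact k * ?E k (tscale (fact n / fact k) (?h k)))"
    by (simp add: sum_fun_apply diff_subst_mon[OF assms(1) Sym_scale[OF h] assms(2)])
  also have "\<dots> = fact n * tps_comp s ?E B n (pw n v)"
    unfolding tps_comp_apply sum_distrib_left
    by (intro sum.cong refl) (simp add: lin_opsD(3)[OF tps_setD[OF E] h])
  also have "tps_comp s ?E B = tps_mult s (*) UNIV (tps_comp s \<tau> B) (gen_fun s P \<omega>)"
    using gen assms by (simp add: comp_mult[OF _ exp_series_in BV] exp_series_comp[OF _ BV])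
  also have "\<dots> n (pw n v) = fps_nth (ser (tps_comp s \<tau> B) v * gP \<omega> v) n"
    unfolding ser_mult(2)[OF comp_in[OF assms(1) BV field_space] gen_fun_in[OF P], symmetric] ser_nth ..
  finally show ?thesis .
qed

text \<open>
  Since \<tau> o B = A^(-1), the factor A in the generating function of S is cancelled by \<tau>(D); hence \<tau>(D)
  and T agree on the polynomials S_n(v^n), which span.
\<close>
lemma right_quotient_eq_diff_subst:
  assumes A: "A \<in> tps_F0 s" and g: "\<forall>\<omega>\<in>Dual. \<forall>v. gS \<omega> v = gP \<omega> v * ser A v"
  defines "\<tau> \<equiv> tps_comp s (tps_inverse s A) (tps_comp_inverse s B)"
  shows "\<tau> \<in> tps_F0 s" "right_quotient = diff_subst s \<tau>"
proof -
  note L = comp_inverse[OF B]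
  note LV = F1_Vseries[OF L(1)]
  show F0: "\<tau> \<in> tps_F0 s"
    unfolding \<tau>_def by (intro comp_F0 F0_inverse(1) A LV)
  then have \<tau>: "\<tau> \<in> Series" by (simp add: tps_F0_def)
  have A': "tps_inverse s A \<in> Series" using F0_inverse(1)[OF A] by (simp add: tps_F0_def)
  have "tps_comp s \<tau> B = tps_inverse s A"
    unfolding \<tau>_def comp_assoc[OF A' LV BV field_space] L(2) by (rule comp_ident_right[OF A' field_space])
  then have \<tau>B: "ser (tps_comp s \<tau> B) v = inverse (ser A v)" for v
    using F0_inverse(3)[OF A] by simp
  have A_unit: "ser A v * inverse (ser A v) = 1" for v
    using A by (simp add: tps_F0_def tps_at0_eq[of _ v] inverse_mult_eq_1')
  have mp: "mon n (pw n v) \<in> Polys" for n v by (intro mon_in_polys tensor_pow_in_Sym)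
  have X: "right_quotient \<circ> S = diff_subst s \<tau> \<circ> S"
  proof (rule lin_ops_polys_eqI[OF vector_space_fscale])
    show "right_quotient \<circ> S \<in> lin_ops fscale fscale Polys Polys"
      using right_quotient_in S unfolding poly_lin_ops_def by (rule lin_ops_comp)
    show "diff_subst s \<tau> \<circ> S \<in> lin_ops fscale fscale Polys UNIV"
      using diff_subst_in[OF \<tau>] S unfolding poly_lin_ops_def by (rule lin_ops_comp)
    fix n v
    let ?c = "\<lambda>k. fact k * A k (pw k v)"
    have "Abs_fps (\<lambda>n. ?c n / fact n) = ser A v" by (simp add: fps_eq_iff)
    then have Sn: "S (mon n (pw n v)) =
        (\<Sum>k\<le>n. fscale (of_nat (n choose k) * ?c k) (P (mon (n - k) (pw (n - k) v))))"
      using appell_coordinates_iff[of v ?c] g unfolding P_appell by (simp add: mult.commute)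
    have Pp: "P (mon n (pw n v)) \<in> Polys" for n by (intro poly_lin_opsD(1)[OF P] mp)
    have "diff_subst s \<tau> (S (mon n (pw n v))) = P (mon n (pw n v))"
    proof
      fix \<omega>
      show "diff_subst s \<tau> (S (mon n (pw n v))) \<omega> = P (mon n (pw n v)) \<omega>"
      proof (cases "\<omega> \<in> Dual")
        case True
        have "diff_subst s \<tau> (S (mon n (pw n v))) = (\<Sum>k\<le>n. diff_subst s \<tau> (fscale (of_nat (n choose k) * ?c k) (P (mon (n - k) (pw (n - k) v)))))"
          unfolding Sn
          by (rule lin_ops_sum_value[OF diff_subst_in[OF \<tau>] subspace_polys vector_space_fscale])
            (intro polys_scale Pp)
        then have "diff_subst s \<tau> (S (mon n (pw n v))) \<omega> =
            (\<Sum>k\<le>n. of_nat (n choose k) * ?c k * diff_subst s \<tau> (P (mon (n - k) (pw (n - k) v))) \<omega>)"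
          by (simp only: lin_opsD(3)[OF diff_subst_in[OF \<tau>] Pp] sum_scale_fun_apply)
        also have "\<dots> = (\<Sum>k\<le>n. fact n * (A k (pw k v) * fps_nth (inverse (ser A v) * gP \<omega> v) (n - k)))"
          unfolding diff_subst_P[OF \<tau> True] \<tau>B
          by (intro sum.cong refl) (simp add: binomial_fact)
        also have "\<dots> = fact n * fps_nth (ser A v * (inverse (ser A v) * gP \<omega> v)) n"
          by (simp add: fps_mult_nth[of "ser A v"] atLeast0AtMost sum_distrib_left)
        also have "ser A v * (inverse (ser A v) * gP \<omega> v) = gP \<omega> v"
          unfolding mult.assoc[symmetric] A_unit by simp
        also have "fact n * fps_nth (gP \<omega> v) n = P (mon n (pw n v)) \<omega>"
          by (simp add: ser_gen_fun del: ser_nth)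
        finally show ?thesis .
      next
        case False
        then show ?thesis
          using diff_subst_outside[OF \<tau> poly_lin_opsD(1)[OF S mp]] polys_outside[OF Pp] by simp
      qed
    qed
    then show "(right_quotient \<circ> S) (mon n (pw n v)) = (diff_subst s \<tau> \<circ> S) (mon n (pw n v))"
      by (simp add: right_quotient_S mp)
  qed
  show "right_quotient = diff_subst s \<tau>"
  proof
    fix p
    show "right_quotient p = diff_subst s \<tau> p"
    proof (cases "p \<in> Polys")
      case True
      then show ?thesis
        using fun_cong[OF X, of "op_inverse s S p"] by (simp add: op_inverse_right[OF S SN])
    next
      case False
      then show ?thesis using poly_lin_opsD(4)[OF right_quotient_in] by (simp add: diff_subst_def)
    qed
  qed
qed

end

end

theorem theorem5p1:
  fixes s :: "'f::real_normed_field \<Rightarrow> 'v::ab_group_add \<Rightarrow> 'v"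
    and P S T :: "('f, 'v) poly_op"
    and B L :: "('f, 'v, 'v) tps"
    and Q :: "(('v \<Rightarrow> 'f) \<Rightarrow> 'f) \<Rightarrow> ('v \<Rightarrow> 'f) \<Rightarrow> 'v"
    and Smat :: "nat \<Rightarrow> nat \<Rightarrow> ('f, 'v) tensor \<Rightarrow> ('f, 'v) tensor"
  assumes "vector_space s"
    and "P \<in> umbral_ops s"
    and "B \<in> tps_F1 s"
    and "\<forall>\<omega>\<in>alg_dual s. gen_fun s P \<omega> = tps_exp s (\<lambda>n. \<omega> \<circ> B n)"
    and "Q = lowering_differential s P"
    and "L = tps_comp_inverse s B"
    and "S \<in> poly_seq_ops s"
    and "op_matrix s S Smat"
    and "T = P \<circ> op_inverse s S"
  shows
   "let S1 = (\<lambda>A. A \<in> tps_F0 s \<and>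
          (\<forall>\<omega>\<in>alg_dual s.
             gen_fun s S \<omega> = tps_mult s (*) UNIV (tps_exp s (\<lambda>n. \<omega> \<circ> B n)) A));
        S2 = shift_invariant s T;
        S3 = (lowering_differential s S = Q);
        S4 = (\<forall>\<omega>\<in>alg_dual s. \<forall>\<theta>\<in>alg_dual s. \<forall>n\<ge>1.
          poly_seq s S n (\<omega> + \<theta>) =
            (\<Sum>k\<le>n. scale_fun (*) (of_nat (n choose k))
               (op_prod s (*) UNIV k (n - k) (poly_seq s S k \<omega>) (poly_seq s P (n - k) \<theta>))));
        S5 = (\<lambda>\<rho>. \<rho> \<in> tps_F0 s \<and>
          (\<forall>\<omega>\<in>alg_dual s. \<forall>n.
             poly_seq s S n \<omega> =
               (\<Sum>k\<le>n. scale_fun (*) (of_nat (n choose k))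
                  (op_prod s (*) UNIV k (n - k) (\<rho> k) (poly_seq s P (n - k) \<omega>)))));
        S6 = (\<lambda>A. A \<in> tps_F0 s \<and>
          (\<forall>k. (\<lambda>n. if k \<le> n then scale_fun tscale (fact k / fact n) (Smat k n) else 0) =
             tps_mult s tscale (sym_power s k) A (tps_tpow s B k)))
    in
      ((\<exists>A. S1 A) \<longleftrightarrow> S2) \<and> (S2 \<longleftrightarrow> S3) \<and> (S3 \<longleftrightarrow> S4) \<and>
      (S4 \<longleftrightarrow> (\<exists>\<rho>. S5 \<rho>)) \<and> ((\<exists>\<rho>. S5 \<rho>) \<longleftrightarrow> (\<exists>A. S6 A)) \<and>
      ((\<exists>A. S1 A) \<longrightarrow> sheffer s S) \<and>
      T \<in> poly_lin_ops s \<and>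
      (\<forall>n. \<forall>f\<in>sym_power s n.
         T (\<lambda>\<omega>. poly_seq s S n \<omega> f) = (\<lambda>\<omega>. poly_seq s P n \<omega> f)) \<and>
      (\<forall>A A'. S1 A \<and> S6 A' \<longrightarrow> A = A') \<and>
      (\<forall>A \<rho>. S1 A \<and> S5 \<rho> \<longrightarrow> (\<forall>k. \<rho> k = scale_fun (*) (fact k) (A k))) \<and>
      (\<forall>A. S1 A \<longrightarrow>
         (let \<tau> = tps_comp s (tps_inverse s A) L in \<tau> \<in> tps_F0 s \<and> T = diff_subst s \<tau>))"
proof -
  interpret normed_sym_tensors s
    using assms(1) by (simp add: normed_sym_tensors_def sym_tensors_def)
  have umbral: "P \<in> umbral_ops s" and B: "B \<in> tps_F1 s"
    and gen: "\<forall>\<omega>\<in>alg_dual s. gen_fun s P \<omega> = tps_exp s (\<lambda>n. \<omega> \<circ> B n)"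
    and S: "S \<in> poly_lin_ops s" and SN: "op_matrix s S Smat"
    using assms by (auto simp: poly_seq_ops_def)
  obtain M where PM: "op_matrix s P M"
    using umbral by (auto simp: umbral_ops_def poly_seq_ops_def)
  note ctx = umbral PM B gen S SN
  \<comment> \<open>The common form of all conditions on S.\<close>
  define g where "g A \<longleftrightarrow> (\<forall>\<omega>\<in>alg_dual s. \<forall>v.
      ser (gen_fun s S \<omega>) v = ser (gen_fun s P \<omega>) v * ser A v)" for A
  \<comment> \<open>The passage from the coefficients \<open>\<rho>\<^sub>k\<close> to the coefficients of A.\<close>
  define rescale where "rescale \<rho> = (\<lambda>k. scale_fun (*) (1 / fact k) (\<rho> k))"
    for \<rho> :: "('f, 'v, 'f) tps"
  have rescale_F0: "rescale \<rho> \<in> tps_F0 s" if "\<rho> \<in> tps_F0 s" for \<rho>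
    using that
    by (auto simp: tps_F0_def tps_set_def tps_at0_def rescale_def scale_fun_apply
        intro: lin_ops_scale[OF field_space])
  have unrescale_F0: "(\<lambda>k. scale_fun (*) (fact k) (A k)) \<in> tps_F0 s" if "A \<in> tps_F0 s" for A
    using that
    by (auto simp: tps_F0_def tps_set_def tps_at0_def scale_fun_apply
        intro: lin_ops_scale[OF field_space])
  have rescale_unrescale: "rescale (\<lambda>k. scale_fun (*) (fact k) (A k)) = A" for A
    by (auto simp: rescale_def scale_fun_def fun_eq_iff)
  have g_unique: "A = A'" if "A \<in> tps_F0 s" "A' \<in> tps_F0 s" "g A" "g A'" for A A'
  proof (rule ser_inject)
    show "A \<in> Series" "A' \<in> Series" using that by (auto simp: tps_F0_def)
    show "ser A v = ser A' v" for v
      using that(3,4) zero_in_Dual gP_zero[OF ctx, of v] unfolding g_def by (metis mult_1)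
  qed
  let ?S1 = "\<lambda>A. A \<in> tps_F0 s \<and> (\<forall>\<omega>\<in>alg_dual s.
      gen_fun s S \<omega> = tps_mult s (*) UNIV (tps_exp s (\<lambda>n. \<omega> \<circ> B n)) A)"
  let ?S3 = "lowering_differential s S = Q"
  let ?S4 = "\<forall>\<omega>\<in>alg_dual s. \<forall>\<theta>\<in>alg_dual s. \<forall>n\<ge>1. poly_seq s S n (\<omega> + \<theta>) =
      (\<Sum>k\<le>n. scale_fun (*) (of_nat (n choose k))
        (op_prod s (*) UNIV k (n - k) (poly_seq s S k \<omega>) (poly_seq s P (n - k) \<theta>)))"
  let ?S5 = "\<lambda>\<rho>. \<rho> \<in> tps_F0 s \<and> (\<forall>\<omega>\<in>alg_dual s. \<forall>n. poly_seq s S n \<omega> =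
      (\<Sum>k\<le>n. scale_fun (*) (of_nat (n choose k))
        (op_prod s (*) UNIV k (n - k) (\<rho> k) (poly_seq s P (n - k) \<omega>))))"
  let ?S6 = "\<lambda>A. A \<in> tps_F0 s \<and>
      (\<forall>k. (\<lambda>n. if k \<le> n then scale_fun tscale (fact k / fact n) (Smat k n) else 0) =
         tps_mult s tscale (sym_power s k) A (tps_tpow s B k))"
  have S1: "?S1 A \<longleftrightarrow> A \<in> tps_F0 s \<and> g A" for A
    using generating_function_iff[OF ctx] unfolding g_def by blast
  have S6: "?S6 A \<longleftrightarrow> A \<in> tps_F0 s \<and> g A" for A
    using matrix_entries_iff[OF ctx, of A] unfolding g_def by (auto simp only: tps_F0_def mem_Collect_eq)
  have S5: "?S5 \<rho> \<longleftrightarrow> \<rho> \<in> tps_F0 s \<and> g (rescale \<rho>)" for \<rho>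
  proof -
    have "\<rho> n \<in> Functionals n" if "\<rho> \<in> tps_F0 s" for n
      using that by (simp add: tps_F0_def tps_set_def)
    then show ?thesis
      using binomial_expansion_iff[OF ctx, of \<rho>] unfolding g_def rescale_def
      by (auto simp only: mult.commute[of "ser (gen_fun s P _) _"])
  qed
  have S3: "?S3 \<longleftrightarrow> (\<exists>A\<in>tps_F0 s. g A)"
    unfolding assms(5) g_def by (rule lowering_differential_iff_sheffer[OF ctx])
  have S4: "?S4 \<longleftrightarrow> (\<exists>A\<in>tps_F0 s. g A)"
    unfolding binomial_type_iff[OF ctx]
  proof
    assume "\<forall>\<omega>\<in>Dual. \<forall>\<theta>\<in>Dual. \<forall>v. ser (gen_fun s S (\<omega> + \<theta>)) v = ser (gen_fun s S \<omega>) v * ser (gen_fun s P \<theta>) v"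
    from binomial_type_imp_sheffer[OF ctx this] show "\<exists>A\<in>tps_F0 s. g A" unfolding g_def by blast
  next
    assume "\<exists>A\<in>tps_F0 s. g A"
    then obtain A where "g A" by blast
    then show "\<forall>\<omega>\<in>Dual. \<forall>\<theta>\<in>Dual. \<forall>v. ser (gen_fun s S (\<omega> + \<theta>)) v = ser (gen_fun s S \<omega>) v * ser (gen_fun s P \<theta>) v"
      unfolding g_def by (simp add: gP_add[OF ctx] add_in_Dual mult_ac)
  qed
  have T: "T = right_quotient P S"
    unfolding right_quotient_def[OF ctx] by (rule assms(9))
  have S2: "shift_invariant s T \<longleftrightarrow> (\<exists>A\<in>tps_F0 s. g A)"
    unfolding T shift_invariant_iff_binomial_type[OF ctx] binomial_type_iff[OF ctx, symmetric] by (rule S4)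
  have S5_ex: "(\<exists>\<rho>. ?S5 \<rho>) \<longleftrightarrow> (\<exists>A\<in>tps_F0 s. g A)"
    unfolding S5 using rescale_F0 unrescale_F0 rescale_unrescale by metis
  have sheffer: "sheffer s S" if "?S1 A" for A
    unfolding sheffer_def using that assms(7) B by blast
  have T_seq: "T (\<lambda>\<omega>. poly_seq s S n \<omega> f) = (\<lambda>\<omega>. poly_seq s P n \<omega> f)" if "f \<in> sym_power s n" for n f
  proof -
    have "(\<lambda>\<omega>. poly_seq s R n \<omega> f) = R (mon n f)" for R
      using that by (simp add: poly_seq_def)
    then show ?thesis
      unfolding T by (simp only: right_quotient_S[OF ctx mon_in_polys[OF that]])
  qed
  have rho: "\<rho> k = scale_fun (*) (fact k) (A k)" if "?S1 A" "?S5 \<rho>" for A \<rho> k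
  proof -
    have "A = rescale \<rho>"
      using that rescale_F0 g_unique unfolding S1 S5 by blast
    then show ?thesis by (simp add: rescale_def scale_fun_def)
  qed
  have tau: "tps_comp s (tps_inverse s A) L \<in> tps_F0 s \<and> T = diff_subst s (tps_comp s (tps_inverse s A) L)"
    if "?S1 A" for A
    using right_quotient_eq_diff_subst[OF ctx, of A] that unfolding S1 g_def assms(6) T by blast
  show ?thesis
    unfolding Let_def
  proof (intro conjI)
    show "(\<exists>A. ?S1 A) \<longleftrightarrow> shift_invariant s T" unfolding S1 S2 by blast
    show "shift_invariant s T \<longleftrightarrow> ?S3" unfolding S2 S3 ..
    show "?S3 \<longleftrightarrow> ?S4" unfolding S3 S4 ..
    show "?S4 \<longleftrightarrow> (\<exists>\<rho>. ?S5 \<rho>)" unfolding S4 S5_ex ..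
    show "(\<exists>\<rho>. ?S5 \<rho>) \<longleftrightarrow> (\<exists>A. ?S6 A)" unfolding S5_ex S6 by blast
    show "(\<exists>A. ?S1 A) \<longrightarrow> sheffer s S" using sheffer by blast
    show "T \<in> poly_lin_ops s" unfolding T by (rule right_quotient_in[OF ctx])
    show "\<forall>n. \<forall>f\<in>sym_power s n. T (\<lambda>\<omega>. poly_seq s S n \<omega> f) = (\<lambda>\<omega>. poly_seq s P n \<omega> f)"
      using T_seq by blast
    show "\<forall>A A'. ?S1 A \<and> ?S6 A' \<longrightarrow> A = A'"
      unfolding S1 S6 using g_unique by blast
    show "\<forall>A \<rho>. ?S1 A \<and> ?S5 \<rho> \<longrightarrow> (\<forall>k. \<rho> k = scale_fun (*) (fact k) (A k))"
      using rho by blast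
    show "\<forall>A. ?S1 A \<longrightarrow> tps_comp s (tps_inverse s A) L \<in> tps_F0 s \<and>
        T = diff_subst s (tps_comp s (tps_inverse s A) L)"
      using tau by blast
  qed
qed

end
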